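(* There exists a randomized algorithm that, given strings $X$ and $Y$, integers $k$ and $\ell$ such that $\operatorname{per}(X[i\mathinner{.\,.} i+\ell))>2k$ for each $i\in[0\mathinner{.\,.}|X|-\ell]$, and a real parameter $0<\varepsilon<1$, returns YES if $\mathsf{ED}(X,Y)\le k$, and returns NO if $\mathsf{ED}(X,Y)\ge(1+\varepsilon)k$. With high probability, the algorithm is correct and its running time is $\tilde{\mathcal{O}}\big(\frac{1}{\varepsilon^2(k+1)}|X|+k^2\ell\big)$.
   Context: Strings are finite sequences over an alphabet $\Sigma$, indexed from $0$; the algorithm has random access to the characters of $X$ and $Y$. For integers $a\le b$, $[a\mathinner{.\,.} b)=\{j\in\mathbb{Z}: a\le j<b\}$, $[a\mathinner{.\,.} b]=\{j\in\mathbb{Z}:a\le j\le b\}$, and $X[a\mathinner{.\,.} b)$ denotes the substring $X[a]X[a+1]\cdots X[b-1]$. A positive integer $p$ is a period of a string $S$ if $S[i]=S[i+p]$ for all $i\in[0\mathinner{.\,.}|S|-p)$; $\operatorname{per}(S)$ is the smallest period of $S$. $\mathsf{ED}$ is edit distance (insertions, deletions, substitutions). $\tilde{\mathcal{O}}$ hides factors polylogarithmic in the input size and in the inverse error probability; "with high probability" means with probability at least $1-1/N^c$ for an arbitrarily large constant $c$, $N$ the input size.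
   Formalization: For k=0 and X=Y the text demands both YES and NO; here NO is required only if also ED(X,Y)>k (automatic for k≥1), so the answer is YES. The time bound is replaced by its maximum with 1, which matters only for X empty and k=0. *)

theory Defs
  imports "HOL-Probability.Probability"
begin

section \<open>Strings\<close>

text \<open>The substring \<open>X[a..b)\<close>.\<close>

definition substring :: "'a list \<Rightarrow> nat \<Rightarrow> nat \<Rightarrow> 'a list" where
  "substring X a b = take (b - a) (drop a X)"

definition is_period :: "nat \<Rightarrow> 'a list \<Rightarrow> bool" where
  "is_period p S \<longleftrightarrow> p > 0 \<and> (\<forall>i. i + p < length S \<longrightarrow> S ! i = S ! (i + p))"

definition per :: "'a list \<Rightarrow> nat" where
  "per S = (LEAST p. is_period p S)"

inductive edit_step :: "'a list \<Rightarrow> 'a list \<Rightarrow> bool" where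
  insertion: "edit_step (u @ v) (u @ a # v)"
| deletion: "edit_step (u @ a # v) (u @ v)"
| substitution: "edit_step (u @ a # v) (u @ b # v)"

definition ED :: "'a list \<Rightarrow> 'a list \<Rightarrow> nat" where
  "ED X Y = (LEAST n. (edit_step ^^ n) X Y)"


section \<open>Randomized word RAM\<close>

text \<open>
  The model of computation is the unit-cost word RAM with word size \<open>w\<close>: every memory cell holds
  a number below \<open>2 ^ w\<close>.  The strings are read-only and accessed one character at a time;
  characters are words.  The real parameter \<open>eps\<close> is accessible only through the words
  \<open>\<lfloor>eps * a\<rfloor>\<close>, where \<open>a\<close> is a word.  A program is a finite list of instructions that does not
  depend on the input or on \<open>w\<close>.
\<close>

datatype ram_input =
  Input (str_X: "nat list") (str_Y: "nat list") (thr: nat) (win: nat) (eps: real)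

datatype binop = Add | Sub | Mul | Div | Mod | And | Or | Xor | Shl | Shr

datatype instr =
    Const nat nat
  | Copy nat nat
  | Load nat nat
  | Store nat nat
  | Op binop nat nat nat
  | Read_X nat nat
  | Read_Y nat nat
  | Mul_Eps nat nat
  | Rand nat
  | Jump nat
  | Jump_Less nat nat nat
  | Halt bool

type_synonym program = "instr list"

text \<open>\<open>Halted True\<close> is the answer YES and \<open>Halted False\<close> is the answer NO.\<close>

datatype config = Running nat "nat \<Rightarrow> nat" | Halted bool

context
  includes bit_operations_syntax
begin

text \<open>Arithmetic wraps around modulo \<open>2 ^ w\<close>; division by zero yields zero.\<close>

fun binop_sem :: "nat \<Rightarrow> binop \<Rightarrow> nat \<Rightarrow> nat \<Rightarrow> nat" where
  "binop_sem w Add x y = (x + y) mod 2 ^ w"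
| "binop_sem w Sub x y = (x + 2 ^ w - y) mod 2 ^ w"
| "binop_sem w Mul x y = (x * y) mod 2 ^ w"
| "binop_sem w Div x y = x div y"
| "binop_sem w Mod x y = x mod y"
| "binop_sem w And x y = x AND y"
| "binop_sem w Or x y = x OR y"
| "binop_sem w Xor x y = x XOR y"
| "binop_sem w Shl x y = (x * 2 ^ y) mod 2 ^ w"
| "binop_sem w Shr x y = x div 2 ^ y"

end

text \<open>Reading beyond the end of a string yields \<open>0\<close>.\<close>

definition char_at :: "nat list \<Rightarrow> nat \<Rightarrow> nat" where
  "char_at S i = (if i < length S then S ! i else 0)"

text \<open>
  The effect of one instruction at program counter \<open>pc\<close> on memory \<open>m\<close>.  In \<open>Load r s\<close> and
  \<open>Store r s\<close> the contents of cell \<open>s\<close>, respectively \<open>r\<close>, serve as an address.  \<open>Rand r\<close> draws a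
  uniformly random word, independently of all earlier draws.
\<close>

fun exec :: "nat \<Rightarrow> ram_input \<Rightarrow> instr \<Rightarrow> nat \<Rightarrow> (nat \<Rightarrow> nat) \<Rightarrow> config pmf" where
  "exec w I (Const r c) pc m = return_pmf (Running (Suc pc) (m(r := c mod 2 ^ w)))"
| "exec w I (Copy r s) pc m = return_pmf (Running (Suc pc) (m(r := m s)))"
| "exec w I (Load r s) pc m = return_pmf (Running (Suc pc) (m(r := m (m s))))"
| "exec w I (Store r s) pc m = return_pmf (Running (Suc pc) (m(m r := m s)))"
| "exec w I (Op f r s t) pc m =
     return_pmf (Running (Suc pc) (m(r := binop_sem w f (m s) (m t))))"
| "exec w I (Read_X r s) pc m = return_pmf (Running (Suc pc) (m(r := char_at (str_X I) (m s))))"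
| "exec w I (Read_Y r s) pc m = return_pmf (Running (Suc pc) (m(r := char_at (str_Y I) (m s))))"
| "exec w I (Mul_Eps r s) pc m =
     return_pmf (Running (Suc pc) (m(r := nat \<lfloor>eps I * real (m s)\<rfloor>)))"
| "exec w I (Rand r) pc m =
     map_pmf (\<lambda>v. Running (Suc pc) (m(r := v))) (pmf_of_set {..<2 ^ w})"
| "exec w I (Jump l) pc m = return_pmf (Running l m)"
| "exec w I (Jump_Less r s l) pc m =
     return_pmf (Running (if m r < m s then l else Suc pc) m)"
| "exec w I (Halt b) pc m = return_pmf (Halted b)"

text \<open>A program counter outside the program gets stuck, i.e. the computation never halts.\<close>

fun step :: "nat \<Rightarrow> program \<Rightarrow> ram_input \<Rightarrow> config \<Rightarrow> config pmf" where
  "step w P I (Running pc m) =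
     (if pc < length P then exec w I (P ! pc) pc m else return_pmf (Running pc m))"
| "step w P I (Halted b) = return_pmf (Halted b)"

text \<open>
  The numerical part of the input is stored in the first four cells.
\<close>

definition init_mem :: "ram_input \<Rightarrow> nat \<Rightarrow> nat" where
  "init_mem I = (\<lambda>_. 0)(0 := length (str_X I), 1 := length (str_Y I), 2 := thr I, 3 := win I)"

text \<open>
  The distribution of the configuration after \<open>t\<close> steps.  As halted configurations are absorbing,
  \<open>Halted b\<close> after \<open>t\<close> steps means that the running time is at most \<open>t\<close> and the answer is \<open>b\<close>.
\<close>

fun run :: "nat \<Rightarrow> program \<Rightarrow> ram_input \<Rightarrow> nat \<Rightarrow> config pmf" where
  "run w P I 0 = return_pmf (Running 0 (init_mem I))"
| "run w P I (Suc t) = bind_pmf (run w P I t) (step w P I)"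

text \<open>
  Input size in words: the characters of both strings and one word for each parameter.
\<close>

definition input_size :: "ram_input \<Rightarrow> nat" where
  "input_size I = length (str_X I) + length (str_Y I) + 3"

definition fits_in_words :: "nat \<Rightarrow> ram_input \<Rightarrow> bool" where
  "fits_in_words w I \<longleftrightarrow>
     length (str_X I) < 2 ^ w \<and> length (str_Y I) < 2 ^ w \<and> thr I < 2 ^ w \<and> win I < 2 ^ w \<and>
     (\<forall>x \<in> set (str_X I) \<union> set (str_Y I). x < 2 ^ w)"


section \<open>The gap problem\<close>

text \<open>
  YES is required if \<open>ED X Y \<le> k\<close>, and NO if \<open>ED X Y \<ge> (1 + e) * k\<close>.  For \<open>k = 0\<close> and \<open>X = Y\<close> both
  conditions hold; the conjunct \<open>ED X Y > k\<close> lets YES take precedence there.  For \<open>k > 0\<close> it follows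
  from \<open>ED X Y \<ge> (1 + e) * k\<close>.
\<close>

definition correct_answer :: "ram_input \<Rightarrow> bool \<Rightarrow> bool" where
  "correct_answer I b \<longleftrightarrow>
     (ED (str_X I) (str_Y I) \<le> thr I \<longrightarrow> b) \<and>
     (ED (str_X I) (str_Y I) > thr I \<and>
      real (ED (str_X I) (str_Y I)) \<ge> (1 + eps I) * real (thr I) \<longrightarrow> \<not> b)"

text \<open>
  The lower bound \<open>1\<close> matters only if \<open>X\<close> is empty and \<open>k = 0\<close>: for \<open>k > 0\<close>, the hypothesis on the
  periods forces \<open>l > 0\<close>, as the empty string has period \<open>1\<close>.
\<close>

definition time_bound :: "ram_input \<Rightarrow> real" where
  "time_bound I =
     max 1 (1 / ((eps I)\<^sup>2 * (real (thr I) + 1)) * real (length (str_X I))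
            + (real (thr I))\<^sup>2 * real (win I))"

end

theory Submission
  imports Defs
begin

text \<open>
  The string \<open>X\<close> is cut at the positions \<open>r\<close>, \<open>r + D\<close>, \<open>r + 2 * D\<close>, ... for a uniformly random offset
  \<open>r < D\<close>, where \<open>D\<close> is about \<open>4 * (k + 1) * l\<close>.  If \<open>ED X Y \<le> k\<close>, then with probability \<open>3/4\<close> no edit
  of a fixed optimal alignment falls into a window of length \<open>l\<close> at a cut.  Such a window occurs in
  \<open>Y\<close> at the shift used by the alignment, and at no other shift between \<open>-k\<close> and \<open>k\<close> because two
  occurrences would give it a period of at most \<open>2 * k\<close>.  So the corresponding cuts of \<open>Y\<close> are found by
  comparing strings: the shift of the previous cut is tried first, and a search over all shifts
  is paid for by the edits that changed the shift.  The distances of the resulting phrases add up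
  to \<open>ED X Y\<close>; for arbitrary cuts their sum is at least \<open>ED X Y\<close>.

  The sum is estimated by sampling.  In a phrase whose two sides have equal length, mark the first
  \<open>d\<close> mismatches on its diagonal, where \<open>d\<close> is the distance of the phrase; there are at least \<open>d\<close> of them.
  One random position is tested in each stride of length about \<open>\<epsilon>\<^sup>2 * k / ln N\<close>, and each marked position
  that is hit contributes the stride length.  The distance \<open>d\<close> is computed, by banded dynamic programming in time
  proportional to \<open>d\<close> times the length of the phrase, only after a mismatch has been seen, so that
  \<open>d > 0\<close>; as a run stops when these distances exceed \<open>k\<close>, this takes time \<open>O(k * D)\<close>.  By Chernoff's inequality,
  proved here by carrying an exponential potential through the program, a run accepts YES instances with probability at
  least \<open>1/2\<close> and NO instances with polynomially small probability; \<open>O(ln N)\<close> runs suffice.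
\<close>

section \<open>A structured language for the word RAM\<close>

text \<open>Running times are bounded for every random outcome; only the answer is random. A
  distance computed in a run is truncated at \<open>2 * k + 2\<close>, so the sum of these distances
  in one run stays below \<open>3 * k + 3\<close>. It also pays for the scans of diagonals and for
  the searches: a change of shift makes the two sides of a phrase differ in length, hence have
  positive distance. Only \<open>d\<close> mismatches are marked because a diagonal may carry far
  more than \<open>d\<close>, and counting all of them would reject YES instances. How a run
  proceeds depends on earlier outcomes; a potential that does not increase on average copes with
  this. The errors are asymmetric: an unlucky offset ruins a YES run with constant probability,
  which repetition with one accepting run repairs, but then no run on a NO instance may accept, and
  this dictates the factor \<open>ln N\<close> in the stride. If
  \<open>\<epsilon>\<^sup>2 * k\<close> is below that scale, the stride is \<open>1\<close> and the
  estimate is exact. Stride and cut distance are powers of two, so that a random word reduced modulo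
  them is uniform.\<close>

datatype com =
    Blk "instr list"
  | Rnd nat
  | Stp bool
  | Seq com com (infixr ";;" 60)
  | IfL nat nat com com
  | WhileL nat nat com

fun csize :: "com \<Rightarrow> nat" where
  "csize (Blk is) = length is"
| "csize (Rnd r) = 1"
| "csize (Stp b) = 1"
| "csize (c1 ;; c2) = csize c1 + csize c2"
| "csize (IfL r s c1 c2) = csize c1 + csize c2 + 2"
| "csize (WhileL r s c) = csize c + 3"

text \<open>Jump targets are absolute, so the position \<open>p\<close> of the code is an argument.
  A conditional stores its else branch before its then branch: the jump is taken when the test
  succeeds, and the other case falls through.\<close>

fun compile :: "nat \<Rightarrow> com \<Rightarrow> program" where
  "compile p (Blk is) = is"
| "compile p (Rnd r) = [Rand r]"
| "compile p (Stp b) = [Halt b]"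
| "compile p (c1 ;; c2) = compile p c1 @ compile (p + csize c1) c2"
| "compile p (IfL r s c1 c2) =
     Jump_Less r s (p + csize c2 + 2) # compile (Suc p) c2 @
     Jump (p + csize c1 + csize c2 + 2) # compile (p + csize c2 + 2) c1"
| "compile p (WhileL r s c) =
     Jump_Less r s (p + 2) # Jump (p + csize c + 3) # compile (p + 2) c @ [Jump p]"

lemma length_compile [simp]: "length (compile p c) = csize c"
  by (induction c arbitrary: p) auto

definition code_at :: "program \<Rightarrow> nat \<Rightarrow> program \<Rightarrow> bool" where
  "code_at P p xs \<longleftrightarrow> (\<exists>A B. P = A @ xs @ B \<and> length A = p)"

lemma code_at_append:
  "code_at P p (xs @ ys) \<longleftrightarrow> code_at P p xs \<and> code_at P (p + length xs) ys"
proof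
  assume "code_at P p (xs @ ys)"
  then obtain A B where *: "P = A @ (xs @ ys) @ B" "length A = p"
    by (auto simp: code_at_def)
  have "P = A @ xs @ (ys @ B)" "P = (A @ xs) @ ys @ B" using * by auto
  then show "code_at P p xs \<and> code_at P (p + length xs) ys"
    unfolding code_at_def using *(2) by (metis length_append)
next
  assume "code_at P p xs \<and> code_at P (p + length xs) ys"
  then obtain A B A' B' where *: "P = A @ xs @ B" "length A = p"
    "P = A' @ ys @ B'" "length A' = p + length xs"
    unfolding code_at_def by blast
  have "A' = A @ xs"
    using * by (metis append.assoc append_eq_append_conv length_append)
  with * show "code_at P p (xs @ ys)"
    unfolding code_at_def by (metis append.assoc)
qed

lemma code_at_Cons:
  "code_at P p (x # xs) \<longleftrightarrow> p < length P \<and> P ! p = x \<and> code_at P (Suc p) xs"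
proof -
  have "code_at P p [x] \<longleftrightarrow> p < length P \<and> P ! p = x"
  proof
    assume "code_at P p [x]"
    then show "p < length P \<and> P ! p = x"
      by (auto simp: code_at_def nth_append)
  next
    assume "p < length P \<and> P ! p = x"
    then have "P = take p P @ [x] @ drop (Suc p) P" "length (take p P) = p"
      using id_take_nth_drop[of p P] by simp_all
    then show "code_at P p [x]" unfolding code_at_def by blast
  qed
  then show ?thesis using code_at_append[of P p "[x]" xs] by simp
qed

section \<open>Failure probabilities and a program logic that bounds them\<close>

locale ram =
  fixes w :: nat and I :: ram_input
begin

definition good :: "config set" where
  "good = {s. \<exists>b. s = Halted b \<and> correct_answer I b}"

fun run_from :: "program \<Rightarrow> nat \<Rightarrow> config \<Rightarrow> config pmf" where
  "run_from P 0 s = return_pmf s"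
| "run_from P (Suc t) s = bind_pmf (step w P I s) (run_from P t)"

text \<open>\<open>run_from\<close> peels off the first step, as the program logic needs;
  \<open>run\<close> adds steps at the end, and so do the arguments about absorbing
  configurations.\<close>

lemma run_from_Suc': "run_from P (Suc t) s = bind_pmf (run_from P t s) (step w P I)"
proof (induction t arbitrary: s)
  case 0
  have "run_from P 0 = return_pmf" by (rule ext) simp
  then show ?case by (simp add: bind_return_pmf bind_return_pmf')
next
  case (Suc t)
  have "run_from P (Suc (Suc t)) s = bind_pmf (step w P I s) (run_from P (Suc t))" by simp
  also have "\<dots> = bind_pmf (step w P I s) (\<lambda>x. bind_pmf (run_from P t x) (step w P I))"
    using Suc by (intro bind_pmf_cong) auto
  finally show ?case by (simp add: bind_assoc_pmf)
qed

lemma run_eq_run_from: "run w P I t = run_from P t (Running 0 (init_mem I))"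
  by (induction t) (simp_all only: run.simps run_from_Suc' run_from.simps(1))

text \<open>A configuration counts as failed if it shows a wrong answer or has not halted yet. Hence
  a bound on \<open>bad\<close> after \<open>t\<close> steps covers correctness and running time at
  once.\<close>

definition bad :: "program \<Rightarrow> nat \<Rightarrow> config \<Rightarrow> real" where
  "bad P t s = measure_pmf.prob (run_from P t s) (- good)"

lemma bad_le_1: "bad P t s \<le> 1"
  by (simp add: bad_def)

lemma bad_return: "step w P I s = return_pmf s' \<Longrightarrow> bad P (Suc t) s = bad P t s'"
  by (simp add: bad_def bind_return_pmf)

lemma run_from_Halted: "run_from P t (Halted b) = return_pmf (Halted b)"
  by (induction t) (simp_all add: bind_return_pmf)

lemma bad_Halted: "bad P t (Halted b) = (if correct_answer I b then 0 else 1)"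
  by (simp add: bad_def run_from_Halted good_def indicator_def)

text \<open>Halted configurations are absorbing, so \<open>good\<close> is never left. This is what
  allows credits to be rounded up.\<close>

lemma bad_antimono_Suc: "bad P (Suc t) s \<le> bad P t s"
proof -
  have "emeasure (run_from P (Suc t) s) (- good)
      = (\<integral>\<^sup>+x. emeasure (step w P I x) (- good) \<partial>run_from P t s)"
    by (simp only: run_from_Suc' emeasure_bind_pmf)
  also have "\<dots> \<le> (\<integral>\<^sup>+x. indicator (- good) x \<partial>run_from P t s)"
  proof (intro nn_integral_mono)
    fix x show "emeasure (step w P I x) (- good) \<le> indicator (- good) x"
    proof (cases "x \<in> good")
      case True
      then show ?thesis by (auto simp: good_def indicator_def)
    next
      case False
      then show ?thesis by (simp add: measure_pmf.emeasure_le_1)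
    qed
  qed
  finally show ?thesis
    by (simp add: bad_def measure_pmf.emeasure_eq_measure)
qed

lemma bad_antimono: "t \<le> t' \<Longrightarrow> bad P t' s \<le> bad P t s"
  by (induction t' rule: dec_induct) (auto intro: order_trans[OF bad_antimono_Suc])

lemma bad_Rand:
  assumes "p < length P" "P ! p = Rand r"
  shows "bad P (Suc t) (Running p m) = (\<Sum>v<2^w. bad P t (Running (Suc p) (m(r := v)))) / 2^w"
proof -
  have "bad P (Suc t) (Running p m)
     = measure_pmf.expectation (bind_pmf (pmf_of_set {..<2 ^ w})
          (\<lambda>v. run_from P t (Running (Suc p) (m(r := v))))) (indicator (- good))"
    using assms by (simp add: bad_def bind_map_pmf)
  also have "\<dots> = (\<Sum>v<2^w. measure_pmf.expectation (run_from P t (Running (Suc p) (m(r := v))))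
       (indicator (- good))) / 2^w"
  proof -
    have "emeasure (bind_pmf (pmf_of_set {..<2 ^ w :: nat})
          (\<lambda>v. run_from P t (Running (Suc p) (m(r := v))))) (- good)
      = (\<integral>\<^sup>+v. ennreal (measure (run_from P t (Running (Suc p) (m(r := v)))) (- good))
           \<partial>pmf_of_set {..<2 ^ w :: nat})"
      unfolding emeasure_bind_pmf by (simp only: measure_pmf.emeasure_eq_measure)
    also have "\<dots> = ennreal (measure_pmf.expectation (pmf_of_set {..<2 ^ w :: nat})
        (\<lambda>v. measure (run_from P t (Running (Suc p) (m(r := v)))) (- good)))"
      by (intro nn_integral_eq_integral measure_pmf.integrable_const_bound[where B = 1]) auto
    finally have "measure (bind_pmf (pmf_of_set {..<2 ^ w :: nat})
          (\<lambda>v. run_from P t (Running (Suc p) (m(r := v))))) (- good)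
      = measure_pmf.expectation (pmf_of_set {..<2 ^ w :: nat})
        (\<lambda>v. measure (run_from P t (Running (Suc p) (m(r := v)))) (- good))"
      by (simp add: measure_pmf.emeasure_eq_measure integral_nonneg)
    also have "\<dots> = (\<Sum>v<2^w. measure (run_from P t (Running (Suc p) (m(r := v)))) (- good)) / 2^w"
      by (subst integral_pmf_of_set) (auto simp: lessThan_empty_iff)
    finally show ?thesis by simp
  qed
  finally show ?thesis by (simp add: bad_def)
qed

text \<open>
  \<open>V c f a m u\<close>: started in memory \<open>m\<close> with \<open>a\<close> time credits, \<open>c\<close> fails with probability at most
  \<open>u\<close>, provided that its continuation fails with probability at most \<open>f b m'\<close> if it is started in
  \<open>m'\<close> with \<open>b\<close> credits.  The slack \<open>k\<close> pays for the jumps that follow the body of a conditional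
  or a loop.
\<close>

definition V :: "com \<Rightarrow> (nat \<Rightarrow> (nat \<Rightarrow> nat) \<Rightarrow> real) \<Rightarrow> nat \<Rightarrow> (nat \<Rightarrow> nat) \<Rightarrow> real \<Rightarrow> bool" where
  "V c f a m u \<longleftrightarrow> (\<forall>P p k. code_at P p (compile p c) \<longrightarrow>
     (\<forall>b m'. b \<le> a \<longrightarrow> bad P (b + k) (Running (p + csize c) m') \<le> f b m') \<longrightarrow>
     bad P (a + k) (Running p m) \<le> u)"

lemma VD: "V c f a m u \<Longrightarrow> code_at P p (compile p c) \<Longrightarrow>
    (\<And>b m'. b \<le> a \<Longrightarrow> bad P (b + k) (Running (p + csize c) m') \<le> f b m') \<Longrightarrow>
    bad P (a + k) (Running p m) \<le> u"
  unfolding V_def by blast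

lemma V_mono: "V c f a m u \<Longrightarrow> a \<le> a' \<Longrightarrow> u \<le> u' \<Longrightarrow> V c f a' m u'"
  unfolding V_def by (meson add_le_mono1 bad_antimono order_trans)

text \<open>\<open>T c a m Q\<close>: every outcome satisfies \<open>Q b m'\<close>, where \<open>b\<close> is the number of unused credits.\<close>

definition T :: "com \<Rightarrow> nat \<Rightarrow> (nat \<Rightarrow> nat) \<Rightarrow> (nat \<Rightarrow> (nat \<Rightarrow> nat) \<Rightarrow> bool) \<Rightarrow> bool" where
  "T c a m Q \<longleftrightarrow> (\<forall>f u. (\<forall>b m'. Q b m' \<longrightarrow> f b m' \<le> u) \<longrightarrow> V c f a m u)"

lemma T_V: "T c a m Q \<Longrightarrow> (\<And>b m'. Q b m' \<Longrightarrow> f b m' \<le> u) \<Longrightarrow> V c f a m u"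
  unfolding T_def by blast

text \<open>Failure probabilities are at most \<open>1\<close>, so intermediate states with
  \<open>g b m' \<ge> 1\<close> need no argument. Bounds of the form
  \<open>if Inv b m then J m else 1\<close> thus carry a postcondition inside a real-valued
  bound.\<close>

lemma V_seq:
  assumes "V c1 g a m u" "\<And>b m'. g b m' < 1 \<Longrightarrow> V c2 f b m' (g b m')"
  shows "V (c1 ;; c2) f a m u"
  unfolding V_def
proof (intro allI impI)
  fix P p k
  assume *: "code_at P p (compile p (c1 ;; c2))"
    "\<forall>b m'. b \<le> a \<longrightarrow> bad P (b + k) (Running (p + csize (c1 ;; c2)) m') \<le> f b m'"
  have c: "code_at P p (compile p c1)" "code_at P (p + csize c1) (compile (p + csize c1) c2)"
    using *(1) by (simp_all add: code_at_append)
  show "bad P (a + k) (Running p m) \<le> u"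
  proof (rule VD[OF assms(1) c(1)])
    fix b m' assume b: "b \<le> a"
    show "bad P (b + k) (Running (p + csize c1) m') \<le> g b m'"
    proof (cases "g b m' < 1")
      case True
      show ?thesis
        by (rule VD[OF assms(2)[OF True] c(2)]) (use *(2) b in \<open>simp add: add.assoc\<close>)
    next
      case False
      then show ?thesis using bad_le_1[of P "b + k" "Running (p + csize c1) m'"] by linarith
    qed
  qed
qed

lemma V_seq_T:
  assumes "T c1 a m Q" "\<And>b m'. Q b m' \<Longrightarrow> V c2 f b m' u"
  shows "V (c1 ;; c2) f a m u"
proof -
  define g where "g b m' = (if V c2 f b m' u then u else 1)" for b m'
  have "V c1 g a m u"
    by (rule T_V[OF assms(1)]) (simp add: g_def assms(2))
  then show ?thesis
    by (rule V_seq) (auto simp: g_def split: if_splits)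
qed

lemma T_seq:
  assumes "T c1 a m (\<lambda>b m'. T c2 b m' Q)"
  shows "T (c1 ;; c2) a m Q"
  unfolding T_def
  by (intro allI impI, rule V_seq_T[OF assms]) (auto intro: T_V)

lemma T_mono: "T c a m Q \<Longrightarrow> (\<And>b m'. Q b m' \<Longrightarrow> Q' b m') \<Longrightarrow> T c a m Q'"
  unfolding T_def by blast

lemma V_Stp: "1 \<le> a \<Longrightarrow> (if correct_answer I b then 0 else 1) \<le> u \<Longrightarrow> V (Stp b) f a m u"
  unfolding V_def
proof (intro allI impI)
  fix P p k
  assume a: "1 \<le> a" "(if correct_answer I b then 0 else 1) \<le> u"
    and *: "code_at P p (compile p (Stp b))"
  have "step w P I (Running p m) = return_pmf (Halted b)"
    using * by (simp add: code_at_Cons)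
  then have "bad P (Suc (a - 1 + k)) (Running p m) = (if correct_answer I b then 0 else 1)"
    by (simp only: bad_return bad_Halted)
  moreover have "Suc (a - 1 + k) = a + k" using a by simp
  ultimately show "bad P (a + k) (Running p m) \<le> u" using a(2) by simp
qed

lemma V_Rnd_seq:
  assumes "1 \<le> a" "\<And>v. v < 2^w \<Longrightarrow> V c f (a - 1) (m(r := v)) (g v)"
    "(\<Sum>v<2^w. g v) / 2^w \<le> u"
  shows "V (Rnd r ;; c) f a m u"
  unfolding V_def
proof (intro allI impI)
  fix P p k
  assume *: "code_at P p (compile p (Rnd r ;; c))"
    "\<forall>b m'. b \<le> a \<longrightarrow> bad P (b + k) (Running (p + csize (Rnd r ;; c)) m') \<le> f b m'"
  have "bad P (Suc (a - 1 + k)) (Running p m)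
      = (\<Sum>v<2^w. bad P (a - 1 + k) (Running (Suc p) (m(r := v)))) / 2^w"
    using * by (intro bad_Rand) (auto simp: code_at_Cons)
  also have "\<dots> \<le> (\<Sum>v<2^w. g v) / 2^w"
  proof (intro divide_right_mono sum_mono)
    fix v :: nat assume v: "v \<in> {..<2^w}"
    show "bad P (a - 1 + k) (Running (Suc p) (m(r := v))) \<le> g v"
      by (rule VD[OF assms(2)]) (use * v in \<open>auto simp: code_at_Cons\<close>)
  qed auto
  also have "\<dots> \<le> u" by fact
  finally show "bad P (a + k) (Running p m) \<le> u" using assms(1) by simp
qed

fun det :: "instr \<Rightarrow> bool" where
  "det (Rand r) = False"
| "det (Jump l) = False"
| "det (Jump_Less r s l) = False"
| "det (Halt b) = False"
| "det _ = True"

fun eff :: "instr \<Rightarrow> (nat \<Rightarrow> nat) \<Rightarrow> nat \<Rightarrow> nat" where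
  "eff (Const r c) m = m(r := c mod 2 ^ w)"
| "eff (Copy r s) m = m(r := m s)"
| "eff (Load r s) m = m(r := m (m s))"
| "eff (Store r s) m = m(m r := m s)"
| "eff (Op f r s t) m = m(r := binop_sem w f (m s) (m t))"
| "eff (Read_X r s) m = m(r := char_at (str_X I) (m s))"
| "eff (Read_Y r s) m = m(r := char_at (str_Y I) (m s))"
| "eff (Mul_Eps r s) m = m(r := nat \<lfloor>eps I * real (m s)\<rfloor>)"
| "eff _ m = m"

fun effs :: "instr list \<Rightarrow> (nat \<Rightarrow> nat) \<Rightarrow> nat \<Rightarrow> nat" where
  "effs [] m = m"
| "effs (i # is) m = effs is (eff i m)"

lemma bad_det:
  assumes "p < length P" "P ! p = i" "det i"
  shows "bad P (Suc t) (Running p m) = bad P t (Running (Suc p) (eff i m))"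
  using assms by (cases i) (auto intro!: bad_return)

lemma bad_Blk:
  assumes "code_at P p is" "list_all det is"
  shows "bad P (length is + t) (Running p m) = bad P t (Running (p + length is) (effs is m))"
  using assms
proof (induction "is" arbitrary: p m)
  case (Cons i "is")
  then show ?case by (simp add: code_at_Cons bad_det)
qed simp

lemma T_Blk:
  assumes "list_all det is" "length is \<le> a" "Q (a - length is) (effs is m)"
  shows "T (Blk is) a m Q"
  unfolding T_def V_def
proof (intro allI impI)
  fix f u P p k
  assume *: "\<forall>b m'. Q b m' \<longrightarrow> f b m' \<le> u" "code_at P p (compile p (Blk is))"
    "\<forall>b m'. b \<le> a \<longrightarrow> bad P (b + k) (Running (p + csize (Blk is)) m') \<le> f b m'"
  have "bad P (length is + (a - length is + k)) (Running p m)
     = bad P (a - length is + k) (Running (p + length is) (effs is m))"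
    using * assms by (intro bad_Blk) auto
  also have "\<dots> \<le> f (a - length is) (effs is m)" using *(3) by simp
  also have "\<dots> \<le> u" using *(1) assms by blast
  finally show "bad P (a + k) (Running p m) \<le> u" using assms(2) by simp
qed

lemma V_IfL:
  assumes "2 \<le> a" "m r < m s \<Longrightarrow> V c1 f (a - 2) m u" "\<not> m r < m s \<Longrightarrow> V c2 f (a - 2) m u"
  shows "V (IfL r s c1 c2) f a m u"
  unfolding V_def
proof (intro allI impI)
  fix P p k
  assume *: "code_at P p (compile p (IfL r s c1 c2))"
    "\<forall>b m'. b \<le> a \<longrightarrow> bad P (b + k) (Running (p + csize (IfL r s c1 c2)) m') \<le> f b m'"
  let ?p1 = "p + csize c2 + 2"
  have at: "p < length P" "P ! p = Jump_Less r s ?p1" "code_at P (Suc p) (compile (Suc p) c2)"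
    "Suc p + csize c2 < length P" "P ! (Suc p + csize c2) = Jump (p + csize c1 + csize c2 + 2)"
    "code_at P ?p1 (compile ?p1 c1)"
    using *(1) by (auto simp: code_at_Cons code_at_append)
  \<comment> \<open>Of the two credits, one pays for the test; the other joins the slack and pays
    for the jump behind the else branch. The then branch simply drops it.\<close>
  have s: "bad P (a + k) (Running p m)
      = bad P (a - 2 + (k + 1)) (Running (if m r < m s then ?p1 else Suc p) m)"
  proof -
    have "bad P (Suc (a - 2 + (k + 1))) (Running p m)
      = bad P (a - 2 + (k + 1)) (Running (if m r < m s then ?p1 else Suc p) m)"
      using at by (intro bad_return) auto
    moreover have "Suc (a - 2 + (k + 1)) = a + k" using assms(1) by simp
    ultimately show ?thesis by (metis (no_types))
  qed
  show "bad P (a + k) (Running p m) \<le> u"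
  proof (cases "m r < m s")
    case True
    have "bad P (a - 2 + (k + 1)) (Running ?p1 m) \<le> u"
    proof (rule VD[OF assms(2)[OF True] at(6)])
      fix b m' assume "b \<le> a - 2"
      have "bad P (b + (k + 1)) (Running (?p1 + csize c1) m')
        \<le> bad P (b + k) (Running (?p1 + csize c1) m')"
        by (rule bad_antimono) simp
      also have "\<dots> \<le> f b m'" using *(2) \<open>b \<le> a - 2\<close> by (simp add: ac_simps)
      finally show "bad P (b + (k + 1)) (Running (?p1 + csize c1) m') \<le> f b m'" .
    qed
    then show ?thesis using s True by simp
  next
    case False
    have "bad P (a - 2 + (k + 1)) (Running (Suc p) m) \<le> u"
    proof (rule VD[OF assms(3)[OF False] at(3)])
      fix b m' assume "b \<le> a - 2"
      have "bad P (Suc (b + k)) (Running (Suc p + csize c2) m')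
        = bad P (b + k) (Running (p + csize c1 + csize c2 + 2) m')"
        using at by (intro bad_return) auto
      also have "\<dots> \<le> f b m'" using *(2) \<open>b \<le> a - 2\<close> by (simp add: ac_simps)
      finally show "bad P (b + (k + 1)) (Running (Suc p + csize c2) m') \<le> f b m'" by simp
    qed
    then show ?thesis using s False by simp
  qed
qed

lemma T_IfL:
  assumes "2 \<le> a" "m r < m s \<Longrightarrow> T c1 (a - 2) m Q" "\<not> m r < m s \<Longrightarrow> T c2 (a - 2) m Q"
  shows "T (IfL r s c1 c2) a m Q"
  unfolding T_def
  by (intro allI impI V_IfL assms) (auto intro: T_V[OF assms(2)] T_V[OF assms(3)])

text \<open>Every test costs credits, so induction on the credits replaces a termination measure.
  \<open>J\<close> acts as a supermartingale: an iteration from \<open>m\<close> fails with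
  probability at most \<open>J m\<close> if its outcome \<open>m'\<close> is charged
  \<open>J m'\<close>.\<close>

lemma V_WhileL:
  assumes "Inv a m"
    and step: "\<And>b m. Inv b m \<Longrightarrow> 2 \<le> b"
      "\<And>b m. Inv b m \<Longrightarrow> m r < m s \<Longrightarrow>
          V c (\<lambda>b' m'. if Inv b' m' then J m' else 1) (b - 2) m (J m)"
      "\<And>b m. Inv b m \<Longrightarrow> \<not> m r < m s \<Longrightarrow> f (b - 2) m \<le> J m"
  shows "V (WhileL r s c) f a m (J m)"
  unfolding V_def
proof (intro allI impI)
  fix P p k
  assume *: "code_at P p (compile p (WhileL r s c))"
    "\<forall>b m'. b \<le> a \<longrightarrow> bad P (b + k) (Running (p + csize (WhileL r s c)) m') \<le> f b m'"
  have at: "p < length P" "P ! p = Jump_Less r s (p + 2)" "Suc p < length P"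
    "P ! (Suc p) = Jump (p + csize c + 3)" "code_at P (p + 2) (compile (p + 2) c)"
    "p + 2 + csize c < length P" "P ! (p + 2 + csize c) = Jump p"
    using *(1) by (auto simp: code_at_Cons code_at_append)
  have "Inv b m \<Longrightarrow> b \<le> a \<Longrightarrow> bad P (b + k) (Running p m) \<le> J m" for b
  proof (induction b arbitrary: m rule: less_induct)
    case (less b)
    note b = step(1)[OF less.prems(1)]
    show ?case
    proof (cases "m r < m s")
      case True
      have "bad P (Suc (b - 2 + (k + 1))) (Running p m) = bad P (b - 2 + (k + 1)) (Running (p + 2) m)"
        using at True by (intro bad_return) auto
      also have "\<dots> \<le> J m"
      proof (rule VD[OF step(2)[OF less.prems(1) True] at(5)])
        fix b' m' assume b': "b' \<le> b - 2"
        have "bad P (Suc (b' + k)) (Running (p + 2 + csize c) m') = bad P (b' + k) (Running p m')"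
          using at by (intro bad_return) auto
        also have "\<dots> \<le> (if Inv b' m' then J m' else 1)"
          using less.IH[of b' m'] less.prems b b' by (auto simp: bad_le_1)
        finally show "bad P (b' + (k + 1)) (Running (p + 2 + csize c) m')
          \<le> (if Inv b' m' then J m' else 1)" by simp
      qed
      finally have "bad P (Suc (b - 2 + (k + 1))) (Running p m) \<le> J m" .
      moreover have "Suc (b - 2 + (k + 1)) = b + k" using b by simp
      ultimately show ?thesis by (metis (no_types))
    next
      case False
      have "bad P (Suc (Suc (b - 2 + k))) (Running p m) = bad P (Suc (b - 2 + k)) (Running (Suc p) m)"
        using at False by (intro bad_return) auto
      also have "\<dots> = bad P (b - 2 + k) (Running (p + csize c + 3) m)"
        using at by (intro bad_return) auto
      also have "\<dots> \<le> f (b - 2) m"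
        using *(2)[rule_format, of "b - 2" m] less.prems by (simp add: ac_simps)
      also have "\<dots> \<le> J m" using step(3)[OF less.prems(1) False] .
      finally have "bad P (Suc (Suc (b - 2 + k))) (Running p m) \<le> J m" .
      moreover have "Suc (Suc (b - 2 + k)) = b + k" using b by simp
      ultimately show ?thesis by (metis (no_types))
    qed
  qed
  from this[OF assms(1)] show "bad P (a + k) (Running p m) \<le> J m" by simp
qed

lemma T_WhileL:
  assumes "Inv a m"
    and step: "\<And>b m. Inv b m \<Longrightarrow> 2 \<le> b"
      "\<And>b m. Inv b m \<Longrightarrow> m r < m s \<Longrightarrow> T c (b - 2) m Inv"
      "\<And>b m. Inv b m \<Longrightarrow> \<not> m r < m s \<Longrightarrow> Q (b - 2) m"
  shows "T (WhileL r s c) a m Q"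
  unfolding T_def
proof (intro allI impI)
  fix f u assume *: "\<forall>b m'. Q b m' \<longrightarrow> f b m' \<le> (u :: real)"
  show "V (WhileL r s c) f a m u"
    using V_WhileL[of Inv a m r s c "\<lambda>_. u" f, OF assms(1) step(1) T_V[OF step(2)]] step(3) *
    by auto
qed

end

section \<open>Edit distance as a recursion on prefixes\<close>

fun lev :: "(nat \<Rightarrow> 'a) \<Rightarrow> (nat \<Rightarrow> 'a) \<Rightarrow> nat \<Rightarrow> nat \<Rightarrow> nat" where
  "lev x y 0 j = j"
| "lev x y (Suc i) 0 = Suc i"
| "lev x y (Suc i) (Suc j) =
     min (lev x y i j + of_bool (x i \<noteq> y j)) (Suc (min (lev x y i (Suc j)) (lev x y (Suc i) j)))"

lemma lev_0_right [simp]: "lev x y i 0 = i"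
  by (cases i) auto

lemma lev_cong:
  "(\<And>a. a < i \<Longrightarrow> x a = x' a) \<Longrightarrow> (\<And>b. b < j \<Longrightarrow> y b = y' b) \<Longrightarrow> lev x y i j = lev x' y' i j"
  by (induction x y i j rule: lev.induct) auto

lemma lev_Suc_left: "lev x y (Suc i) j \<le> Suc (lev x y i j)"
  by (cases j) auto

lemma lev_Suc_right: "lev x y i (Suc j) \<le> Suc (lev x y i j)"
  by (cases i) auto

lemma lev_Suc_Suc: "lev x y (Suc i) (Suc j) \<le> lev x y i j + of_bool (x i \<noteq> y j)"
  by simp

lemma lev_ge_diff: "i \<le> j + lev x y i j \<and> j \<le> i + lev x y i j"
  by (induction x y i j rule: lev.induct) auto

lemma lev_add_right: "lev x y i (j + j') \<le> lev x y i j + j'"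
  by (induction j') (auto intro: order_trans[OF lev_Suc_right])

lemma lev_add_left: "lev x y (i + i') j \<le> lev x y i j + i'"
  by (induction i') (auto intro: order_trans[OF lev_Suc_left])

text \<open>Alignments of two pairs of parts can be concatenated. NO instances rely on this: phrase
  distances for arbitrary cuts never sum to less than the whole distance.\<close>

lemma lev_append:
  "lev x y (i + i') (j + j') \<le>
     lev x y i j + lev (\<lambda>a. x (i + a)) (\<lambda>b. y (j + b)) i' j'"
proof (induction "(\<lambda>a. x (i + a))" "(\<lambda>b. y (j + b))" i' j' rule: lev.induct)
  case (1 j')
  then show ?case by (simp add: lev_add_right)
next
  case (2 i')
  then show ?case using lev_add_left[of x y i "Suc i'" j] by simp
next
  case (3 i' j')
  have "lev x y (i + Suc i') (j + Suc j') \<le> lev x y (i + i') (j + j') + of_bool (x (i + i') \<noteq> y (j + j'))"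
    "lev x y (i + Suc i') (j + Suc j') \<le> Suc (lev x y (i + i') (j + Suc j'))"
    "lev x y (i + Suc i') (j + Suc j') \<le> Suc (lev x y (i + Suc i') (j + j'))"
    by simp_all
  then show ?case using 3 by simp
qed

text \<open>The alignment along the diagonal substitutes at the mismatches. Read the other way, a
  phrase at distance \<open>d\<close> has \<open>d\<close> mismatches to mark.\<close>

lemma lev_le_mismatches: "lev x y i i \<le> card {a. a < i \<and> x a \<noteq> y a}"
proof (induction i)
  case (Suc i)
  have "{a. a < Suc i \<and> x a \<noteq> y a} = {a. a < i \<and> x a \<noteq> y a} \<union> (if x i \<noteq> y i then {i} else {})"
    by (auto simp: less_Suc_eq)
  then have "card {a. a < Suc i \<and> x a \<noteq> y a} = card {a. a < i \<and> x a \<noteq> y a} + of_bool (x i \<noteq> y i)"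
    by simp
  then show ?case using Suc lev_Suc_Suc[of x y i i] by linarith
qed simp

lemma lev_eq_0D: "lev x y i j = 0 \<Longrightarrow> i = j \<and> (\<forall>a<i. x a = y a)"
proof (induction x y i j rule: lev.induct)
  case (3 x y i j)
  have "lev x y i j + of_bool (x i \<noteq> y j) = 0" using 3(4) by (simp add: min_def split: if_splits)
  then have "lev x y i j = 0" "x i = y j" by auto
  then show ?case using 3(1) by (auto simp: less_Suc_eq)
qed auto

lemma lev_Suc_Suc_cases:
  "lev x y (Suc i) (Suc j) = lev x y i j + of_bool (x i \<noteq> y j) \<or>
   lev x y (Suc i) (Suc j) = Suc (lev x y i (Suc j)) \<or>
   lev x y (Suc i) (Suc j) = Suc (lev x y (Suc i) j)"
  by (simp add: min_def)

text \<open>Splits off the last column of an alignment: the last character of the first string with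
  the block of the second string aligned to it. Trailing insertions move into that block one at a
  time.\<close>

lemma lev_split_last:
  "\<exists>j'\<le>j. lev x y i j' + lev (\<lambda>a. x (i + a)) (\<lambda>b. y (j' + b)) 1 (j - j') \<le> lev x y (Suc i) j"
proof (induction j)
  case (Suc j)
  consider "lev x y (Suc i) (Suc j) = lev x y i j + of_bool (x i \<noteq> y j)"
    | "lev x y (Suc i) (Suc j) = Suc (lev x y i (Suc j))"
    | "lev x y (Suc i) (Suc j) = Suc (lev x y (Suc i) j)"
    using lev_Suc_Suc_cases[of x y i j] by blast
  then show ?case
  proof cases
    case 1
    then show ?thesis by (intro exI[of _ j]) auto
  next
    case 2
    then show ?thesis by (intro exI[of _ "Suc j"]) auto
  next
    case 3
    obtain j' where j': "j' \<le> j"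
      "lev x y i j' + lev (\<lambda>a. x (i + a)) (\<lambda>b. y (j' + b)) 1 (j - j') \<le> lev x y (Suc i) j"
      using Suc by blast
    have "Suc j - j' = Suc (j - j')" using j' by simp
    then show ?thesis using j' 3 lev_Suc_right[of "\<lambda>a. x (i + a)" "\<lambda>b. y (j' + b)" 1 "j - j'"]
      by (intro exI[of _ j']) auto
  qed
qed auto

subsection \<open>Optimal alignments\<close>

text \<open>
  An alignment is represented by the function \<open>p\<close> that maps a prefix length of the first string to
  the length of the prefix of the second string it is aligned with.  Its cost is the sum of the
  costs of its columns.
\<close>

definition col_cost :: "(nat \<Rightarrow> 'a) \<Rightarrow> (nat \<Rightarrow> 'a) \<Rightarrow> (nat \<Rightarrow> nat) \<Rightarrow> nat \<Rightarrow> nat" where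
  "col_cost x y p i = lev (\<lambda>a. x (i + a)) (\<lambda>b. y (p i + b)) 1 (p (Suc i) - p i)"

definition alignment :: "(nat \<Rightarrow> nat) \<Rightarrow> nat \<Rightarrow> nat \<Rightarrow> bool" where
  "alignment p i j \<longleftrightarrow> p 0 = 0 \<and> p i = j \<and> (\<forall>a<i. p a \<le> p (Suc a))"

text \<open>Columns are peeled off from the right. At least one column is required, as
  \<open>p 0 = 0\<close> and \<open>p i = j\<close> clash for \<open>i = 0 < j\<close>; insertions
  before the first character belong to column \<open>0\<close>.\<close>

lemma optimal_alignment:
  assumes "i > 0"
  shows "\<exists>p. alignment p i j \<and> (\<Sum>a<i. col_cost x y p a) \<le> lev x y i j"
  using assms
proof (induction i arbitrary: j rule: nat_induct_non_zero)
  case 1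
  show ?case
    by (rule exI[of _ "\<lambda>a. if a = 0 then 0 else j"]) (auto simp: alignment_def col_cost_def)
next
  case (Suc i)
  obtain j' where j': "j' \<le> j"
    "lev x y i j' + lev (\<lambda>a. x (i + a)) (\<lambda>b. y (j' + b)) 1 (j - j') \<le> lev x y (Suc i) j"
    using lev_split_last by blast
  obtain p where p: "alignment p i j'" "(\<Sum>a<i. col_cost x y p a) \<le> lev x y i j'"
    using Suc.IH by blast
  define q where "q = p(Suc i := j)"
  have "alignment q (Suc i) j"
    using p(1) j'(1) by (auto simp: alignment_def q_def less_Suc_eq)
  moreover have "(\<Sum>a<i. col_cost x y q a) = (\<Sum>a<i. col_cost x y p a)"
    by (intro sum.cong) (auto simp: q_def col_cost_def)
  moreover have "col_cost x y q i = lev (\<lambda>a. x (i + a)) (\<lambda>b. y (j' + b)) 1 (j - j')"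
    using p(1) by (auto simp: q_def col_cost_def alignment_def)
  ultimately show ?case using j' p(2) by (intro exI[of _ q]) auto
qed

lemma alignment_mono:
  assumes "alignment p i j" "a \<le> b" "b \<le> i"
  shows "p a \<le> p b"
  using assms(2,3)
proof (induction b rule: dec_induct)
  case (step b)
  then have "p b \<le> p (Suc b)" "p a \<le> p b" using assms(1) by (auto simp: alignment_def)
  then show ?case by simp
qed simp

lemma col_cost_eq_0D:
  assumes "col_cost x y p i = 0" "p i \<le> p (Suc i)"
  shows "p (Suc i) = Suc (p i)" "x i = y (p i)"
  using lev_eq_0D[OF assms(1)[unfolded col_cost_def]] assms(2) by auto

lemma lev_le_col_costs:
  assumes "alignment p i j" "a \<le> b" "b \<le> i"
  shows "lev (\<lambda>u. x (a + u)) (\<lambda>v. y (p a + v)) (b - a) (p b - p a) \<le> (\<Sum>c=a..<b. col_cost x y p c)"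
  using assms(2,3)
proof (induction b rule: dec_induct)
  case (step b)
  have m: "p a \<le> p b" "p b \<le> p (Suc b)"
    using alignment_mono[OF assms(1)] step by auto
  have e: "Suc b - a = (b - a) + 1" "p (Suc b) - p a = (p b - p a) + (p (Suc b) - p b)"
    using step m by auto
  have "lev (\<lambda>u. x (a + u)) (\<lambda>v. y (p a + v)) (Suc b - a) (p (Suc b) - p a)
    \<le> lev (\<lambda>u. x (a + u)) (\<lambda>v. y (p a + v)) (b - a) (p b - p a)
      + lev (\<lambda>u. x (a + ((b - a) + u))) (\<lambda>v. y (p a + ((p b - p a) + v))) 1 (p (Suc b) - p b)"
    unfolding e by (rule lev_append)
  also have "lev (\<lambda>u. x (a + ((b - a) + u))) (\<lambda>v. y (p a + ((p b - p a) + v))) 1 (p (Suc b) - p b)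
    = col_cost x y p b"
    unfolding col_cost_def using step m by (intro lev_cong) auto
  finally show ?case using step by auto
qed simp

text \<open>An alignment leaves the main diagonal by at most the cost spent so far. This is why
  shifts between \<open>-k\<close> and \<open>k\<close> suffice in the search for cuts.\<close>

lemma alignment_diagonal:
  assumes "alignment p i j" "a \<le> i"
  shows "p a \<le> a + (\<Sum>c<a. col_cost x y p c) \<and> a \<le> p a + (\<Sum>c<a. col_cost x y p c)"
  using lev_le_col_costs[OF assms(1), of 0 a x y] assms
    lev_ge_diff[of a "p a" x y] by (auto simp: alignment_def atLeast0LessThan)

text \<open>A free column matches one character with one character, so inside a window of free
  columns the alignment stays on one diagonal and copies the window.\<close>

lemma alignment_clean_window:
  assumes "alignment p i j" "a + l \<le> i" "\<And>c. a \<le> c \<Longrightarrow> c < a + l \<Longrightarrow> col_cost x y p c = 0" "u < l"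
  shows "x (a + u) = y (p a + u)"
proof -
  have "p (a + v) = p a + v" if "v \<le> l" for v
    using that
  proof (induction v)
    case (Suc v)
    moreover have "p (a + v) \<le> p (Suc (a + v))"
      using alignment_mono[OF assms(1)] Suc.prems assms(2) by auto
    ultimately show ?case
      using col_cost_eq_0D(1)[of x y p "a + v"] assms(3)[of "a + v"] by auto
  qed simp
  moreover have "p (a + u) \<le> p (Suc (a + u))"
    using alignment_mono[OF assms(1)] assms by auto
  ultimately show ?thesis
    using col_cost_eq_0D(2)[of x y p "a + u"] assms by auto
qed

subsection \<open>The edit distance\<close>

text \<open>Edit steps may act anywhere and undo each other, while \<open>lev\<close> works from the
  right end. This relation mediates: alignments built from the right, closed under one more edit
  step. The rule \<open>al_weaken\<close> is there because deleting a character inserted earlier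
  lowers the cost instead of raising it.\<close>

inductive al :: "nat \<Rightarrow> 'a list \<Rightarrow> 'a list \<Rightarrow> bool" where
  al_Nil: "al 0 [] []"
| al_match: "al n xs ys \<Longrightarrow> al n (xs @ [a]) (ys @ [a])"
| al_subst: "al n xs ys \<Longrightarrow> al (Suc n) (xs @ [a]) (ys @ [b])"
| al_del: "al n xs ys \<Longrightarrow> al (Suc n) (xs @ [a]) ys"
| al_ins: "al n xs ys \<Longrightarrow> al (Suc n) xs (ys @ [b])"
| al_weaken: "al n xs ys \<Longrightarrow> al (Suc n) xs ys"

lemma edit_step_snocE:
  assumes "edit_step (ys @ [y]) zs"
  obtains a where "zs = ys @ [y, a]" | "zs = ys" | b where "zs = ys @ [b]"
    | zs' where "zs = zs' @ [y]" "edit_step ys zs'"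
proof -
  have "(\<exists>a. zs = ys @ [y, a]) \<or> zs = ys \<or> (\<exists>b. zs = ys @ [b]) \<or> (\<exists>zs'. zs = zs' @ [y] \<and> edit_step ys zs')"
    using assms
  proof cases
    case (insertion u v a)
    show ?thesis
    proof (cases v rule: rev_cases)
      case (snoc v' b)
      then have "ys = u @ v'" "zs = (u @ a # v') @ [y]" using insertion by auto
      then show ?thesis using edit_step.insertion by metis
    qed (use insertion in auto)
  next
    case (deletion u a v)
    show ?thesis
    proof (cases v rule: rev_cases)
      case (snoc v' b)
      then have "ys = u @ a # v'" "zs = (u @ v') @ [y]" using deletion by auto
      then show ?thesis using edit_step.deletion by metis
    qed (use deletion in auto)
  next
    case (substitution u a v b)
    show ?thesis
    proof (cases v rule: rev_cases)
      case (snoc v' b')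
      then have "ys = u @ a # v'" "zs = (u @ b # v') @ [y]" using substitution by auto
      then show ?thesis using edit_step.substitution by metis
    qed (use substitution in auto)
  qed
  then show thesis using that by blast
qed

lemma edit_step_Nil: "edit_step [] zs \<Longrightarrow> \<exists>a. zs = [a]"
  by (erule edit_step.cases) auto

lemma al_edit_step: "al n xs ys \<Longrightarrow> edit_step ys zs \<Longrightarrow> al (Suc n) xs zs"
proof (induction arbitrary: zs rule: al.induct)
  case al_Nil
  then obtain a where "zs = [] @ [a]" using edit_step_Nil by fastforce
  then show ?case using al.intros by metis
next
  case (al_match n xs ys a)
  from al_match.prems show ?case
  proof (cases rule: edit_step_snocE)
    case (1 b)
    then show ?thesis using al.al_ins[OF al.al_match[OF al_match.hyps]] by simp
  qed (auto intro: al.intros al_match)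
next
  case (al_subst n xs ys a b)
  from al_subst.prems show ?case
  proof (cases rule: edit_step_snocE)
    case (1 c)
    then show ?thesis using al.al_ins[OF al.al_subst[OF al_subst.hyps]] by simp
  qed (auto intro: al.intros al_subst)
next
  case (al_ins n xs ys b)
  from al_ins.prems show ?case
  proof (cases rule: edit_step_snocE)
    case (1 c)
    then show ?thesis using al.al_ins[OF al.al_ins[OF al_ins.hyps]] by simp
  qed (auto intro: al.intros al_ins)
qed (auto intro: al.intros)

lemma al_self: "al 0 xs xs"
  by (induction xs rule: rev_induct) (auto intro: al.intros)

lemma relpowp_edit_step_al: "(edit_step ^^ n) xs ys \<Longrightarrow> al n xs ys"
  by (induction n arbitrary: ys) (auto intro: al_self al_edit_step)

lemma al_lev:
  fixes xs ys :: "nat list"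
  shows "al n xs ys \<Longrightarrow> lev (char_at xs) (char_at ys) (length xs) (length ys) \<le> n"
proof (induction rule: al.induct)
  case (al_match n xs ys a)
  have "lev (char_at (xs @ [a])) (char_at (ys @ [a])) (length xs) (length ys)
      = lev (char_at xs) (char_at ys) (length xs) (length ys)"
    by (intro lev_cong) (auto simp: char_at_def nth_append)
  moreover have "char_at (xs @ [a]) (length xs) = a" "char_at (ys @ [a]) (length ys) = a"
    by (simp_all add: char_at_def)
  ultimately show ?case using al_match
      lev_Suc_Suc[of "char_at (xs @ [a])" "char_at (ys @ [a])" "length xs" "length ys"]
    by (simp del: lev.simps)
next
  case (al_subst n xs ys a b)
  have "lev (char_at (xs @ [a])) (char_at (ys @ [b])) (length xs) (length ys)
      = lev (char_at xs) (char_at ys) (length xs) (length ys)"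
    by (intro lev_cong) (auto simp: char_at_def nth_append)
  then show ?case using al_subst
      lev_Suc_Suc[of "char_at (xs @ [a])" "char_at (ys @ [b])" "length xs" "length ys"]
    by (simp add: of_bool_def del: lev.simps split: if_splits)
next
  case (al_del n xs ys a)
  have "lev (char_at (xs @ [a])) (char_at ys) (length xs) (length ys)
      = lev (char_at xs) (char_at ys) (length xs) (length ys)"
    by (intro lev_cong) (auto simp: char_at_def nth_append)
  then show ?case using al_del lev_Suc_left[of "char_at (xs @ [a])" "char_at ys" "length xs" "length ys"]
    by simp
next
  case (al_ins n xs ys a)
  have "lev (char_at xs) (char_at (ys @ [a])) (length xs) (length ys)
      = lev (char_at xs) (char_at ys) (length xs) (length ys)"
    by (intro lev_cong) (auto simp: char_at_def nth_append)
  then show ?case using al_ins lev_Suc_right[of "char_at xs" "char_at (ys @ [a])" "length xs" "length ys"]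
    by simp
qed auto

lemma edit_step_append: "edit_step xs ys \<Longrightarrow> edit_step (xs @ zs) (ys @ zs)"
  by (erule edit_step.cases) (auto intro: edit_step.intros)

lemma relpowp_edit_step_append: "(edit_step ^^ n) xs ys \<Longrightarrow> (edit_step ^^ n) (xs @ zs) (ys @ zs)"
proof (induction n arbitrary: ys)
  case (Suc n)
  then obtain us where "(edit_step ^^ n) xs us" "edit_step us ys" by auto
  then have "(edit_step ^^ n) (xs @ zs) (us @ zs)" "edit_step (us @ zs) (ys @ zs)"
    using Suc.IH edit_step_append by blast+
  then show ?case by (rule relpowp_Suc_I)
qed auto

lemma edit_step_ends:
  "edit_step (xs @ [a]) xs" "edit_step xs (xs @ [a])" "edit_step (xs @ [a]) (xs @ [b])"
  using edit_step.deletion[of xs a "[]"] edit_step.insertion[of xs "[]" a]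
    edit_step.substitution[of xs a "[]" b] by auto

lemma relpowp_edit_step_Nil: "(edit_step ^^ length xs) xs []"
proof (induction xs rule: rev_induct)
  case (snoc a xs)
  show ?case
    using relpowp_Suc_I2[of edit_step, OF edit_step_ends(1) snoc] by (simp del: relpowp.simps)
qed simp

lemma lev_relpowp_edit_step:
  assumes "i \<le> length xs" "j \<le> length ys"
  shows "(edit_step ^^ lev (char_at xs) (char_at ys) i j) (take i xs) (take j ys)"
  using assms
proof (induction "char_at xs" "char_at ys" i j rule: lev.induct)
  case (1 j)
  then show ?case
  proof (induction j)
    case (Suc j)
    then show ?case
      by (auto simp: take_Suc_conv_app_nth intro!: relpowp_Suc_I edit_step_ends)
  qed simp
next
  case (2 i)
  then show ?case
    using relpowp_edit_step_Nil[of "take (Suc i) xs"] by (simp del: relpowp.simps add: min_absorb2)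
next
  case (3 i j)
  have c: "char_at xs i = xs ! i" "char_at ys j = ys ! j" using 3 by (auto simp: char_at_def)
  have t: "take (Suc i) xs = take i xs @ [xs ! i]" "take (Suc j) ys = take j ys @ [ys ! j]"
    using 3 by (auto simp: take_Suc_conv_app_nth)
  note IH = 3(1)[OF Suc_leD Suc_leD] 3(2)[OF Suc_leD] 3(3)[OF _ Suc_leD]
  let ?l = "lev (char_at xs) (char_at ys)"
  consider "?l (Suc i) (Suc j) = ?l i j + of_bool (xs ! i \<noteq> ys ! j)"
    | "?l (Suc i) (Suc j) = Suc (?l i (Suc j))" | "?l (Suc i) (Suc j) = Suc (?l (Suc i) j)"
    using lev_Suc_Suc_cases[of "char_at xs" "char_at ys" i j] unfolding c by blast
  then show ?case
  proof cases
    case 1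
    have *: "(edit_step ^^ ?l i j) (take i xs @ [xs ! i]) (take j ys @ [xs ! i])"
      using IH(1) 3 by (intro relpowp_edit_step_append) auto
    show ?thesis
    proof (cases "xs ! i = ys ! j")
      case True
      then show ?thesis using * unfolding 1 t by simp
    next
      case False
      then show ?thesis using relpowp_Suc_I[OF * edit_step_ends(3)] unfolding 1 t by simp
    qed
  next
    case 2
    have "(edit_step ^^ ?l i (Suc j)) (take i xs) (take (Suc j) ys)" using IH(2) 3 by simp
    then show ?thesis unfolding 2 t(1) by (rule relpowp_Suc_I2[of edit_step, OF edit_step_ends(1)])
  next
    case c3: 3
    have "(edit_step ^^ ?l (Suc i) j) (take (Suc i) xs) (take j ys)" using IH(3) 3 by simp
    then show ?thesis unfolding c3 t(2) by (rule relpowp_Suc_I[of _ edit_step, OF _ edit_step_ends(2)])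
  qed
qed

theorem ED_eq_lev: "ED X Y = lev (char_at X) (char_at Y) (length X) (length Y)"
  unfolding ED_def
proof (rule Least_equality)
  show "(edit_step ^^ lev (char_at X) (char_at Y) (length X) (length Y)) X Y"
    using lev_relpowp_edit_step[of "length X" X "length Y" Y] by simp
next
  fix n assume "(edit_step ^^ n) X Y"
  then show "lev (char_at X) (char_at Y) (length X) (length Y) \<le> n"
    by (intro al_lev relpowp_edit_step_al)
qed

subsection \<open>Banded dynamic programming\<close>

text \<open>
  Diagonal \<open>q\<close> of the band of radius \<open>D\<close> consists of the pairs \<open>(i, j)\<close> with \<open>i + q = j + D + 1\<close>;
  distances are truncated at \<open>D + 1\<close>, which makes the two boundary diagonals constant.
\<close>

definition band :: "nat \<Rightarrow> (nat \<Rightarrow> 'a) \<Rightarrow> (nat \<Rightarrow> 'a) \<Rightarrow> nat \<Rightarrow> nat \<Rightarrow> nat" where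
  "band D x y i q = (if i + q < D + 1 then D + 1 else min (D + 1) (lev x y i (i + q - (D + 1))))"

lemma band_0: "q \<le> 2 * D + 2 \<Longrightarrow> band D x y 0 q = (if q < D + 1 then D + 1 else q - (D + 1))"
  by (auto simp: band_def)

lemma band_left: "band D x y i 0 = D + 1"
  using lev_ge_diff[of i "i - (D + 1)" x y] by (auto simp: band_def)

lemma band_right: "band D x y i (2 * D + 2) = D + 1"
proof -
  have "i + (2 * D + 2) - (D + 1) = i + (D + 1)" by simp
  moreover have "D + 1 \<le> lev x y i (i + (D + 1))" using lev_ge_diff[of i "i + (D + 1)" x y] by auto
  ultimately show ?thesis unfolding band_def by (metis min_absorb1)
qed

text \<open>Only the old cells \<open>q\<close>, \<open>q + 1\<close> and the new cell
  \<open>q - 1\<close> occur, so a row can be overwritten in place by increasing \<open>q\<close>.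
  Where the diagonal predecessor would lie left of the first column, its cell holds
  \<open>D + 1\<close>, and the cost \<open>1\<close> is a dummy value absorbed by the outer
  minimum.\<close>

lemma band_Suc:
  assumes "0 < q"
  shows "band D x y (Suc i) q = min (D + 1) (min (band D x y i q +
      (if i + q < D + 1 then 1 else of_bool (x i \<noteq> y (i + q - (D + 1)))))
    (min (band D x y i (q + 1) + 1) (band D x y (Suc i) (q - 1) + 1)))"
proof -
  consider "i + q < D" | "i + q = D" | j where "i + q = D + 1 + j"
    by (metis less_linear less_iff_Suc_add add.commute add_Suc_right Suc_eq_plus1)
  then show ?thesis
  proof cases
    case 1
    then show ?thesis using assms by (auto simp: band_def)
  next
    case 2
    then show ?thesis using assms by (auto simp: band_def)
  next
    case (3 j)
    then have e: "i + q - (D + 1) = j" "Suc i + q - (D + 1) = Suc j" "i + (q + 1) - (D + 1) = Suc j"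
      "Suc i + (q - 1) - (D + 1) = j" "Suc i + (q - 1) = D + 1 + j" "Suc i + q = D + 1 + Suc j"
      "i + (q + 1) = D + 1 + Suc j"
      using assms by auto
    show ?thesis
      unfolding band_def e 3 by (auto simp: min_def)
  qed
qed

section \<open>Subroutines\<close>

text \<open>
  Memory cells: \<open>0\<close> to \<open>3\<close> hold \<open>|X|\<close>, \<open>|Y|\<close>, \<open>k\<close> and \<open>l\<close>; \<open>4\<close> the window length, \<open>6\<close> the distance of
  consecutive cuts, \<open>8\<close> the stride, \<open>9\<close> the acceptance threshold, \<open>13\<close> and \<open>14\<close> the constants \<open>0\<close> and
  \<open>1\<close>, \<open>15\<close> the number \<open>2 * k + 1\<close> of shifts; \<open>16\<close>, \<open>17\<close> the start and \<open>21\<close>, \<open>22\<close> the end of the current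
  phrase in \<open>X\<close> and \<open>Y\<close>, \<open>25\<close>, \<open>26\<close> its lengths; \<open>18\<close> the next cut; \<open>19\<close> the estimate and \<open>20\<close> the sum
  of all distances computed in the current run.  The other cells are temporary.
\<close>

definition IfEq :: "nat \<Rightarrow> nat \<Rightarrow> com \<Rightarrow> com \<Rightarrow> com" where
  "IfEq r s c1 c2 = IfL r s c2 (IfL s r c2 c1)"

abbreviation MinL :: "nat \<Rightarrow> nat \<Rightarrow> com" where
  "MinL r s \<equiv> IfL s r (Blk [Copy r s]) (Blk [])"

text \<open>\<open>B\<close> bounds the quantities of the algorithm up to small factors;
  \<open>1000\<close> leaves room for the sums formed in the cells and for the table addresses from
  \<open>64\<close> on, so that the modular arithmetic never wraps around.\<close>

locale bounded_ram = ram +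
  fixes B :: nat
  assumes B_pos: "0 < B" and B_word: "1000 * B \<le> 2 ^ w"
begin

abbreviation "cX \<equiv> char_at (str_X I)"
abbreviation "cY \<equiv> char_at (str_Y I)"

lemma binop_Add: "x + y < 2 ^ w \<Longrightarrow> binop_sem w Add x y = x + y"
  by simp

lemma binop_Sub: "y \<le> x \<Longrightarrow> x < 2 ^ w \<Longrightarrow> binop_sem w Sub x y = x - y"
proof -
  assume "y \<le> x" "x < 2 ^ w"
  then have "(x + 2 ^ w - y) = (x - y) + 2 ^ w" by simp
  then have "binop_sem w Sub x y = (x - y) mod 2 ^ w" by simp
  then show ?thesis using \<open>x < 2 ^ w\<close> by simp
qed

lemma binop_Mul: "x * y < 2 ^ w \<Longrightarrow> binop_sem w Mul x y = x * y"
  by simp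

lemma mod_word_small: "x < 1000 \<Longrightarrow> x mod 2 ^ w = (x :: nat)"
  using B_pos B_word by (intro mod_less) linarith

lemma w_pos [simp]: "0 < w"
  using B_pos B_word by (cases w) auto

text \<open>An opaque copy of \<open>min\<close>, which the arithmetic procedures do not split.\<close>

definition minimum :: "nat \<Rightarrow> nat \<Rightarrow> nat" where "minimum x y = min x y"

lemma T_MinL:
  assumes "3 \<le> a" "\<And>b. a \<le> b + 3 \<Longrightarrow> Q b (m(r := minimum (m r) (m s)))"
  shows "T (MinL r s) a m Q"
proof (intro T_IfL T_Blk, goal_cases)
  case 4
  then show ?case using assms(1) assms(2)[of "a - 3"] by (simp add: minimum_def min_absorb2)
next
  case 7
  then show ?case using assms(1) assms(2)[of "a - 2"] by (simp add: minimum_def min_absorb1)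
qed (use assms in auto)

lemma T_credit: "T c a m Q \<Longrightarrow> a \<le> a' \<Longrightarrow> T c a' m Q"
  unfolding T_def using V_mono by blast

lemma T_IfEq:
  assumes "4 \<le> a" "m r = m s \<Longrightarrow> T c1 (a - 4) m Q" "m r \<noteq> m s \<Longrightarrow> T c2 (a - 4) m Q"
  shows "T (IfEq r s c1 c2) a m Q"
  unfolding IfEq_def using assms by (intro T_IfL) (auto intro: T_credit)

lemmas T_intros = T_seq T_Blk T_IfL T_IfEq

declare binop_sem.simps(1-3) [simp del]
declare binop_Add [simp] binop_Sub [simp] binop_Mul [simp] mod_word_small [simp]

section \<open>Windows: comparison and search over the shifts\<close>

definition matches :: "nat \<Rightarrow> nat \<Rightarrow> nat \<Rightarrow> bool" where
  "matches l c y \<longleftrightarrow> (\<forall>u<l. cX (c + u) = cY (y + u))"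

lemma matches_Suc: "matches (Suc l) c y \<longleftrightarrow> matches l c y \<and> cX (c + l) = cY (y + l)"
  by (auto simp: matches_def less_Suc_eq)

lemma matches_antimono: "matches l c y \<Longrightarrow> l' \<le> l \<Longrightarrow> matches l' c y"
  by (auto simp: matches_def)

text \<open>Beyond the end of \<open>Y\<close> zeros are read, so a window may match padding. This
  is harmless: the uniqueness of occurrences uses only equality of the values read, and on NO
  instances any cuts inside \<open>Y\<close> will do.\<close>

definition compare_windows :: com where
  "compare_windows = Blk [Const 40 0, Const 41 1] ;;
     WhileL 40 4
      (Blk [Op Add 42 18 40, Read_X 42 42, Op Add 43 22 40, Read_Y 43 43] ;;
       IfEq 42 43 (Blk [Op Add 40 40 14]) (Blk [Const 41 0, Copy 40 4]))"

lemma T_compare_windows: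
  assumes "m 14 = 1" "m 18 + m 4 < 2 ^ w" "m 22 + m 4 < 2 ^ w" "12 * m 4 + 4 \<le> a"
  shows "T compare_windows a m (\<lambda>b m'. a \<le> b + 12 * m 4 + 4 \<and>
    m' 41 = of_bool (matches (m 4) (m 18) (m 22)) \<and>
    (\<forall>r. r \<notin> {40..43} \<longrightarrow> m' r = m r))"
proof -
  define Inv where "Inv b m' \<longleftrightarrow> (\<forall>r. r \<notin> {40..43} \<longrightarrow> m' r = m r) \<and> m' 40 \<le> m 4 \<and>
     a \<le> b + 12 * m' 40 + 2 \<and>
     (m' 41 = 1 \<and> matches (m' 40) (m 18) (m 22) \<or>
      m' 41 = 0 \<and> m' 40 = m 4 \<and> \<not> matches (m 4) (m 18) (m 22))" for b m'
  show ?thesis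
    unfolding compare_windows_def
  proof (intro T_seq T_Blk, goal_cases)
    case 3
    show ?case
    proof (rule T_WhileL[where Inv = Inv], goal_cases)
      case (3 b m')
      then have w: "m 18 + m' 40 < 2 ^ w" "m 22 + m' 40 < 2 ^ w" "Suc (m' 40) < 2 ^ w"
        "matches (m 4) (m 18) (m 22) \<Longrightarrow> matches (Suc (m' 40)) (m 18) (m 22)"
        using assms unfolding Inv_def by (auto intro: matches_antimono)
      show ?case
        by (intro T_intros) (use 3 assms w in \<open>auto simp: Inv_def matches_Suc\<close>)
    next
      case 1
      show ?case using assms by (simp add: Inv_def matches_def)
    qed (use assms in \<open>auto simp: Inv_def\<close>)
  qed (use assms in auto)
qed

text \<open>Candidate starts are \<open>m 18 + u - k\<close> for \<open>u \<le> 2 * k\<close>, which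
  avoids signed shifts; negative starts are skipped. Copying cell \<open>15\<close> into the counter
  leaves the loop with the match kept in cell \<open>22\<close>.\<close>

definition search_window :: com where
  "search_window = Blk [Const 44 0, Const 41 0] ;;
     WhileL 44 15
      (Blk [Op Add 45 18 44] ;;
       IfL 45 2 (Blk [Op Add 44 44 14])
        (Blk [Op Sub 22 45 2] ;; compare_windows ;;
         IfL 13 41 (Blk [Copy 44 15]) (Blk [Op Add 44 44 14])))"

lemma T_search_window:
  assumes "m 13 = 0" "m 14 = 1" "m 18 + m 15 + m 4 < 2 ^ w" "m 2 < m 15"
    "m 15 * (12 * m 4 + 20) + 4 \<le> a"
  shows "T search_window a m (\<lambda>b m'. a \<le> b + m 15 * (12 * m 4 + 20) + 4 \<and>
    (if m' 41 = 0 then \<forall>u<m 15. m 2 \<le> m 18 + u \<longrightarrow> \<not> matches (m 4) (m 18) (m 18 + u - m 2)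
     else matches (m 4) (m 18) (m' 22) \<and> m 18 \<le> m' 22 + m 2 \<and> m' 22 + m 2 < m 18 + m 15) \<and>
    (\<forall>r. r \<notin> insert 22 {40..45} \<longrightarrow> m' r = m r))"
proof -
  define C where "C = 12 * m 4 + 20"
  define Inv where "Inv b m' \<longleftrightarrow> (\<forall>r. r \<notin> insert 22 {40..45} \<longrightarrow> m' r = m r) \<and> m' 44 \<le> m 15 \<and>
     a \<le> b + m' 44 * C + 2 \<and>
     (if m' 41 = 0 then \<forall>u<m' 44. m 2 \<le> m 18 + u \<longrightarrow> \<not> matches (m 4) (m 18) (m 18 + u - m 2)
      else matches (m 4) (m 18) (m' 22) \<and> m 18 \<le> m' 22 + m 2 \<and> m' 22 + m 2 < m 18 + m 15
        \<and> m' 44 = m 15)" for b m'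
  have C3: "j * C + C \<le> m 15 * C" if "j < m 15" for j
    using that by (metis Suc_leI add.commute mult_Suc mult_le_mono1)
  show ?thesis
    unfolding search_window_def
  proof (intro T_seq T_Blk, goal_cases)
    case 3
    show ?case
    proof (rule T_WhileL[where Inv = Inv], goal_cases)
      case 1
      show ?case using assms by (simp add: Inv_def)
    next
      case (2 b m')
      then have "m' 44 * C \<le> m 15 * C" "a \<le> b + m' 44 * C + 2" by (auto simp: Inv_def)
      then show ?case using assms(5) unfolding C_def[symmetric] by linarith
    next
      case (3 b m')
      let ?m1 = "m'(45 := m' 18 + m' 44, 22 := m' 18 + m' 44 - m' 2)"
      have j: "m' 44 < m 15" and f: "\<And>r. r \<notin> insert 22 {40..45} \<Longrightarrow> m' r = m r"
        and b: "a \<le> b + m' 44 * C + 2" and no: "m' 41 = 0"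
          "\<forall>u<m' 44. m 2 \<le> m 18 + u \<longrightarrow> \<not> matches (m 4) (m 18) (m 18 + u - m 2)"
        using 3 unfolding Inv_def by (auto split: if_splits)
      have w: "m 18 + m' 44 < 2 ^ w" "Suc (m' 44) < 2 ^ w" "m 18 + m' 44 - m 2 + m 4 < 2 ^ w"
        using j assms by auto
      have bC: "C + 2 \<le> b" using b assms C3[OF j] unfolding C_def by linarith
      have e: "m 18 + m' 44 - m 2 = m 18 + u - m 2 \<longleftrightarrow> u = m' 44" if "m 2 \<le> m 18 + m' 44" "m 2 \<le> m 18 + u" for u
        using that by auto
      show ?case
        by (intro T_intros T_mono[OF T_compare_windows])
           (use f w assms bC no b C3[OF j] 3 in \<open>auto simp: C_def Inv_def less_Suc_eq\<close>)
    next
      case (4 b m')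
      then show ?case by (auto simp: Inv_def C_def split: if_splits)
    qed
  qed (use assms in auto)
qed

section \<open>Distance of a phrase by dynamic programming with doubling radius\<close>

definition pdist :: "nat \<Rightarrow> nat \<Rightarrow> nat \<Rightarrow> nat \<Rightarrow> nat" where
  "pdist x y i j = lev (\<lambda>a. cX (x + a)) (\<lambda>b. cY (y + b)) i j"

definition bnd :: "(nat \<Rightarrow> nat) \<Rightarrow> nat \<Rightarrow> nat \<Rightarrow> nat" where
  "bnd m = band (m 27) (\<lambda>a. cX (m 16 + a)) (\<lambda>b. cY (m 17 + b))"

text \<open>The current row of the banded dynamic program is stored in the cells from \<open>64\<close> on.\<close>

definition band_init :: com where
  "band_init = Blk [Op Add 32 27 14, Op Add 33 32 32, Op Add 38 33 14, Const 31 0, Const 52 64] ;;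
     WhileL 31 38
      (Blk [Op Add 36 52 31] ;;
       IfL 31 32 (Blk [Store 36 32]) (Blk [Op Sub 34 31 32, Store 36 34]) ;;
       Blk [Op Add 31 31 14])"

definition band_mismatch :: com where
  "band_mismatch =
     Blk [Op Add 34 30 31, Copy 37 14] ;;
     IfL 34 32 (Blk [])
      (Blk [Op Sub 34 34 32, Op Add 34 34 17, Read_Y 34 34] ;; IfEq 34 39 (Blk [Copy 37 13]) (Blk []))"

definition band_min :: com where
  "band_min =
     Blk [Op Add 36 52 31, Load 35 36, Op Add 35 35 37, Op Add 36 36 14, Load 34 36, Op Add 34 34 14] ;;
     MinL 35 34 ;;
     Blk [Op Sub 36 36 14, Op Sub 36 36 14, Load 34 36, Op Add 34 34 14] ;;
     MinL 35 34 ;;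
     MinL 35 32 ;;
     Blk [Op Add 36 36 14, Store 36 35, Op Add 31 31 14]"

definition band_cell :: com where
  "band_cell = band_mismatch ;; band_min"

definition band_row :: com where
  "band_row = Blk [Op Add 39 16 30, Read_X 39 39, Const 31 1] ;; WhileL 31 33 band_cell ;;
     Blk [Op Add 30 30 14]"

definition band_result :: com where
  "band_result = Blk [Copy 28 32, Op Add 34 26 32] ;;
     IfL 34 25 (Blk [])
      (Blk [Op Sub 34 34 25] ;; IfL 33 34 (Blk []) (Blk [Op Add 36 52 34, Load 28 36]))"

definition band_dp :: com where
  "band_dp = band_init ;; Blk [Const 30 0] ;; WhileL 30 25 band_row ;; band_result"

definition dp_regs :: "nat set" where "dp_regs = {28..39} \<union> {52}"

lemma dp_regs_mem [simp]: "r \<in> dp_regs \<longleftrightarrow> 28 \<le> r \<and> r \<le> 39 \<or> r = 52"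
  by (auto simp: dp_regs_def)

definition dp_frame :: "(nat \<Rightarrow> nat) \<Rightarrow> (nat \<Rightarrow> nat) \<Rightarrow> bool" where
  "dp_frame m m' \<longleftrightarrow> (\<forall>r<64. r \<notin> dp_regs \<longrightarrow> m' r = m r)"

definition band_regs :: "(nat \<Rightarrow> nat) \<Rightarrow> (nat \<Rightarrow> nat) \<Rightarrow> bool" where
  "band_regs m m' \<longleftrightarrow> dp_frame m m' \<and> m' 32 = m 27 + 1 \<and> m' 33 = 2 * m 27 + 2 \<and> m' 52 = 64"

lemma T_band_init:
  assumes "m 14 = 1" "3 * m 27 + 100 < 2 ^ w" "10 * (2 * m 27 + 3) + 10 \<le> a"
  shows "T band_init a m (\<lambda>b m'. a \<le> b + 10 * (2 * m 27 + 3) + 10 \<and> band_regs m m' \<and>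
     (\<forall>q\<le>2 * m 27 + 2. m' (64 + q) = bnd m 0 q))"
proof -
  define Inv where "Inv b m' \<longleftrightarrow> band_regs m m' \<and> m' 38 = 2 * m 27 + 3 \<and>
     m' 31 \<le> 2 * m 27 + 3 \<and> a \<le> b + 10 * m' 31 + 6 \<and>
     (\<forall>q<m' 31. m' (64 + q) = (if q < m 27 + 1 then m 27 + 1 else q - (m 27 + 1)))" for b m'
  show ?thesis
    unfolding band_init_def
  proof (intro T_seq T_Blk, goal_cases)
    case 3
    show ?case
    proof (rule T_WhileL[where Inv = Inv], goal_cases)
      case (3 b m')
      then have w: "m' 31 + 64 < 2 ^ w" "Suc (m' 31) < 2 ^ w"
        using assms unfolding Inv_def by auto
      show ?case
        by (intro T_intros) (use 3 assms w in \<open>auto simp: Inv_def band_regs_def dp_frame_def less_Suc_eq\<close>)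
    next
      case (4 b m')
      then show ?case
        by (auto simp: Inv_def bnd_def band_0)
    qed (use assms in \<open>auto simp: Inv_def band_regs_def dp_frame_def\<close>)
  qed (use assms in auto)
qed

lemma T_band_mismatch:
  assumes "m 13 = 0" "m 14 = 1" "m 30 + m 31 + m 17 + 100 < 2 ^ w" "20 \<le> a"
  shows "T band_mismatch a m (\<lambda>b m'. a \<le> b + 20 \<and> (\<forall>r. r \<notin> {34,37} \<longrightarrow> m' r = m r) \<and>
     m' 37 = (if m 30 + m 31 < m 32 then 1 else of_bool (m 39 \<noteq> cY (m 17 + (m 30 + m 31 - m 32)))))"
  unfolding band_mismatch_def
  by (intro T_intros) (use assms in \<open>auto simp: ac_simps\<close>)

lemma T_band_min:
  assumes "m 14 = 1" "m 52 = 64" "0 < m 31" "25 \<le> a" "m 31 + 100 < 2 ^ w"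
    "m (64 + m 31) + m 37 < 2 ^ w" "m (65 + m 31) + 1 < 2 ^ w" "m (63 + m 31) + 1 < 2 ^ w"
  shows "T band_min a m (\<lambda>b m'. a \<le> b + 25 \<and>
     (\<forall>r. r \<notin> {31,34,35,36,64 + m 31} \<longrightarrow> m' r = m r) \<and> m' 31 = Suc (m 31) \<and>
     m' (64 + m 31) = minimum (minimum (minimum (m (64 + m 31) + m 37) (m (65 + m 31) + 1))
        (m (63 + m 31) + 1)) (m 32))"
  unfolding band_min_def
  apply (intro T_seq T_Blk T_MinL)
  using assms apply simp_all
  done

lemma bnd_le: "bnd m i q \<le> m 27 + 1"
  by (auto simp: bnd_def band_def)

lemma T_band_cell:
  assumes "m 13 = 0" "m 14 = 1" "m 32 = m 27 + 1" "m 33 = 2 * m 27 + 2" "m 52 = 64"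
    "0 < m 31" "m 31 < m 33" "m 39 = cX (m 16 + m 30)"
    "m 30 + m 17 + 5 * m 27 + 200 < 2 ^ w" "45 \<le> a"
    "\<forall>q\<le>2 * m 27 + 2. m (64 + q) = bnd m (if q < m 31 then Suc (m 30) else m 30) q"
  shows "T band_cell a m (\<lambda>b m'. a \<le> b + 45 \<and>
     (\<forall>r. r \<notin> {31,34,35,36,37,64 + m 31} \<longrightarrow> m' r = m r) \<and>
     m' 31 = Suc (m 31) \<and> m' (64 + m 31) = bnd m (Suc (m 30)) (m 31))"
proof -
  have l: "m (64 + m 31) = bnd m (m 30) (m 31)" "m (65 + m 31) = bnd m (m 30) (m 31 + 1)"
    "m (63 + m 31) = bnd m (Suc (m 30)) (m 31 - 1)"
    using assms(6,7,4) assms(11)[rule_format, of "m 31"] assms(11)[rule_format, of "m 31 + 1"]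
      assms(11)[rule_format, of "m 31 - 1"] by (auto simp: Suc_diff_Suc)
  have step: "bnd m (Suc (m 30)) (m 31) = minimum (minimum (minimum (m (64 + m 31) +
       (if m 30 + m 31 < m 32 then 1 else of_bool (m 39 \<noteq> cY (m 17 + (m 30 + m 31 - m 32)))))
       (m (65 + m 31) + 1)) (m (63 + m 31) + 1)) (m 32)"
    unfolding l unfolding assms(3,8) bnd_def minimum_def
    by (subst band_Suc[OF assms(6)]) (simp only: ac_simps)
  have le: "m (64 + m 31) \<le> m 27 + 1" "m (65 + m 31) \<le> m 27 + 1" "m (63 + m 31) \<le> m 27 + 1"
    unfolding l by (rule bnd_le)+
  show ?thesis
    unfolding band_cell_def
  proof (intro T_seq T_mono[OF T_band_mismatch], goal_cases)
    case (5 b m')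
    show ?case
      by (rule T_mono[OF T_band_min]) (use 5 assms(1-10) le in \<open>simp_all add: step\<close>)
  qed (use assms(1-10) in auto)
qed

lemma T_band_row:
  assumes "m 13 = 0" "m 14 = 1" "m 32 = m 27 + 1" "m 33 = 2 * m 27 + 2" "m 52 = 64"
    "m 16 + m 30 + m 17 + 5 * m 27 + 200 < 2 ^ w" "10 + 50 * (2 * m 27 + 2) \<le> a"
    "\<forall>q\<le>2 * m 27 + 2. m (64 + q) = bnd m (m 30) q"
  shows "T band_row a m (\<lambda>b m'. a \<le> b + 10 + 50 * (2 * m 27 + 2) \<and>
     (\<forall>r<64. r \<notin> {30,31,34,35,36,37,39} \<longrightarrow> m' r = m r) \<and>
     m' 30 = Suc (m 30) \<and> (\<forall>q\<le>2 * m 27 + 2. m' (64 + q) = bnd m (Suc (m 30)) q))"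
proof -
  define Inv where "Inv b m' \<longleftrightarrow> (\<forall>r<64. r \<notin> {31,34,35,36,37,39} \<longrightarrow> m' r = m r) \<and>
     m' 39 = cX (m 16 + m 30) \<and> 0 < m' 31 \<and> m' 31 \<le> 2 * m 27 + 2 \<and> a \<le> b + 3 + 50 * m' 31 \<and>
     (\<forall>q\<le>2 * m 27 + 2. m' (64 + q) = bnd m (if q < m' 31 then Suc (m 30) else m 30) q)" for b m'
  show ?thesis
    unfolding band_row_def
  proof (intro T_seq T_Blk, goal_cases)
    case 3
    show ?case
    proof (rule T_WhileL[where Inv = Inv], goal_cases)
      case 1
      have "bnd m (Suc (m 30)) 0 = bnd m (m 30) 0" by (simp only: bnd_def band_left)
      then show ?case using assms by (auto simp: Inv_def)
    next
      case (3 b m')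
      then have f: "\<And>r. r < 64 \<Longrightarrow> r \<notin> {31,34,35,36,37,39} \<Longrightarrow> m' r = m r" unfolding Inv_def by auto
      have e: "bnd m' = bnd m" by (intro ext) (simp add: bnd_def f)
      show ?case
        by (rule T_mono[OF T_band_cell])
          (use 3 assms in \<open>auto simp: Inv_def f e less_Suc_eq\<close>)
    next
      case (4 b m')
      have "bnd m (Suc (m 30)) (2 * m 27 + 2) = bnd m (m 30) (2 * m 27 + 2)"
        by (simp only: bnd_def band_right)
      then show ?case
        by (intro T_Blk) (use 4 assms in \<open>auto simp: Inv_def le_less\<close>)
    qed (use assms in \<open>auto simp: Inv_def\<close>)
  qed (use assms in auto)
qed

text \<open>Off the band the lengths differ by more than the radius, so the truncated distance is
  the radius plus one and no table entry is needed.\<close>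

lemma bnd_result:
  "(if j + (m 27 + 1) < i then m 27 + 1 else if 2 * m 27 + 2 < j + (m 27 + 1) - i then m 27 + 1
    else bnd m i (j + (m 27 + 1) - i)) = min (m 27 + 1) (pdist (m 16) (m 17) i j)"
proof -
  have "i \<le> j + pdist (m 16) (m 17) i j" "j \<le> i + pdist (m 16) (m 17) i j"
    using lev_ge_diff[of i j] by (auto simp: pdist_def)
  moreover have "bnd m i (j + (m 27 + 1) - i) = min (m 27 + 1) (pdist (m 16) (m 17) i j)"
    if "i \<le> j + (m 27 + 1)"
    using that by (simp add: bnd_def band_def pdist_def)
  ultimately show ?thesis by (auto simp: min_def)
qed

lemma T_band_result:
  assumes "band_regs m0 m" "m0 26 + m0 27 + 100 < 2 ^ w" "10 \<le> a"
    "\<forall>q\<le>2 * m0 27 + 2. m (64 + q) = bnd m0 (m0 25) q"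
  shows "T band_result a m (\<lambda>b m'. a \<le> b + 10 \<and> (\<forall>r. r \<notin> {28,34,36} \<longrightarrow> m' r = m r) \<and>
    m' 28 = min (m0 27 + 1) (pdist (m0 16) (m0 17) (m0 25) (m0 26)))"
proof -
  have f: "m 25 = m0 25" "m 26 = m0 26" "m 27 = m0 27" "m 32 = m0 27 + 1" "m 33 = 2 * m0 27 + 2" "m 52 = 64"
    using assms(1) by (auto simp: band_regs_def dp_frame_def)
  have w: "m0 26 + m0 27 + 100 - m0 25 < 2 ^ w" "m0 26 + Suc (m0 27) - m0 25 + 64 < 2 ^ w"
    using assms(2) by auto
  have r: "m (65 + (m0 26 + m0 27) - m0 25) = bnd m0 (m0 25) (Suc (m0 26 + m0 27) - m0 25)"
    if "\<not> Suc (m0 26 + m0 27) < m0 25" "\<not> Suc (Suc (2 * m0 27)) < Suc (m0 26 + m0 27) - m0 25"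
  proof -
    have "65 + (m0 26 + m0 27) - m0 25 = 64 + (Suc (m0 26 + m0 27) - m0 25)" using that by simp
    then show ?thesis using assms(4)[rule_format, of "Suc (m0 26 + m0 27) - m0 25"] that by simp
  qed
  show ?thesis
    unfolding band_result_def bnd_result[symmetric]
    by (intro T_intros) (use assms(2-3) f w r in auto)
qed

lemma T_band_dp:
  assumes "m 13 = 0" "m 14 = 1" "m 16 + m 25 + m 17 + m 26 + 5 * m 27 + 300 < 2 ^ w"
    "120 * (m 27 + 1) * (m 25 + 1) \<le> a"
  shows "T band_dp a m (\<lambda>b m'. a \<le> b + 120 * (m 27 + 1) * (m 25 + 1) \<and> dp_frame m m' \<and>
     m' 28 = min (m 27 + 1) (pdist (m 16) (m 17) (m 25) (m 26)))"
proof -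
  define D where "D = m 27"
  define C where "C = 12 + 50 * (2 * D + 2)"
  have C: "20 * D + 60 + m 25 * C \<le> 120 * (m 27 + 1) * (m 25 + 1)"
    by (simp add: C_def D_def algebra_simps)
  have C': "i * C + C \<le> m 25 * C" if "i < m 25" for i
    using that by (metis Suc_leI add.commute mult_Suc mult_le_mono1)
  define Inv where "Inv b m' \<longleftrightarrow> band_regs m m' \<and> m' 30 \<le> m 25 \<and>
     a \<le> b + 20 * D + 45 + m' 30 * C \<and>
     (\<forall>q\<le>2 * D + 2. m' (64 + q) = bnd m (m' 30) q)" for b m'
  show ?thesis
    unfolding band_dp_def
  proof (intro T_seq T_Blk T_mono[OF T_band_init], goal_cases)
    case (6 b1 m1)
    show ?case
    proof (rule T_WhileL[where Inv = Inv], goal_cases)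
      case 1
      then show ?case using 6 by (auto simp: Inv_def band_regs_def dp_frame_def D_def)
    next
      case (2 b m')
      then have "m' 30 * C \<le> m 25 * C" "a \<le> b + 20 * D + 45 + m' 30 * C" by (auto simp: Inv_def)
      then show ?case using assms(4) C by linarith
    next
      case (3 b m')
      then have f: "\<And>r. r < 64 \<Longrightarrow> r \<notin> dp_regs \<Longrightarrow> m' r = m r"
        "m' 32 = m 27 + 1" "m' 33 = 2 * m 27 + 2" "m' 52 = 64"
        and i: "m' 30 < m 25" and b: "a \<le> b + 20 * D + 45 + m' 30 * C"
        and row: "\<forall>q\<le>2 * D + 2. m' (64 + q) = bnd m (m' 30) q"
        unfolding Inv_def band_regs_def dp_frame_def by auto
      have e: "bnd m' = bnd m" by (intro ext) (simp add: bnd_def f)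
      have b2: "C \<le> b" "C - 2 = 10 + 50 * (2 * D + 2)" using b C C'[OF i] assms(4) by (auto simp: C_def)
      show ?case
      proof (rule T_mono[OF T_band_row], goal_cases)
        case (9 b2 m2)
        then show ?case using b2 b f i C'[OF i] unfolding Inv_def
          by (auto simp: e D_def C_def band_regs_def dp_frame_def)
      qed (use assms f i row b2 in \<open>auto simp: e D_def\<close>)
    next
      case (4 b m')
      then have i: "m' 30 = m 25" and b: "a \<le> b + 20 * D + 45 + m' 30 * C" and r: "band_regs m m'"
        and row: "\<forall>q\<le>2 * D + 2. m' (64 + q) = bnd m (m' 30) q"
        by (auto simp: Inv_def band_regs_def dp_frame_def)
      show ?case
      proof (rule T_mono[OF T_band_result[where ?m0.0 = m]], goal_cases)
        case (5 b2 m2)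
        then show ?case using r b i C assms(4) by (auto simp: band_regs_def dp_frame_def)
      qed (use assms r b i row C in \<open>auto simp: D_def\<close>)
    qed
  qed (use assms C in \<open>auto simp: D_def\<close>)
qed

text \<open>The radius is doubled until it reaches the distance or exceeds \<open>k\<close>. As it
  is doubled only while it is at most \<open>k\<close>, the result is the distance itself or a lower
  bound above \<open>k\<close>, and in either case at most \<open>2 * k + 2\<close>.\<close>

definition distance :: com where
  "distance = Blk [Copy 27 14, Copy 55 14] ;;
     WhileL 13 55
      (band_dp ;;
       IfL 27 28 (IfL 2 27 (Blk [Copy 55 13]) (Blk [Op Add 27 27 27])) (Blk [Copy 55 13]))"

definition distance_cost :: "nat \<Rightarrow> nat \<Rightarrow> nat" where
  "distance_cost i v = 4 * (120 * (i + 1) + 10) * (2 * v + 1) + 8"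

lemma T_distance:
  fixes m :: "nat \<Rightarrow> nat"
  defines "d \<equiv> pdist (m 16) (m 17) (m 25) (m 26)"
  assumes "m 13 = 0" "m 14 = 1" "m 16 + m 25 + m 17 + m 26 + 20 * m 2 + 400 < 2 ^ w"
    "distance_cost (m 25) (2 * m 2 + 2) \<le> a"
  shows "T distance a m (\<lambda>b m'. a \<le> b + distance_cost (m 25) (m' 28) \<and>
     (\<forall>r<64. r \<notin> {27,55} \<union> dp_regs \<longrightarrow> m' r = m r) \<and>
     m' 28 \<le> d \<and> m' 28 \<le> 2 * m 2 + 2 \<and> (m' 28 = d \<or> m 2 < m' 28))"
proof -
  define E where "E = 120 * (m 25 + 1) + 10"
  \<comment> \<open>A round of radius \<open>D\<close> costs at most \<open>2 * E * D\<close>. The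
    earlier rounds have radii \<open>1, 2, ..., D / 2\<close> and cost at most
    \<open>2 * E * (D - 1)\<close> altogether, so the total stays below \<open>4 * E * D\<close>;
    finally \<open>D\<close> is at most twice the result plus one.\<close>
  define Inv where "Inv b m' \<longleftrightarrow> (\<forall>r<64. r \<notin> {27,55} \<union> dp_regs \<longrightarrow> m' r = m r) \<and>
     0 < m' 27 \<and> m' 27 \<le> 2 * d + 1 \<and> m' 27 \<le> 2 * m 2 + 1 \<and>
     (if m' 55 = 0 then a \<le> b + 4 * E * m' 27 + 4 \<and> m' 28 = min (m' 27 + 1) d \<and> (m' 28 = d \<or> m 2 < m' 27)
      else a + 2 * E \<le> b + 2 * E * m' 27 + 4)" for b m'
  have E: "4 * E * (4 * m 2 + 5) + 8 \<le> a"
    using assms(5) by (simp add: distance_cost_def E_def algebra_simps)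
  have cost: "120 * (D + 1) * (m 25 + 1) + 10 \<le> 2 * E * D" if "0 < D" for D
  proof -
    have "(D + 1) * (120 * (m 25 + 1)) \<le> (2 * D) * (120 * (m 25 + 1))" "10 \<le> 20 * D"
      using that by (intro mult_right_mono, simp_all)
    moreover have "2 * E * D = (2 * D) * (120 * (m 25 + 1)) + 20 * D" by (simp add: E_def algebra_simps)
    moreover have "120 * (D + 1) * (m 25 + 1) = (D + 1) * (120 * (m 25 + 1))" by (simp only: ac_simps)
    ultimately show ?thesis by linarith
  qed
  show ?thesis
    unfolding distance_def
  proof (intro T_seq T_Blk, goal_cases)
    case 3
    show ?case
    proof (rule T_WhileL[where Inv = Inv], goal_cases)
      case 1
      show ?case using assms by (auto simp: Inv_def)
    next
      case (2 b m')
      then have "m' 27 \<le> 4 * m 2 + 5"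
        "a \<le> b + 4 * E * m' 27 + 4 \<or> a + 2 * E \<le> b + 2 * E * m' 27 + 4"
        unfolding Inv_def by (auto split: if_splits)
      moreover from this(1) have "4 * E * m' 27 \<le> 4 * E * (4 * m 2 + 5)"
        "2 * E * m' 27 \<le> 4 * E * (4 * m 2 + 5)" by (intro mult_le_mono; simp)+
      ultimately show ?case using E by linarith
    next
      case (3 b m')
      then have f: "\<And>r. r < 64 \<Longrightarrow> r \<notin> {27,55} \<union> dp_regs \<Longrightarrow> m' r = m r"
        and D: "0 < m' 27" "m' 27 \<le> 2 * d + 1" "m' 27 \<le> 2 * m 2 + 1"
        and b: "a + 2 * E \<le> b + 2 * E * m' 27 + 4" and go: "0 < m' 55"
        using assms(2) unfolding Inv_def by (auto split: if_splits)
      have f': "m' 2 = m 2" "m' 13 = 0" "m' 14 = 1" "m' 16 = m 16" "m' 17 = m 17" "m' 25 = m 25" "m' 26 = m 26"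
        using f assms(2,3) by auto
      have "2 * E * m' 27 \<le> 2 * E * (2 * m 2 + 1)" using D(3) by (intro mult_le_mono2)
      moreover have "2 * E * (2 * m 2 + 1) + 2 * E * (2 * m 2 + 1) + 8 \<le> 4 * E * (4 * m 2 + 5) + 8" by (simp add: algebra_simps)
      ultimately have b': "2 * E * m' 27 \<le> b" using b E by linarith
      note c = cost[OF D(1)]
      show ?case
      proof (intro T_seq T_mono[OF T_band_dp], goal_cases)
        case (5 b2 m2)
        have g: "\<And>r. r < 64 \<Longrightarrow> r \<notin> dp_regs \<Longrightarrow> m2 r = m' r" using 5 by (auto simp: dp_frame_def)
        have "m2 55 = m' 55" using g by simp
        then have g': "0 < m2 55" "m2 2 = m 2" "m2 13 = 0" "m2 14 = 1" "m2 27 = m' 27"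
          using g f' go by auto
        have v: "m2 28 = min (m' 27 + 1) d" using 5 f' by (simp add: d_def)
        have bb: "b \<le> b2 + 2 * E * m' 27 - 8" "8 \<le> b2" using 5 c b' b f' by auto
        show ?case
          by (intro T_intros)
            (use g g' f f' v bb b b' D assms(4) c in \<open>auto simp: Inv_def algebra_simps\<close>)
      qed (use f' assms D b' c in \<open>auto simp: algebra_simps\<close>)
    next
      case (4 b m')
      then have z: "m' 55 = 0" and i: "a \<le> b + 4 * E * m' 27 + 4" "m' 28 = min (m' 27 + 1) d"
        "m' 28 = d \<or> m 2 < m' 27" "m' 27 \<le> 2 * d + 1" "m' 27 \<le> 2 * m 2 + 1"
        "\<forall>r<64. r \<notin> {27,55} \<union> dp_regs \<longrightarrow> m' r = m r"
        using assms(2) by (auto simp: Inv_def split: if_splits)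
      have "4 * E * m' 27 \<le> 4 * E * (2 * m' 28 + 1)"
        using i by (intro mult_le_mono2) (auto simp: min_def)
      then have "a \<le> b - 2 + (4 * E * (2 * m' 28 + 1) + 8)" using i(1) by linarith
      then show ?case using i by (auto simp: distance_cost_def E_def min_def)
    qed
  qed (use assms in \<open>auto simp: distance_cost_def\<close>)
qed

section \<open>Mismatches on a diagonal\<close>

definition mism :: "nat \<Rightarrow> nat \<Rightarrow> nat \<Rightarrow> nat" where
  "mism x y i = card {a. a < i \<and> cX (x + a) \<noteq> cY (y + a)}"

lemma mism_0 [simp]: "mism x y 0 = 0"
  by (simp add: mism_def)

lemma mism_Suc: "mism x y (Suc i) = mism x y i + of_bool (cX (x + i) \<noteq> cY (y + i))"
proof -
  have "{a. a < Suc i \<and> cX (x + a) \<noteq> cY (y + a)} =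
     {a. a < i \<and> cX (x + a) \<noteq> cY (y + a)} \<union> (if cX (x + i) \<noteq> cY (y + i) then {i} else {})"
    by (auto simp: less_Suc_eq)
  then show ?thesis by (simp add: mism_def)
qed

lemma mism_mono: "i \<le> j \<Longrightarrow> mism x y i \<le> mism x y j"
  unfolding mism_def by (intro card_mono) auto

lemma pdist_le_mism: "pdist x y i i \<le> mism x y i"
  unfolding pdist_def mism_def by (rule lev_le_mismatches)

definition scan_mismatches :: com where
  "scan_mismatches = Blk [Copy 48 16, Copy 51 17, Copy 50 13] ;;
     WhileL 50 28
      (Blk [Read_X 42 48, Read_Y 43 51] ;;
       IfEq 42 43 (Blk []) (Blk [Op Add 50 50 14]) ;;
       Blk [Op Add 48 48 14, Op Add 51 51 14])"

text \<open>The loop does not test for the end of the phrase: the third hypothesis provides as many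
  mismatches as are requested.\<close>

lemma T_scan_mismatches:
  assumes "m 13 = 0" "m 14 = 1" "m 28 \<le> mism (m 16) (m 17) i" "m 16 + m 17 + i + 10 < 2 ^ w" "12 * i + 6 \<le> a"
  shows "T scan_mismatches a m (\<lambda>b m'. a \<le> b + 12 * i + 6 \<and>
     (\<forall>r. r \<notin> {42,43,48,50,51} \<longrightarrow> m' r = m r) \<and>
     (\<exists>e\<le>i. m' 48 = m 16 + e \<and> mism (m 16) (m 17) e = m 28))"
proof -
  define Inv where "Inv b m' \<longleftrightarrow> (\<forall>r. r \<notin> {42,43,48,50,51} \<longrightarrow> m' r = m r) \<and>
     (\<exists>e\<le>i. m' 48 = m 16 + e \<and> m' 51 = m 17 + e \<and> m' 50 = mism (m 16) (m 17) e \<and> m' 50 \<le> m 28 \<and>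
        a \<le> b + 12 * e + 3)" for b m'
  show ?thesis
    unfolding scan_mismatches_def
  proof (intro T_seq T_Blk, goal_cases)
    case 3
    show ?case
    proof (rule T_WhileL[where Inv = Inv], goal_cases)
      case 1
      show ?case using assms by (auto simp: Inv_def)
    next
      case (2 b m')
      then show ?case using assms by (auto simp: Inv_def)
    next
      case (3 b m')
      then obtain e where e: "e \<le> i" "m' 48 = m 16 + e" "m' 51 = m 17 + e" "m' 50 = mism (m 16) (m 17) e"
        "m' 50 < m 28" "a \<le> b + 12 * e + 3" and f: "\<forall>r. r \<notin> {42,43,48,50,51} \<longrightarrow> m' r = m r"
        by (auto simp: Inv_def)
      have "e < i" using e assms(3) mism_mono[of i e "m 16" "m 17"] by (cases "e < i") auto
      have s: "mism (m 16) (m 17) e + 1 < 2 ^ w" "m 16 + e + 1 < 2 ^ w" "m 17 + e + 1 < 2 ^ w"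
      proof -
        have "mism (m 16) (m 17) e \<le> e" unfolding mism_def
          by (rule order_trans[OF card_mono[of "{..<e}"]]) auto
        then show "mism (m 16) (m 17) e + 1 < 2 ^ w" using e assms(4) by linarith
      qed (use e assms(4) in auto)
      show ?case
        apply (intro T_intros)
        unfolding Inv_def
        using e f s assms \<open>e < i\<close>
        by (auto simp: mism_Suc intro!: exI[of _ "Suc e"])
    next
      case (4 b m')
      then show ?case by (auto simp: Inv_def)
    qed
  qed (use assms in auto)
qed

end

text \<open>Every residue modulo a divisor \<open>g\<close> of \<open>W\<close> occurs
  \<open>W / g\<close> times among the numbers below \<open>W\<close>.\<close>

lemma sum_mod_average:
  fixes h :: "nat \<Rightarrow> real"
  assumes "g dvd W" "0 < W"
  shows "(\<Sum>v<W. h (v mod g)) / W = (\<Sum>u<g. h u) / g"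
proof -
  obtain q where q: "W = g * q" using assms(1) by (auto simp: dvd_def)
  have "(\<Sum>v<g * q. h (v mod g)) = q * (\<Sum>u<g. h u)"
  proof (induction q)
    case (Suc q)
    have "{..<g * Suc q} = {..<g * q} \<union> {g * q..<g * q + g}" by auto
    then have "(\<Sum>v<g * Suc q. h (v mod g)) = (\<Sum>v<g * q. h (v mod g)) + (\<Sum>v=g * q..<g * q + g. h (v mod g))"
      using sum.union_disjoint[of "{..<g * q}" "{g * q..<g * q + g}" "\<lambda>v. h (v mod g)"]
      by (metis (no_types, lifting) finite_lessThan finite_atLeastLessThan disjoint_iff lessThan_iff
          atLeastLessThan_iff not_less)
    also have "(\<Sum>v=g * q..<g * q + g. h (v mod g)) = (\<Sum>u<g. h u)"
      using sum.shift_bounds_nat_ivl[of "\<lambda>v. h (v mod g)" 0 "g * q" g]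
      by (simp add: add.commute lessThan_atLeast0)
    finally show ?case using Suc by (simp add: algebra_simps)
  qed simp
  then show ?thesis using q assms(2) by simp
qed

lemma average_hits:
  fixes x y :: real and g :: nat and A :: "nat set"
  assumes "0 < g"
  shows "(\<Sum>u<g. if u \<in> A then x else y) / g
    = real (card {u. u < g \<and> u \<in> A}) / g * x + (1 - real (card {u. u < g \<and> u \<in> A}) / g) * y"
proof -
  let ?A = "{u. u < g \<and> u \<in> A}"
  have e: "{..<g} \<inter> {u. u \<in> A} = ?A" "{..<g} \<inter> - {u. u \<in> A} = {..<g} - ?A" by auto
  have "(\<Sum>u<g. if u \<in> A then x else y) = (\<Sum>u\<in>?A. x) + (\<Sum>u\<in>{..<g} - ?A. y)"
    using sum.If_cases[OF finite_lessThan, of "\<lambda>u. u \<in> A" "\<lambda>_. x" "\<lambda>_. y" g] unfolding e .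
  also have "\<dots> = card ?A * x + (g - card ?A) * y"
    by (simp add: card_Diff_subset subset_eq)
  moreover have "card ?A \<le> g" using card_mono[of "{..<g}" ?A] by auto
  ultimately show ?thesis using assms by (simp add: field_simps of_nat_diff)
qed

context ram
begin

lemma V_Blk:
  assumes "list_all det is" "length is \<le> a" "f (a - length is) (effs is m) \<le> u"
  shows "V (Blk is) f a m u"
  by (rule T_V[OF T_Blk[where Q = "\<lambda>b m'. b = a - length is \<and> m' = effs is m"]]) (use assms in auto)

end

section \<open>Estimating one phrase by sampling\<close>

locale sampler = bounded_ram +
  fixes n ny k lp Dl g TH :: nat
  assumes bounds: "n \<le> B" "ny \<le> B" "k \<le> B" "lp \<le> B" "Dl \<le> B" "g \<le> B" "TH \<le> 2 * B"
    and g: "0 < g" "g dvd 2 ^ w" and Dl: "0 < Dl" "Dl dvd 2 ^ w"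
begin

text \<open>The cells that stay fixed during the runs: \<open>lp\<close> is the window length,
  \<open>Dl\<close> the cut distance, \<open>g\<close> the stride, \<open>TH\<close> the acceptance
  threshold. Cell \<open>10\<close> holds \<open>TH + 1\<close>; copying it into the estimate marks
  a run as lost.\<close>

definition conf :: "(nat \<Rightarrow> nat) \<Rightarrow> bool" where
  "conf m \<longleftrightarrow> m 0 = n \<and> m 1 = ny \<and> m 2 = k \<and> m 4 = lp \<and> m 6 = Dl \<and> m 8 = g \<and> m 9 = TH \<and>
     m 10 = TH + 1 \<and> m 13 = 0 \<and> m 14 = 1 \<and> m 15 = 2 * k + 1"

lemma word_bound: "x < 1000 * B \<Longrightarrow> x < 2 ^ w"
  using B_word by linarith

text \<open>
  \<open>H acc r\<close> bounds the failure probability if the estimate accumulated so far is \<open>acc\<close> and the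
  remaining phrases have total cost \<open>r\<close>: the two inequalities state that sampling a stride with \<open>c\<close>
  hits, respectively computing a cost exactly, does not increase the bound.  The run is lost once
  \<open>acc\<close> exceeds \<open>TH\<close>.
\<close>

definition potential :: "(nat \<Rightarrow> nat \<Rightarrow> real) \<Rightarrow> real \<Rightarrow> bool" where
  "potential H lost \<longleftrightarrow>
     (\<forall>acc r c. acc \<le> TH \<longrightarrow> c \<le> g \<longrightarrow>
        real c / g * H (acc + g) r + (1 - real c / g) * H acc r \<le> H acc (r + c)) \<and>
     (\<forall>acc r d. acc \<le> TH \<longrightarrow> H (acc + d) r \<le> H acc (r + d)) \<and>
     (\<forall>acc r. TH < acc \<longrightarrow> H acc r = lost)"

text \<open>The first \<open>d\<close> mismatches on the diagonal through \<open>(x, y)\<close>.\<close>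

definition hits :: "nat \<Rightarrow> nat \<Rightarrow> nat \<Rightarrow> nat \<Rightarrow> nat set" where
  "hits x y L d = {i. i < L \<and> cX (x + i) \<noteq> cY (y + i) \<and> mism x y i < d}"

lemma finite_hits [simp]: "finite (hits x y L d)"
  by (simp add: hits_def)

lemma card_hits: "card (hits x y L d) = min d (mism x y L)"
proof (induction L)
  case (Suc L)
  have "hits x y (Suc L) d = hits x y L d \<union>
     (if cX (x + L) \<noteq> cY (y + L) \<and> mism x y L < d then {L} else {})"
    by (auto simp: hits_def less_Suc_eq)
  moreover have "L \<notin> hits x y L d" by (simp add: hits_def)
  ultimately show ?case using Suc by (auto simp: mism_Suc)
qed (simp add: hits_def)

text \<open>Once a position \<open>e\<close> with \<open>d\<close> mismatches before it is known,
  one comparison decides whether a mismatch is marked. This keeps the cost per stride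
  constant.\<close>

lemma hits_less:
  assumes "mism x y e = d" "i < L" "cX (x + i) \<noteq> cY (y + i)"
  shows "i \<in> hits x y L d \<longleftrightarrow> i < e"
proof
  assume "i \<in> hits x y L d"
  then show "i < e" using assms mism_mono[of e i x y] by (cases "i < e") (auto simp: hits_def)
next
  assume "i < e"
  then have "mism x y (Suc i) \<le> d" using assms mism_mono[of "Suc i" e x y] by simp
  then show "i \<in> hits x y L d" using assms by (simp add: hits_def mism_Suc)
qed

text \<open>Cell \<open>48\<close> is zero as long as no mismatch has been seen. Afterwards it is
  positive even in a phrase that starts at \<open>0\<close>, as it points one place beyond a
  mismatch; if the budget is exceeded, the nonzero end of the phrase is stored instead.\<close>

definition first_mismatch :: com where
  "first_mismatch = IfL 13 48 (Blk [])
     (distance ;; Blk [Op Add 20 20 28] ;; IfL 2 20 (Blk [Copy 19 10, Copy 48 21]) scan_mismatches)"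

definition stride_hit :: com where
  "stride_hit = first_mismatch ;; IfL 47 48 (IfL 9 19 (Blk []) (Blk [Op Add 19 19 8])) (Blk [])"

definition stride :: com where
  "stride = Blk [Op Mod 47 47 8, Op Add 47 46 47] ;;
     IfL 47 21
      (Blk [Op Add 49 47 17, Op Sub 49 49 16, Read_X 53 47, Read_Y 54 49] ;;
       IfEq 53 54 (Blk []) stride_hit)
      (Blk []) ;;
     Blk [Op Add 46 46 8]"

definition sample_phrase :: com where
  "sample_phrase = Blk [Copy 46 16, Copy 48 13] ;; WhileL 46 21 (Rnd 47 ;; stride)"

definition sample_regs :: "nat set" where
  "sample_regs = {19,20,27,42,43,55} \<union> {46..54} \<union> {28..39}"

lemma sample_regs_mem [simp]: "r \<in> sample_regs \<longleftrightarrow> r \<in> {19,20,27,42,43,55} \<or> 46 \<le> r \<and> r \<le> 54 \<or> 28 \<le> r \<and> r \<le> 39"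
  by (auto simp: sample_regs_def)

definition phrase_regs :: "nat \<Rightarrow> nat \<Rightarrow> nat \<Rightarrow> (nat \<Rightarrow> nat) \<Rightarrow> bool" where
  "phrase_regs x y L m \<longleftrightarrow> conf m \<and> m 16 = x \<and> m 17 = y \<and> m 25 = L \<and> m 26 = L \<and> m 21 = x + L \<and>
     x + L \<le> B \<and> y + L \<le> 4 * B"

lemma phrase_regs_frame:
  assumes "phrase_regs x y L m" "\<And>r. r < 64 \<Longrightarrow> r \<notin> sample_regs \<Longrightarrow> m' r = m r"
  shows "phrase_regs x y L m'"
  using assms(1) by (simp add: phrase_regs_def conf_def assms(2))

text \<open>The state after a mismatch has been found: either the cost \<open>d\<close> of the phrase is known and
  position \<open>m 48\<close> is just beyond the \<open>d\<close>-th mismatch, or the budget \<open>k\<close> is exceeded.\<close>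

definition resolved :: "nat \<Rightarrow> nat \<Rightarrow> nat \<Rightarrow> nat \<Rightarrow> (nat \<Rightarrow> nat) \<Rightarrow> bool" where
  "resolved x y d ex m \<longleftrightarrow> 0 < m 48 \<and>
     ((\<exists>e. m 48 = x + e \<and> mism x y e = d \<and> m 20 = ex + d \<and> ex + d \<le> k) \<or>
      TH < m 19 \<and> k < ex + d \<and> m 20 \<le> 3 * k + 2)"

text \<open>Amortised analysis: each unit added to cell \<open>20\<close> releases \<beta> credits,
  which pay for the dynamic program and the scan. Before an addition the cell is at most
  \<open>k\<close>, and one result is at most \<open>2 * k + 2\<close>, so \<open>3 * k + 3\<close>
  units never run out.\<close>

lemma T_first_mismatch:
  assumes regs: "phrase_regs x y L m"
    and d: "d = pdist x y L L" "0 < d"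
    and ex: "ex \<le> k"
    and state: "m 48 = 0 \<and> m 20 = ex \<and> m 19 \<le> TH \<or> resolved x y d ex m"
    and cost: "\<And>v. 1 \<le> v \<Longrightarrow> distance_cost L v + 12 * L + 60 \<le> \<beta> * v"
    and a: "\<beta> * (3 * k + 3 - m 20) + b1 + 4 \<le> a"
  shows "T first_mismatch a m (\<lambda>b m'. (\<forall>r<64. r \<notin> sample_regs - {46,47,49,53,54} \<longrightarrow> m' r = m r) \<and>
     resolved x y d ex m' \<and> \<beta> * (3 * k + 3 - m' 20) + b1 \<le> b \<and>
     (m' 19 = m 19 \<or> k < ex + d \<and> m' 19 = TH + 1))"
  unfolding first_mismatch_def
proof (intro T_IfL, goal_cases)
  case 2
  then show ?case using state a regs by (intro T_Blk) (auto simp: resolved_def phrase_regs_def conf_def)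
next
  case 3
  have r: "m 16 = x" "m 17 = y" "m 25 = L" "m 26 = L" "m 21 = x + L" "m 2 = k" "m 13 = 0" "m 14 = 1"
    "m 10 = TH + 1" "x + L \<le> B" "y + L \<le> 4 * B"
    using regs by (auto simp: phrase_regs_def conf_def)
  have s: "m 48 = 0" "m 20 = ex" "m 19 \<le> TH" using state 3 r by (auto simp: resolved_def)
  have w: "m 16 + m 25 + m 17 + m 26 + 20 * m 2 + 400 < 2 ^ w"
    using r bounds B_pos by (intro word_bound) auto
  \<comment> \<open>The result is not known in advance, so credits for its largest possible value
    \<open>2 * k + 2\<close> have to be at hand; the surplus comes back.\<close>
  have "\<beta> * (2 * k + 2) \<le> \<beta> * (3 * k + 3 - ex)" using ex by (intro mult_le_mono2) auto
  then have a1: "distance_cost (m 25) (2 * m 2 + 2) \<le> a - 2"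
    using cost[of "2 * k + 2"] a s r by auto
  show ?case
  proof (intro T_seq T_mono[OF T_distance], goal_cases)
    case (5 b2 m2)
    define v where "v = m2 28"
    have v: "0 < v" "v \<le> d" "v \<le> 2 * k + 2" "v = d \<or> k < v" and b2: "a - 2 \<le> b2 + distance_cost L v"
      and f: "\<And>q. q < 64 \<Longrightarrow> q \<notin> {27,55} \<union> dp_regs \<Longrightarrow> m2 q = m q"
      using 5 r d by (auto simp: v_def)
    have c: "\<beta> * (3 * k + 3 - (ex + v)) + (distance_cost L v + 12 * L + 60) \<le> \<beta> * (3 * k + 3 - ex)"
    proof -
      have "3 * k + 3 - ex = (3 * k + 3 - (ex + v)) + v" using v ex by simp
      then have "\<beta> * (3 * k + 3 - ex) = \<beta> * (3 * k + 3 - (ex + v)) + \<beta> * v"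
        by (simp only: distrib_left)
      then show ?thesis using cost[of v] v by simp
    qed
    have b3: "\<beta> * (3 * k + 3 - (ex + v)) + b1 + 12 * L + 60 \<le> b2 + 2"
      using b2 c a s by simp
    have fr: "m2 16 = x" "m2 17 = y" "m2 21 = x + L" "m2 2 = k" "m2 13 = 0" "m2 14 = 1" "m2 10 = TH + 1"
      "m2 20 = ex" "m2 19 = m 19"
      using f r s by auto
    have w2: "ex + v < 2 ^ w" using ex v bounds B_pos by (intro word_bound) auto
    have L: "0 < L" using d by (cases L) (auto simp: pdist_def)
    show ?case
    proof (intro T_seq T_Blk T_IfL, goal_cases)
      case 6
      then have k: "k < ex + v" using fr w2 by (simp add: v_def)
      have "(\<forall>r<64. r \<notin> sample_regs - {46,47,49,53,54} \<longrightarrow>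
          effs [Copy 19 10, Copy 48 21] (effs [Op Add 20 20 28] m2) r = m r)"
        using f by auto
      then show ?case using k v fr w2 b3 L ex by (auto simp: resolved_def v_def[symmetric])
    next
      case 7
      then have k: "ex + v \<le> k" using fr w2 by (simp add: v_def)
      then have vd: "v = d" using v by auto
      show ?case
      proof (rule T_mono[OF T_scan_mismatches[where i = L]], goal_cases)
        case 3
        then show ?case using vd d pdist_le_mism[of x y L] fr by (simp add: v_def)
      next
        case 4
        then show ?case using r fr bounds B_pos by (intro word_bound) auto
      next
        case 5
        then show ?case using b3 by simp
      next
        case (6 b4 m4)
        then obtain e where e: "m4 48 = x + e" "mism x y e = d"
          using fr vd by (auto simp: v_def)
        have g: "\<And>q. q \<notin> {42,43,48,50,51} \<Longrightarrow> m4 q = (m2(20 := ex + v)) q"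
          using 6 fr w2 by (auto simp: v_def)
        have "0 < e" using e d(2) by (cases e) auto
        then have "resolved x y d ex m4" using e g[of 20] k vd by (auto simp: resolved_def)
        moreover have "\<beta> * (3 * k + 3 - m4 20) + b1 \<le> b4"
        proof -
          have "b2 - Suc (Suc (Suc 0)) \<le> b4 + 12 * L + 6" "m4 20 = ex + v" using 6 g[of 20] by simp_all
          then show ?thesis using b3 by simp
        qed
        moreover have "\<forall>r<64. r \<notin> sample_regs - {46,47,49,53,54} \<longrightarrow> m4 r = m r" using g f by auto
        ultimately show ?case using g[of 19] fr by auto
      qed (use fr in auto)
    qed (use b3 in auto)
  qed (use r w a1 in auto)
qed (use a in auto)

lemma T_stride_hit:
  assumes regs: "phrase_regs x y L m"
    and d: "d = pdist x y L L"
    and ex: "ex \<le> k"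
    and pos: "m 46 = x + i" "m 47 = x + (i + u)" "i + u < L" "cX (x + (i + u)) \<noteq> cY (y + (i + u))"
    and acc: "m 19 \<le> 3 * B + 1"
    and state: "m 48 = 0 \<and> m 20 = ex \<and> m 19 \<le> TH \<or> resolved x y d ex m"
    and cost: "\<And>v. 1 \<le> v \<Longrightarrow> distance_cost L v + 12 * L + 60 \<le> \<beta> * v"
    and a: "\<beta> * (3 * k + 3 - m 20) + b1 + 12 \<le> a"
  shows "T stride_hit a m (\<lambda>b m'. (\<forall>r<64. r \<notin> sample_regs \<longrightarrow> m' r = m r) \<and>
     m' 46 = x + i \<and> \<beta> * (3 * k + 3 - m' 20) + b1 \<le> b \<and> resolved x y d ex m' \<and>
     (m' 19 = (if i + u \<in> hits x y L d \<and> m 19 \<le> TH then m 19 + g else m 19) \<or>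
      k < ex + d \<and> m' 19 = TH + 1))" (is "T _ _ _ ?Q")
proof -
  have r: "m 8 = g" "m 9 = TH"
    using regs by (auto simp: phrase_regs_def conf_def)
  have w: "m 19 + g < 2 ^ w"
    using bounds B_pos acc by (auto intro!: word_bound)
  have "0 < d"
    using lev_eq_0D[of "\<lambda>a. cX (x + a)" "\<lambda>b. cY (y + b)" L L] pos d
    by (auto simp: pdist_def)
  have a': "\<beta> * (3 * k + 3 - m 20) + (b1 + 8) + 4 \<le> a" using a by simp
  show ?thesis
    unfolding stride_hit_def
  proof (rule T_seq, rule T_mono[OF T_first_mismatch[OF regs d \<open>0 < d\<close> ex state cost a']], assumption)
    fix b2 m2
    assume "(\<forall>r<64. r \<notin> sample_regs - {46,47,49,53,54} \<longrightarrow> m2 r = m r) \<and>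
     resolved x y d ex m2 \<and> \<beta> * (3 * k + 3 - m2 20) + (b1 + 8) \<le> b2 \<and>
     (m2 19 = m 19 \<or> k < ex + d \<and> m2 19 = TH + 1)"
    then have f2: "\<And>q. q < 64 \<Longrightarrow> q \<notin> sample_regs - {46,47,49,53,54} \<Longrightarrow> m2 q = m q"
      and res: "resolved x y d ex m2" and b2: "\<beta> * (3 * k + 3 - m2 20) + (b1 + 8) \<le> b2"
      and a2: "m2 19 = m 19 \<or> k < ex + d \<and> m2 19 = TH + 1" by blast+
    have m2: "m2 46 = x + i" "m2 47 = x + (i + u)" "m2 8 = g" "m2 9 = TH"
      using f2[of 46] f2[of 47] f2[of 8] f2[of 9] pos r by auto
    have hit: "x + (i + u) < m2 48 \<longleftrightarrow> i + u \<in> hits x y L d" if "m2 19 \<le> TH"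
      using res that hits_less[of x y _ d "i + u" L] pos by (auto simp: resolved_def)
    have fin: "\<forall>r<64. r \<notin> sample_regs \<longrightarrow> m2 r = m r"
      using f2 by auto
    show "T (IfL 47 48 (IfL 9 19 (Blk []) (Blk [Op Add 19 19 8])) (Blk [])) b2 m2 ?Q"
    proof (cases "m2 19 \<le> TH")
      case True
      then have "m2 19 = m 19" using a2 by simp
      then show ?thesis
        by (intro T_intros) (use fin res b2 m2 hit w True in \<open>auto simp: resolved_def\<close>)
    next
      case False
      then show ?thesis
        by (intro T_intros) (use fin res b2 m2 a2 in \<open>auto simp: resolved_def\<close>)
    qed
  qed
qed

lemma T_stride:
  assumes regs: "phrase_regs x y L m"
    and d: "d = pdist x y L L"
    and ex: "ex \<le> k"
    and pos: "m 46 = x + i" "i < L" "m 47 mod g = u"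
    and acc: "m 19 \<le> 3 * B + 1"
    and state: "m 48 = 0 \<and> m 20 = ex \<and> m 19 \<le> TH \<or> resolved x y d ex m"
    and cost: "\<And>v. 1 \<le> v \<Longrightarrow> distance_cost L v + 12 * L + 60 \<le> \<beta> * v"
    and a: "\<beta> * (3 * k + 3 - m 20) + b1 + 30 \<le> a"
  shows "T stride a m (\<lambda>b m'. (\<forall>r<64. r \<notin> sample_regs \<longrightarrow> m' r = m r) \<and>
     m' 46 = x + i + g \<and> \<beta> * (3 * k + 3 - m' 20) + b1 \<le> b \<and>
     (m' 48 = 0 \<and> m' 20 = ex \<and> m' 19 \<le> TH \<or> resolved x y d ex m') \<and>
     (m' 19 = (if i + u \<in> hits x y L d \<and> m 19 \<le> TH then m 19 + g else m 19) \<or>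
      k < ex + d \<and> m' 19 = TH + 1))" (is "T _ _ _ ?Q")
proof -
  have r: "m 16 = x" "m 17 = y" "m 21 = x + L" "m 8 = g" "x + L \<le> B" "y + L \<le> 4 * B"
    using regs by (auto simp: phrase_regs_def conf_def)
  have u: "u < g" using pos(3) g by auto
  have w: "x + (i + u) < 2 ^ w" "x + i + g < 2 ^ w" "x + (i + u) + y < 2 ^ w" "y + (i + u) < 2 ^ w"
    using pos u r bounds B_pos acc by (auto intro!: word_bound)
  show ?thesis
    unfolding stride_def
  proof (rule T_seq, rule T_Blk)
    let ?m = "effs [Op Mod 47 47 8, Op Add 47 46 47] m"
    have m: "?m = m(47 := x + (i + u))" using pos r w by (simp add: ac_simps)
    \<comment> \<open>A position that matches or lies beyond the end of the phrase is not marked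
      whatever \<open>d\<close> is, so such a sample is settled without knowing the
      distance.\<close>
    have nohit: "i + u \<notin> hits x y L d"
      if "\<not> i + u < L \<or> cX (x + (i + u)) = cY (y + (i + u))"
      using that by (auto simp: hits_def)
    show "T (IfL 47 21
      (Blk [Op Add 49 47 17, Op Sub 49 49 16, Read_X 53 47, Read_Y 54 49] ;;
       IfEq 53 54 (Blk []) stride_hit)
      (Blk []) ;; Blk [Op Add 46 46 8]) (a - length [Op Mod 47 47 8, Op Add 47 46 47]) ?m
      ?Q"
      unfolding m
    proof (rule T_seq, rule T_IfL)
      assume "\<not> (m(47 := x + (i + u))) 47 < (m(47 := x + (i + u))) 21"
      then have "i + u \<notin> hits x y L d" using nohit r by simp
      then show "T (Blk []) (a - length [Op Mod 47 47 8, Op Add 47 46 47] - 2) (m(47 := x + (i + u)))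
        (\<lambda>b m'. T (Blk [Op Add 46 46 8]) b m' ?Q)"
        by (intro T_Blk) (use w pos r state a in \<open>auto simp: resolved_def\<close>)
    next
      assume lt: "(m(47 := x + (i + u))) 47 < (m(47 := x + (i + u))) 21"
      let ?m1 = "m(47 := x + (i + u), 49 := y + (i + u), 53 := cX (x + (i + u)), 54 := cY (y + (i + u)))"
      have m1: "effs [Op Add 49 47 17, Op Sub 49 49 16, Read_X 53 47, Read_Y 54 49] (m(47 := x + (i + u))) = ?m1"
        using r w by (simp add: ac_simps)
      show "T (Blk [Op Add 49 47 17, Op Sub 49 49 16, Read_X 53 47, Read_Y 54 49] ;;
         IfEq 53 54 (Blk []) stride_hit) (a - length [Op Mod 47 47 8, Op Add 47 46 47] - 2)
        (m(47 := x + (i + u)))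
        (\<lambda>b m'. T (Blk [Op Add 46 46 8]) b m' ?Q)"
      proof (rule T_seq, rule T_Blk, goal_cases)
        case 3
        show ?case unfolding m1
        proof (rule T_IfEq, goal_cases)
          case 2
          then have "i + u \<notin> hits x y L d" using nohit by simp
          then show ?case
            by (intro T_Blk) (use w pos r state a in \<open>auto simp: resolved_def\<close>)
        next
          case 3
          show ?case
          proof (rule T_mono[OF T_stride_hit[where x = x and y = y and L = L and d = d and
                ex = ex and i = i and u = u and \<beta> = \<beta> and ?b1.0 = "b1 + 2"]], goal_cases)
            case 1
            show ?case by (rule phrase_regs_frame[OF regs]) auto
          next
            case 9
            show ?case using state by (auto simp: resolved_def)
          next
            case (12 b2 m2)
            then have "m2 46 = x + i" "m2 8 = g" using r by simp_all
            then show ?case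
              by (intro T_Blk) (use 12 w in \<open>auto simp: resolved_def\<close>)
          qed (use 3 d ex pos lt r acc cost a in auto)
        qed (use a in auto)
      qed (use a in auto)
    qed (use a in auto)
  qed (use a in auto)
qed

definition phrase_post :: "nat \<Rightarrow> nat \<Rightarrow> nat \<Rightarrow> nat \<Rightarrow> (nat \<Rightarrow> nat) \<Rightarrow> nat \<Rightarrow> (nat \<Rightarrow> nat) \<Rightarrow> bool" where
  "phrase_post \<beta> b1 d ex m b m' \<longleftrightarrow> (\<forall>r<64. r \<notin> sample_regs \<longrightarrow> m' r = m r) \<and>
     \<beta> * (3 * k + 3 - m' 20) + b1 \<le> b \<and> m' 19 \<le> 6 * B \<and> m' 20 \<le> 3 * k + 2 \<and>
     (m' 19 \<le> TH \<longrightarrow> m' 20 \<le> k \<and> (m' 20 = ex \<or> m' 20 = ex + d))"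

text \<open>During the loop the bound is \<open>H\<close> at the current estimate and the number of
  marked positions still ahead, plus the cost \<open>R\<close> of the later phrases. At the start
  all \<open>d\<close> marked positions are ahead, at the end none.\<close>

lemma V_sample_phrase:
  assumes regs: "phrase_regs x y L m"
    and d: "d = pdist x y L L"
    and ex: "m 20 = ex" "ex \<le> k" and acc: "m 19 \<le> TH"
    and cost: "\<And>v. 1 \<le> v \<Longrightarrow> distance_cost L v + 12 * L + 60 \<le> \<beta> * v"
    and pot: "potential H lost" and lose: "\<And>acc r. k < ex + d \<Longrightarrow> lost \<le> H acc r"
    and a: "\<beta> * (3 * k + 3 - ex) + b1 + 40 * (L div g + 1) + 10 \<le> a"
    and post: "\<And>b m'. phrase_post \<beta> b1 d ex m b m' \<Longrightarrow> f b m' \<le> H (m' 19) R"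
  shows "V sample_phrase f a m (H (m 19) (d + R))"
proof -
  define rem where "rem i = card {h \<in> hits x y L d. i \<le> h}" for i
  \<comment> \<open>\<open>j\<close> strides cover what is left of the phrase; the last one may
    stick out beyond its end, hence \<open>i \<le> L + g\<close>.\<close>
  define Inv where "Inv b m' \<longleftrightarrow> (\<forall>r<64. r \<notin> sample_regs \<longrightarrow> m' r = m r) \<and> m' 19 \<le> 3 * B \<and>
     (m' 48 = 0 \<and> m' 20 = ex \<and> m' 19 \<le> TH \<or> resolved x y d ex m') \<and>
     (\<exists>i j. m' 46 = x + i \<and> i \<le> L + g \<and> L \<le> i + j * g \<and> \<beta> * (3 * k + 3 - m' 20) + b1 + 40 * j + 2 \<le> b)"
    for b m'
  define J where "J m' = H (m' 19) (rem (m' 46 - x) + R)" for m' :: "nat \<Rightarrow> nat"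
  have r: "m 16 = x" "m 17 = y" "m 21 = x + L" "m 8 = g" "x + L \<le> B" "y + L \<le> 4 * B" "m 13 = 0"
    using regs by (auto simp: phrase_regs_def conf_def)
  have rem0: "rem 0 = d"
    unfolding rem_def by (simp add: card_hits d pdist_le_mism min_absorb1)
  have remL: "rem i = 0" if "L \<le> i" for i
  proof -
    have "{h \<in> hits x y L d. i \<le> h} = {}" using that by (auto simp: hits_def)
    then show ?thesis by (simp only: rem_def card.empty)
  qed
  have rem_step: "rem i = card {u. u < g \<and> i + u \<in> hits x y L d} + rem (i + g)" for i
  proof -
    have "{h \<in> hits x y L d. i \<le> h} = (\<lambda>u. i + u) ` {u. u < g \<and> i + u \<in> hits x y L d} \<union>
       {h \<in> hits x y L d. i + g \<le> h}"
    proof (rule set_eqI)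
      fix h
      show "h \<in> {h \<in> hits x y L d. i \<le> h} \<longleftrightarrow> h \<in> (\<lambda>u. i + u) ` {u. u < g \<and> i + u \<in> hits x y L d} \<union>
         {h \<in> hits x y L d. i + g \<le> h}"
        by (cases "i \<le> h") (auto simp: le_iff_add image_iff not_less)
    qed
    moreover have "card ((\<lambda>u. i + u) ` {u. u < g \<and> i + u \<in> hits x y L d})
      = card {u. u < g \<and> i + u \<in> hits x y L d}"
      by (intro card_image) simp
    ultimately show ?thesis
      unfolding rem_def by (simp only:) (subst card_Un_disjoint, auto)
  qed
  have "V (WhileL 46 21 (Rnd 47 ;; stride)) f (a - 2) (m(46 := x, 48 := 0)) (J (m(46 := x, 48 := 0)))"
  proof (rule V_WhileL[where Inv = Inv], goal_cases)
    case 1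
    have "L \<le> (L div g + 1) * g"
      using dividend_less_div_times[OF g(1), of L] by simp
    then have "L \<le> 0 + (L div g + 1) * g" by simp
    moreover have "m 19 \<le> 3 * B" using acc bounds by simp
    ultimately show ?case using ex acc a unfolding Inv_def
      by (intro conjI exI[of _ 0] exI[of _ "L div g + 1"]) auto
  next
    case (2 b m')
    then show ?case by (auto simp: Inv_def)
  next
    case (3 b m')
    then obtain i j where i: "m' 46 = x + i" "i \<le> L + g" "L \<le> i + j * g"
        "\<beta> * (3 * k + 3 - m' 20) + b1 + 40 * j + 2 \<le> b"
      and fr: "\<forall>r<64. r \<notin> sample_regs \<longrightarrow> m' r = m r" and acc': "m' 19 \<le> 3 * B"
      and st: "m' 48 = 0 \<and> m' 20 = ex \<and> m' 19 \<le> TH \<or> resolved x y d ex m'"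
      unfolding Inv_def by blast
    have iL: "i < L" using 3(2) i(1) fr r by simp
    then obtain j' where j': "j = Suc j'" using i(3) by (cases j) auto
    \<comment> \<open>The bound after a draw with residue \<open>u\<close>. Its average over
      \<open>u < g\<close> is controlled by the first inequality of \<open>potential\<close>, where
      \<open>c\<close> counts the marked positions in the stride; once \<open>TH\<close> is
      exceeded, the bound is constant.\<close>
    define val where "val u = (if i + u \<in> hits x y L d \<and> m' 19 \<le> TH then H (m' 19 + g) (rem (i + g) + R)
      else H (m' 19) (rem (i + g) + R))" for u
    show ?case
    proof (rule V_Rnd_seq[where g = "\<lambda>v. val (v mod g)"])
      fix v :: nat assume "v < 2 ^ w"
      have regs': "phrase_regs x y L (m'(47 := v))"
        by (rule phrase_regs_frame[OF regs]) (use fr in auto)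
      show "V stride (\<lambda>b' m'. if Inv b' m' then J m' else 1) (b - 2 - 1) (m'(47 := v)) (val (v mod g))"
      proof (rule T_V[OF T_stride[OF regs' d ex(2), of i "v mod g" \<beta> "b1 + 40 * j' + 2"]], goal_cases)
        case 5
        show ?case using st by (auto simp: resolved_def)
      next
        case (8 b2 m2)
        then have fr2: "\<forall>r<64. r \<notin> sample_regs \<longrightarrow> m2 r = m r" and i2: "m2 46 = x + (i + g)"
          and b2: "\<beta> * (3 * k + 3 - m2 20) + b1 + 40 * j' + 2 \<le> b2"
          and st2: "m2 48 = 0 \<and> m2 20 = ex \<and> m2 19 \<le> TH \<or> resolved x y d ex m2"
          and a2: "m2 19 = (if i + v mod g \<in> hits x y L d \<and> m' 19 \<le> TH then m' 19 + g else m' 19) \<or>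
             k < ex + d \<and> m2 19 = TH + 1"
          using fr by auto
        have a3: "m2 19 \<le> 3 * B" using a2 acc' bounds B_pos by (auto split: if_splits)
        have "Inv b2 m2"
          unfolding Inv_def using fr2 a3 st2 i2 iL i(3) b2 j'
          by (auto intro!: exI[of _ "i + g"] exI[of _ j'])
        moreover have "J m2 \<le> val (v mod g)"
        proof (cases "k < ex + d \<and> m2 19 = TH + 1")
          case True
          then have "J m2 = lost" using pot by (simp add: J_def potential_def)
          also have "\<dots> \<le> val (v mod g)" using True lose by (simp add: val_def)
          finally show ?thesis .
        next
          case False
          then show ?thesis using a2 i2 by (auto simp: J_def val_def)
        qed
        ultimately show ?case by simp
      qed (use i iL acc' cost j' in auto)
    next
      have "(\<Sum>v<2 ^ w. val (v mod g)) / 2 ^ w = (\<Sum>u<g. val u) / g"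
        using sum_mod_average[OF g(2), of val] by simp
      also have "\<dots> \<le> J m'"
      proof (cases "m' 19 \<le> TH")
        case True
        have c: "card {u. u < g \<and> u \<in> {u. i + u \<in> hits x y L d}} \<le> g"
          using card_mono[of "{..<g}" "{u. u < g \<and> u \<in> {u. i + u \<in> hits x y L d}}"] by auto
        have "(\<Sum>u<g. val u) / g = (\<Sum>u<g. if u \<in> {u. i + u \<in> hits x y L d}
          then H (m' 19 + g) (rem (i + g) + R) else H (m' 19) (rem (i + g) + R)) / g"
          using True by (simp add: val_def)
        also have "\<dots> \<le> H (m' 19) (rem (i + g) + R + card {u. u < g \<and> u \<in> {u. i + u \<in> hits x y L d}})"
          unfolding average_hits[OF g(1)] using pot True c unfolding potential_def by blast
        also have "rem (i + g) + R + card {u. u < g \<and> u \<in> {u. i + u \<in> hits x y L d}} = rem i + R"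
          using rem_step[of i] by simp
        finally show ?thesis by (simp add: J_def i(1))
      next
        case False
        then show ?thesis using pot g(1) by (simp add: val_def J_def potential_def)
      qed
      finally show "(\<Sum>v<2 ^ w. val (v mod g)) / 2 ^ w \<le> J m'" .
    qed (use i j' in auto)
  next
    case (4 b m')
    then obtain i j where i: "m' 46 = x + i" "\<beta> * (3 * k + 3 - m' 20) + b1 + 40 * j + 2 \<le> b"
      and fr: "\<forall>r<64. r \<notin> sample_regs \<longrightarrow> m' r = m r" and acc': "m' 19 \<le> 3 * B"
      and st: "m' 48 = 0 \<and> m' 20 = ex \<and> m' 19 \<le> TH \<or> resolved x y d ex m'"
      unfolding Inv_def by blast
    have "L \<le> i" using 4(2) i(1) fr r by simp
    then have "J m' = H (m' 19) R" by (simp add: J_def i(1) remL)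
    moreover have "f (b - 2) m' \<le> H (m' 19) R"
      by (rule post) (use i fr acc' st ex in \<open>auto simp: phrase_post_def resolved_def\<close>)
    ultimately show ?case by simp
  qed
  moreover have "J (m(46 := x, 48 := 0)) = H (m 19) (d + R)"
    by (simp add: J_def rem0)
  ultimately have W: "V (WhileL 46 21 (Rnd 47 ;; stride)) f (a - 2) (m(46 := x, 48 := 0)) (H (m 19) (d + R))"
    by simp
  show ?thesis
    unfolding sample_phrase_def
  proof (rule V_seq_T[where Q = "\<lambda>b m'. b = a - 2 \<and> m' = m(46 := x, 48 := 0)"])
    show "T (Blk [Copy 46 16, Copy 48 13]) a m (\<lambda>b m'. b = a - 2 \<and> m' = m(46 := x, 48 := 0))"
      by (intro T_Blk) (use a r in auto)
  qed (use W in auto)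
qed

lemma V_IfEq:
  assumes "4 \<le> a" "m r = m s \<Longrightarrow> V c1 f (a - 4) m u" "m r \<noteq> m s \<Longrightarrow> V c2 f (a - 4) m u"
  shows "V (IfEq r s c1 c2) f a m u"
  unfolding IfEq_def using assms by (intro V_IfL) (auto intro: V_mono)

section \<open>Phrases of either kind\<close>

definition exact_phrase :: com where
  "exact_phrase = distance ;; Blk [Op Add 20 20 28] ;;
     IfL 2 20 (Blk [Copy 19 10]) (Blk [Op Add 19 19 28])"

definition phrase :: com where
  "phrase = Blk [Op Sub 25 21 16] ;;
     IfL 22 17 (Blk [Copy 19 10])
      (IfL 1 22 (Blk [Copy 19 10])
       (Blk [Op Sub 26 22 17] ;; IfEq 25 26 sample_phrase exact_phrase))"

text \<open>Here the sides have different lengths, so \<open>0 < d\<close> and the distance may be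
  computed without sampling. The credits may be short by \<sigma>, the price of a preceding window
  search; \<beta> contains \<sigma>, and the positive distance repays the debt.\<close>

lemma T_exact_phrase:
  assumes conf: "conf m" and regs: "m 16 + m 25 + m 17 + m 26 \<le> 10 * B" "L = m 25"
    and d: "d = pdist (m 16) (m 17) (m 25) (m 26)" "0 < d"
    and ex: "m 20 = ex" "ex \<le> k" and acc: "m 19 \<le> TH"
    and cost: "\<And>v. 1 \<le> v \<Longrightarrow> distance_cost L v + \<sigma> + 60 \<le> \<beta> * v"
    and a: "\<beta> * (3 * k + 3 - ex) + b1 + 10 \<le> a + \<sigma>"
  shows "T exact_phrase a m (\<lambda>b m'. (\<forall>r<64. r \<notin> sample_regs \<longrightarrow> m' r = m r) \<and>
     b1 \<le> b \<and> m' 19 \<le> 6 * B \<and>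
     (if ex + d \<le> k then m' 19 = m 19 + d \<and> m' 20 = ex + d \<and> \<beta> * (3 * k + 3 - m' 20) + b1 \<le> b
      else m' 19 = TH + 1))" (is "T _ _ _ ?Q")
  unfolding exact_phrase_def
proof -
  have r: "m 2 = k" "m 13 = 0" "m 14 = 1" "m 10 = TH + 1"
    using conf by (auto simp: conf_def)
  have w: "m 16 + m 25 + m 17 + m 26 + 20 * m 2 + 400 < 2 ^ w"
    using r regs bounds B_pos by (intro word_bound) auto
  have "\<beta> * (2 * k + 2) \<le> \<beta> * (3 * k + 3 - ex)" using ex by (intro mult_le_mono2) auto
  then have a1: "distance_cost (m 25) (2 * m 2 + 2) \<le> a"
    using cost[of "2 * k + 2"] a r regs by auto
  show "T (distance ;; Blk [Op Add 20 20 28] ;; IfL 2 20 (Blk [Copy 19 10]) (Blk [Op Add 19 19 28])) a m ?Q"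
  proof (intro T_seq T_mono[OF T_distance], goal_cases)
    case (5 b2 m2)
    define v where "v = m2 28"
    have v: "0 < v" "v \<le> d" "v \<le> 2 * k + 2" "v = d \<or> k < v" and b2: "a \<le> b2 + distance_cost L v"
      and f: "\<And>q. q < 64 \<Longrightarrow> q \<notin> {27,55} \<union> dp_regs \<Longrightarrow> m2 q = m q"
      using 5 r d regs by (auto simp: v_def)
    have c: "\<beta> * (3 * k + 3 - (ex + v)) + (distance_cost L v + \<sigma> + 60) \<le> \<beta> * (3 * k + 3 - ex)"
    proof -
      have "3 * k + 3 - ex = (3 * k + 3 - (ex + v)) + v" using v ex by simp
      then have "\<beta> * (3 * k + 3 - ex) = \<beta> * (3 * k + 3 - (ex + v)) + \<beta> * v"
        by (simp only: distrib_left)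
      then show ?thesis using cost[of v] v by simp
    qed
    have b3: "\<beta> * (3 * k + 3 - (ex + v)) + b1 + 60 \<le> b2"
      using b2 c a by simp
    have fr: "m2 2 = k" "m2 10 = TH + 1" "m2 20 = ex" "m2 19 = m 19"
      using f r ex by auto
    have w2: "ex + v < 2 ^ w" "m 19 + v < 2 ^ w" using ex v acc bounds B_pos by (auto intro!: word_bound)
    have TB: "TH + 1 \<le> 6 * B" "m 19 + k \<le> 6 * B" using acc bounds B_pos by auto
    have m3: "effs [Op Add 20 20 28] m2 = m2(20 := ex + v)" using fr w2 by (simp add: v_def[symmetric])
    show ?case
    proof (cases "ex + v \<le> k")
      case True
      then have "v = d" using v by auto
      then show ?thesis
        by (intro T_intros) (use True fr f b3 w2 TB in \<open>auto simp: v_def[symmetric]\<close>)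
    next
      case False
      then have "k < ex + d" using v by auto
      then show ?thesis
        by (intro T_intros) (use False fr f b3 w2 TB in \<open>auto simp: v_def[symmetric]\<close>)
    qed
  qed (use r w a1 in auto)
qed

definition phrase_frame :: "(nat \<Rightarrow> nat) \<Rightarrow> (nat \<Rightarrow> nat) \<Rightarrow> bool" where
  "phrase_frame m m' \<longleftrightarrow> (\<forall>r<64. r \<notin> {25,26} \<union> sample_regs \<longrightarrow> m' r = m r)"

text \<open>\<open>tx + y = x + ty\<close> says that the shift is unchanged, so that the sides have
  equal length; only otherwise may the debt \<sigma> be outstanding. \<open>lose\<close> lists the
  cases in which giving up must be compatible with the bound.\<close>

lemma V_phrase:
  assumes conf: "conf m" and regs: "m 16 = x" "m 17 = y" "m 21 = tx" "m 22 = ty"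
    and xy: "x \<le> tx" "tx \<le> n" "y \<le> 2 * B"
    and d: "d = pdist x y (tx - x) (ty - y)" and L: "tx - x \<le> L"
    and ex: "m 20 = ex" "ex \<le> k" and acc: "m 19 \<le> TH"
    and cost: "\<And>v. 1 \<le> v \<Longrightarrow> distance_cost L v + 12 * L + \<sigma> + 60 \<le> \<beta> * v"
    and pot: "potential H lost"
    and lose: "\<And>acc r. ty < y \<or> ny < ty \<or> k < ex + d \<Longrightarrow> lost \<le> H acc r"
    and a: "\<beta> * (3 * k + 3 - ex) + b1 + 40 * ((tx - x) div g + 1) + 30
       \<le> a + (if tx + y = x + ty then 0 else \<sigma>)"
    and post: "\<And>b m'. phrase_frame m m' \<Longrightarrow> b1 \<le> b \<Longrightarrow> m' 19 \<le> 6 * B \<Longrightarrow>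
       (m' 19 \<le> TH \<Longrightarrow> \<beta> * (3 * k + 3 - m' 20) + b1 \<le> b \<and> m' 20 \<le> k \<and>
          (m' 20 = ex \<or> m' 20 = ex + d) \<and> y \<le> ty \<and> ty \<le> ny) \<Longrightarrow> f b m' \<le> H (m' 19) R"
  shows "V phrase f a m (H (m 19) (d + R))"
proof -
  have r: "m 1 = ny" "m 10 = TH + 1" using conf by (auto simp: conf_def)
  have w: "tx < 2 ^ w" using bounds B_pos xy by (intro word_bound) auto
  define m1 where "m1 = m(25 := tx - x)"
  have m1: "effs [Op Sub 25 21 16] m = m1" using regs xy w by (simp add: m1_def)
  have dcm: "distance_cost (tx - x) v \<le> distance_cost L v" for v
    unfolding distance_cost_def using L by (intro add_mono mult_le_mono le_refl) auto
  have "\<sigma> + 60 \<le> \<beta>" using cost[of 1] by simp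
  moreover have "\<beta> * 1 \<le> \<beta> * (3 * k + 3 - ex)" using ex by (intro mult_le_mono2) auto
  ultimately have "\<sigma> + 60 \<le> \<beta> * (3 * k + 3 - ex)" by linarith
  then have ab: "b1 + 40 * ((tx - x) div g + 1) + 30 \<le> a" "b1 + 40 \<le> a" using a by (auto split: if_splits)
  have lostV: "V (Blk [Copy 19 10]) f b m1 (H (m 19) (d + R))" if "ty < y \<or> ny < ty" "b1 + 1 \<le> b" for b
  proof (rule V_Blk)
    let ?m = "effs [Copy 19 10] m1"
    have "f (b - length [Copy 19 10]) ?m \<le> H (?m 19) R"
      by (rule post) (use that r bounds B_pos in \<open>auto simp: m1_def phrase_frame_def\<close>)
    also have "?m 19 = TH + 1" using r by (simp add: m1_def)
    also have "H (TH + 1) R = lost" using pot by (simp add: potential_def)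
    also have "\<dots> \<le> H (m 19) (d + R)" using lose that by blast
    finally show "f (b - length [Copy 19 10]) ?m \<le> H (m 19) (d + R)" .
  qed (use that in auto)
  show ?thesis
    unfolding phrase_def
  proof (rule V_seq_T[where Q = "\<lambda>b m'. b = a - 1 \<and> m' = m1"])
    show "T (Blk [Op Sub 25 21 16]) a m (\<lambda>b m'. b = a - 1 \<and> m' = m1)"
      by (intro T_Blk) (use m1 ab in auto)
  next
    fix b m' assume "b = a - 1 \<and> m' = m1"
    then have b: "b = a - 1" "m' = m1" by auto
    show "V (IfL 22 17 (Blk [Copy 19 10])
      (IfL 1 22 (Blk [Copy 19 10])
       (Blk [Op Sub 26 22 17] ;; IfEq 25 26 sample_phrase exact_phrase))) f b m' (H (m 19) (d + R))"
      unfolding b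
    proof (intro V_IfL, goal_cases)
      case 2
      then show ?case using regs ab by (intro lostV) (auto simp: m1_def)
    next
      case 4
      then show ?case using regs ab r by (intro lostV) (auto simp: m1_def)
    next
      case 5
      then have y: "y \<le> ty" "ty \<le> ny" using regs r by (auto simp: m1_def)
      have w2: "ty < 2 ^ w" using y bounds B_pos by (intro word_bound) auto
      define m2 where "m2 = m1(26 := ty - y)"
      have m2: "effs [Op Sub 26 22 17] m1 = m2" using regs w2 y by (simp add: m1_def m2_def)
      have c2: "conf m2" using conf by (simp add: conf_def m1_def m2_def)
      have r2: "m2 16 = x" "m2 17 = y" "m2 21 = tx" "m2 25 = tx - x" "m2 26 = ty - y" "m2 20 = ex" "m2 19 = m 19"
        using regs ex by (auto simp: m1_def m2_def)
      show ?case
      proof (rule V_seq_T[where Q = "\<lambda>b m'. b = a - 6 \<and> m' = m2"])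
        show "T (Blk [Op Sub 26 22 17]) (a - 1 - 2 - 2) m1 (\<lambda>b m'. b = a - 6 \<and> m' = m2)"
          by (intro T_Blk) (use m2 ab in auto)
      next
        fix b m' assume "b = a - 6 \<and> m' = m2"
        then have b: "b = a - 6" "m' = m2" by auto
        show "V (IfEq 25 26 sample_phrase exact_phrase) f b m' (H (m 19) (d + R))"
          unfolding b
        proof (rule V_IfEq, goal_cases)
          case 2
          then have e: "tx - x = ty - y" using r2 by simp
          then have e': "tx + y = x + ty" using xy y by simp
          have "V sample_phrase f (a - 6 - 4) m2 (H (m2 19) (d + R))"
          proof (rule V_sample_phrase[where \<beta> = \<beta> and ?b1.0 = b1])
            show "phrase_regs x y (tx - x) m2"
              unfolding phrase_regs_def using c2 r2 e xy y bounds by auto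
            show "d = pdist x y (tx - x) (tx - x)" using d e by simp
            show "distance_cost (tx - x) v + 12 * (tx - x) + 60 \<le> \<beta> * v" if "1 \<le> v" for v
              using cost[OF that] dcm[of v] L by linarith
            show "f b m' \<le> H (m' 19) R" if "phrase_post \<beta> b1 d ex m2 b m'" for b m'
              using that y unfolding phrase_post_def
              by (intro post) (auto simp: phrase_frame_def m1_def m2_def)
          qed (use r2 ex acc pot lose a e' in auto)
          then show ?case using r2 by simp
        next
          case 3
          then have ne: "tx - x \<noteq> ty - y" using r2 by simp
          then have ne': "tx + y \<noteq> x + ty" using xy y by auto
          have d0: "0 < d" using ne lev_ge_diff[of "tx - x" "ty - y"] unfolding d pdist_def
            by (metis add.right_neutral gr0I le_antisym)
          have "T exact_phrase (a - 6 - 4) m2 (\<lambda>b m'. (\<forall>r<64. r \<notin> sample_regs \<longrightarrow> m' r = m2 r) \<and>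
             b1 \<le> b \<and> m' 19 \<le> 6 * B \<and>
             (if ex + d \<le> k then m' 19 = m2 19 + d \<and> m' 20 = ex + d \<and> \<beta> * (3 * k + 3 - m' 20) + b1 \<le> b
              else m' 19 = TH + 1))"
          proof (rule T_exact_phrase)
            show "distance_cost (tx - x) v + \<sigma> + 60 \<le> \<beta> * v" if "1 \<le> v" for v
              using cost[OF that] dcm[of v] by linarith
            have "\<beta> * (3 * k + 3 - ex) + b1 + 70 \<le> a + \<sigma>" "10 \<le> a"
              using a ab ne' by auto
            then show "\<beta> * (3 * k + 3 - ex) + b1 + 10 \<le> a - 6 - 4 + \<sigma>" by linarith
          qed (use c2 r2 d d0 ex acc a ab ne' xy y bounds in auto)
          then show ?case
          proof (rule T_V)
            fix b m'
            assume *: "(\<forall>r<64. r \<notin> sample_regs \<longrightarrow> m' r = m2 r) \<and>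
             b1 \<le> b \<and> m' 19 \<le> 6 * B \<and>
             (if ex + d \<le> k then m' 19 = m2 19 + d \<and> m' 20 = ex + d \<and> \<beta> * (3 * k + 3 - m' 20) + b1 \<le> b
              else m' 19 = TH + 1)"
            have "f b m' \<le> H (m' 19) R"
              using * y by (intro post) (auto simp: phrase_frame_def m1_def m2_def split: if_splits)
            also have "H (m' 19) R \<le> H (m 19) (d + R)"
            proof (cases "ex + d \<le> k")
              case True
              have "H (m 19 + d) R \<le> H (m 19) (R + d)" using pot acc unfolding potential_def by blast
              then show ?thesis using * r2 True by (simp add: add.commute)
            next
              case False
              then have "H (m' 19) R = lost" using * pot by (simp add: potential_def)
              then show ?thesis using lose False by simp
            qed
            finally show "f b m' \<le> H (m 19) (d + R)" .
          qed
        qed (use ab in auto)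
      qed
    qed (use ab in auto)
  qed
qed

section \<open>Locating the cuts in the second string\<close>

definition find_target :: com where
  "find_target = Blk [Op Add 45 18 4] ;;
     IfL 0 45 (Blk [Copy 21 0, Copy 22 1, Copy 24 14])
      (Blk [Copy 21 18, Op Sub 45 18 16, Op Add 22 45 17, Copy 24 13] ;; compare_windows ;;
       IfL 13 41 (Blk []) (search_window ;; IfL 13 41 (Blk []) (Blk [Copy 19 10])) ;;
       Blk [Op Add 18 18 6])"

definition search_cost :: nat where
  "search_cost = (2 * k + 1) * (12 * lp + 20) + 4"

text \<open>A window that no longer fits into \<open>X\<close> makes the phrase the last one,
  flagged in cell \<open>24\<close>, with the ends of both strings as target.
  \<open>m' 22 + m 16 = m 18 + m 17\<close> says that the previous shift was kept; then no search
  has to be paid for.\<close>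

definition target_post :: "(nat \<Rightarrow> nat) \<Rightarrow> nat \<Rightarrow> nat \<Rightarrow> (nat \<Rightarrow> nat) \<Rightarrow> bool" where
  "target_post m a b m' \<longleftrightarrow>
     (\<forall>r. r \<notin> {18,19,21,22,24} \<union> {40..45} \<longrightarrow> m' r = m r) \<and>
     (if n < m 18 + lp then m' 21 = n \<and> m' 22 = ny \<and> m' 24 = 1 \<and> m' 19 = m 19 \<and> a \<le> b + 12 * lp + 40
      else m' 21 = m 18 \<and> m' 18 = m 18 + Dl \<and> m' 24 = 0 \<and> a \<le> b + 12 * lp + 40 + search_cost \<and>
        (matches lp (m 18) (m' 22) \<and> m' 22 \<le> m 18 + k \<and> m 18 \<le> m' 22 + k \<and> m' 19 = m 19 \<and>
           (m' 22 + m 16 = m 18 + m 17 \<longrightarrow> a \<le> b + 12 * lp + 40) \<or>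
         m' 19 = TH + 1 \<and> (\<forall>s. matches lp (m 18) s \<longrightarrow> s \<le> m 18 + k \<longrightarrow> \<not> m 18 \<le> s + k)))"

lemma T_find_target:
  assumes conf: "conf m" and xy: "m 16 \<le> m 18" "m 17 \<le> m 16 + k" "m 16 \<le> m 17 + k" "m 18 \<le> n + Dl"
    and a: "12 * lp + 40 + search_cost \<le> a"
  shows "T find_target a m (target_post m a)"
proof -
  have r: "m 0 = n" "m 1 = ny" "m 2 = k" "m 4 = lp" "m 6 = Dl" "m 10 = TH + 1" "m 13 = 0" "m 14 = 1" "m 15 = 2 * k + 1"
    using conf by (auto simp: conf_def)
  have w: "m 18 + lp < 2 ^ w" "m 18 < 2 ^ w" "m 18 - m 16 + m 17 < 2 ^ w" "m 18 + Dl < 2 ^ w"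
    "m 18 + (2 * k + 1) + lp < 2 ^ w" "m 18 - m 16 + m 17 + lp < 2 ^ w"
    using bounds B_pos xy by (auto intro!: word_bound)
  show ?thesis
    unfolding find_target_def
  proof (rule T_seq, rule T_Blk)
    show "T (IfL 0 45 (Blk [Copy 21 0, Copy 22 1, Copy 24 14])
      (Blk [Copy 21 18, Op Sub 45 18 16, Op Add 22 45 17, Copy 24 13] ;; compare_windows ;;
       IfL 13 41 (Blk []) (search_window ;; IfL 13 41 (Blk []) (Blk [Copy 19 10])) ;;
       Blk [Op Add 18 18 6])) (a - length [Op Add 45 18 4]) (effs [Op Add 45 18 4] m) (target_post m a)"
    proof (rule T_IfL, goal_cases)
      case 2
      then show ?case by (intro T_Blk) (use a r w in \<open>auto simp: target_post_def\<close>)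
    next
      case 3
      define m1 where "m1 = m(21 := m 18, 45 := m 18 - m 16, 22 := m 18 - m 16 + m 17, 24 := 0)"
      have le: "m 18 + lp \<le> n" using 3 r w by simp
      have m1: "effs [Copy 21 18, Op Sub 45 18 16, Op Add 22 45 17, Copy 24 13] (effs [Op Add 45 18 4] m) = m1"
        using r w xy by (auto simp: m1_def fun_upd_twist)
      have r1: "m1 4 = lp" "m1 13 = 0" "m1 14 = 1" "m1 18 = m 18" "m1 22 = m 18 - m 16 + m 17" "m1 2 = k"
        "m1 15 = 2 * k + 1" "m1 10 = TH + 1" "m1 6 = Dl" "m1 21 = m 18" "m1 24 = 0" "m1 19 = m 19"
        using r by (auto simp: m1_def)
      have rng: "m 18 - m 16 + m 17 \<le> m 18 + k" "m 18 \<le> m 18 - m 16 + m 17 + k" using xy by auto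
      show ?case
      proof (rule T_seq, rule T_Blk, goal_cases)
        case 3
        show ?case unfolding m1
        proof (intro T_seq T_mono[OF T_compare_windows], goal_cases)
          case (5 b2 m2)
          then have f2: "\<And>r. r \<notin> {40..43} \<Longrightarrow> m2 r = m1 r" and
            e2: "m2 41 = of_bool (matches lp (m 18) (m 18 - m 16 + m 17))" and b2: "a \<le> b2 + 12 * lp + 15"
            using r1 by auto
          have s2: "m2 13 = 0" "m2 14 = 1" "m2 18 = m 18" "m2 15 = 2 * k + 1" "m2 4 = lp" "m2 2 = k"
            using f2 r1 by auto
          show ?case
          proof (rule T_IfL, goal_cases)
            case 2
            then have "matches lp (m 18) (m 18 - m 16 + m 17)" using e2 s2 by (auto split: if_splits)
            then show ?case
              by (intro T_Blk) (use b2 a f2 r1 le xy rng w in \<open>auto simp: target_post_def m1_def\<close>)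
          next
            case 3
            then have nm: "\<not> matches lp (m 18) (m 18 - m 16 + m 17)" using e2 s2 by auto
            show ?case
            proof (rule T_seq, rule T_mono[OF T_search_window], goal_cases)
              case (6 b3 m3)
              then have f3: "\<And>r. r \<notin> insert 22 {40..45} \<Longrightarrow> m3 r = m1 r" and
                e3: "if m3 41 = 0 then \<forall>u<2 * k + 1. k \<le> m 18 + u \<longrightarrow> \<not> matches lp (m 18) (m 18 + u - k)
                  else matches lp (m 18) (m3 22) \<and> m 18 \<le> m3 22 + k \<and> m3 22 + k < m 18 + (2 * k + 1)"
                and b3: "a \<le> b3 + 12 * lp + 17 + search_cost"
                using s2 f2 b2 by (auto simp: search_cost_def)
              have s3: "m3 13 = 0" "m3 10 = TH + 1" "m3 18 = m 18" "m3 6 = Dl" "m3 21 = m 18" "m3 24 = 0" "m3 19 = m 19"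
                using f3 r1 by auto
              show ?case
              proof (cases "m3 41 = 0")
                case True
                have "\<forall>s. matches lp (m 18) s \<longrightarrow> s \<le> m 18 + k \<longrightarrow> \<not> m 18 \<le> s + k"
                proof (intro allI impI notI)
                  fix s assume s: "matches lp (m 18) s" "s \<le> m 18 + k" "m 18 \<le> s + k"
                  have "s + k - m 18 < 2 * k + 1" "k \<le> m 18 + (s + k - m 18)" "m 18 + (s + k - m 18) - k = s"
                    using s by auto
                  then show False using e3 True s(1) by metis
                qed
                then show ?thesis
                  by (intro T_intros) (use True b3 a f3 s3 le w in \<open>auto simp: target_post_def m1_def\<close>)
              next
                case False
                \<comment> \<open>The search runs only after the previous shift has failed, so a
                  match that it finds has a different shift.\<close>
                have "m3 22 + m 16 \<noteq> m 18 + m 17"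
                proof
                  assume "m3 22 + m 16 = m 18 + m 17"
                  then have "m3 22 = m 18 - m 16 + m 17" using xy by simp
                  then show False using nm e3 False by simp
                qed
                then show ?thesis
                  by (intro T_intros) (use False e3 b3 a f3 s3 le w in \<open>auto simp: target_post_def m1_def\<close>)
              qed
            qed (use s2 w b2 a in \<open>auto simp: search_cost_def\<close>)
          qed (use b2 a in auto)
        qed (use r1 w a in auto)
      qed (use a in auto)
    qed (use a in auto)
  qed (use a in auto)
qed

section \<open>A run over all phrases\<close>

definition run_body :: com where
  "run_body = find_target ;;
     IfL 9 19 (Blk [Copy 23 14])
      (phrase ;; Blk [Copy 16 21, Copy 17 22] ;; IfL 9 19 (Blk [Copy 23 14]) (Blk [Copy 23 24]))"

text \<open>
  If \<open>safe\<close> holds, the run follows the optimal alignment \<open>p\<close>, whose columns are free inside all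
  windows at the cuts.
\<close>

definition remaining :: "bool \<Rightarrow> (nat \<Rightarrow> nat) \<Rightarrow> nat \<Rightarrow> nat \<Rightarrow> nat" where
  "remaining safe p x y = (if safe then \<Sum>c=x..<n. col_cost cX cY p c else pdist x y (n - x) (ny - y))"

text \<open>The two modes of the analysis. A safe run follows \<open>p\<close>, its cost is at most
  \<open>remaining\<close>, and \<open>H\<close> must not decrease in the cost. Otherwise the cuts
  are arbitrary, the cost is at least \<open>remaining\<close>, \<open>H\<close> must not increase,
  and giving up has to respect every bound. The second mode serves NO instances and, with constant
  \<open>H\<close>, unlucky offsets.\<close>

definition consistent :: "bool \<Rightarrow> (nat \<Rightarrow> nat) \<Rightarrow> (nat \<Rightarrow> bool) \<Rightarrow> (nat \<Rightarrow> nat \<Rightarrow> real) \<Rightarrow> real \<Rightarrow> bool" where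
  "consistent safe p Cut H lost \<longleftrightarrow> potential H lost \<and> (\<forall>c. Cut c \<longrightarrow> Cut (c + Dl)) \<and>
     (if safe then alignment p n ny \<and> (\<Sum>c<n. col_cost cX cY p c) \<le> k \<and>
        (\<forall>acc r r'. r \<le> r' \<longrightarrow> H acc r \<le> H acc r') \<and>
        (\<forall>c i. Cut c \<longrightarrow> c + lp \<le> n \<longrightarrow> c \<le> i \<longrightarrow> i < c + lp \<longrightarrow> col_cost cX cY p i = 0) \<and>
        (\<forall>c s t. c + lp \<le> n \<longrightarrow> matches lp c s \<longrightarrow> matches lp c t \<longrightarrow> s \<le> c + k \<longrightarrow> c \<le> s + k \<longrightarrow>
            t \<le> c + k \<longrightarrow> c \<le> t + k \<longrightarrow> s = t)
      else (\<forall>acc r r'. r \<le> r' \<longrightarrow> H acc r' \<le> H acc r) \<and> (\<forall>acc r. lost \<le> H acc r))"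

lemma div_add_le: "a div g + b div g \<le> (a + b) div (g :: nat)"
  using div_add1_eq[of a b g] by linarith

definition target :: "nat \<Rightarrow> nat \<Rightarrow> nat \<Rightarrow> bool" where
  "target cx tx ty \<longleftrightarrow> n < cx + lp \<and> tx = n \<and> ty = ny \<or>
     cx + lp \<le> n \<and> tx = cx \<and> matches lp cx ty \<and> ty \<le> cx + k \<and> cx \<le> ty + k"

lemma safe_cut:
  assumes "consistent True p Cut H lost" "Cut c" "c + lp \<le> n"
  shows "matches lp c (p c)" "p c \<le> c + k" "c \<le> p c + k"
proof -
  have al: "alignment p n ny" and sum: "(\<Sum>c<n. col_cost cX cY p c) \<le> k"
    and clean: "\<And>i. c \<le> i \<Longrightarrow> i < c + lp \<Longrightarrow> col_cost cX cY p i = 0"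
    using assms by (auto simp: consistent_def)
  show "matches lp c (p c)"
    unfolding matches_def using alignment_clean_window[OF al assms(3) clean] by blast
  have "(\<Sum>i<c. col_cost cX cY p i) \<le> (\<Sum>i<n. col_cost cX cY p i)"
    using assms(3) by (intro sum_mono2) auto
  then show "p c \<le> c + k" "c \<le> p c + k"
    using alignment_diagonal[OF al, of c cX cY] assms(3) sum by auto
qed

text \<open>In safe mode the window at a cut \<open>cx\<close> occurs in \<open>Y\<close> at
  \<open>p cx\<close>, and uniqueness identifies any match within the shifts with this one; so the
  phrase costs at most its columns and the budget \<open>k\<close> is respected. In the other mode
  the third claim is concatenation of alignments.\<close>

lemma target_step:
  assumes con: "consistent safe p Cut H lost" and t: "target cx tx ty" "Cut cx"
    and x: "x \<le> tx" "tx \<le> n" and d: "d = pdist x y (tx - x) (ty - y)"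
    and yp: "safe \<Longrightarrow> y = p x" and ex: "safe \<Longrightarrow> ex \<le> (\<Sum>c<x. col_cost cX cY p c)"
  shows "ty < y \<or> ny < ty \<or> k < ex + d \<Longrightarrow> lost \<le> H acc r"
    and "safe \<Longrightarrow> ty = p tx \<and> ex + d \<le> (\<Sum>c<tx. col_cost cX cY p c)"
    and "H acc (d + (if y \<le> ty \<and> ty \<le> ny then remaining safe p tx ty else remaining safe p x y))
       \<le> H acc (remaining safe p x y)"
proof -
  have S: "ty = p tx \<and> y \<le> ty \<and> ty \<le> ny \<and> d \<le> (\<Sum>c=x..<tx. col_cost cX cY p c)" if safe
  proof -
    have con': "consistent True p Cut H lost" using con that by simp
    then have al: "alignment p n ny" by (auto simp: consistent_def)
    have ty: "ty = p tx"
    proof (cases "n < cx + lp")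
      case True
      then show ?thesis using t(1) al by (auto simp: target_def alignment_def)
    next
      case False
      then have c: "cx + lp \<le> n" by simp
      show ?thesis
        using t(1) c safe_cut[OF con' t(2) c] con' unfolding target_def consistent_def
        by (metis (mono_tags) not_less)
    qed
    have "p x \<le> p tx" "p tx \<le> p n" using alignment_mono[OF al] x by auto
    moreover have "p n = ny" using al by (simp add: alignment_def)
    moreover have "d \<le> (\<Sum>c=x..<tx. col_cost cX cY p c)"
      using lev_le_col_costs[OF al x, of cX cY] d ty yp[OF that] by (simp add: pdist_def)
    ultimately show ?thesis using ty yp[OF that] by simp
  qed
  have split: "(\<Sum>c<tx. col_cost cX cY p c) = (\<Sum>c<x. col_cost cX cY p c) + (\<Sum>c=x..<tx. col_cost cX cY p c)"
    using x(1) by (simp add: lessThan_atLeast0 sum.atLeastLessThan_concat)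
  show 2: "ty = p tx \<and> ex + d \<le> (\<Sum>c<tx. col_cost cX cY p c)" if safe
    using S[OF that] ex[OF that] split by simp
  show "lost \<le> H acc r" if *: "ty < y \<or> ny < ty \<or> k < ex + d"
  proof (cases safe)
    case True
    have "(\<Sum>i<tx. col_cost cX cY p i) \<le> (\<Sum>i<n. col_cost cX cY p i)"
      using x by (intro sum_mono2) auto
    moreover have "(\<Sum>c<n. col_cost cX cY p c) \<le> k" using con True by (simp add: consistent_def)
    ultimately have False using S[OF True] 2[OF True] * by linarith
    then show ?thesis ..
  qed (use con in \<open>auto simp: consistent_def\<close>)
  show "H acc (d + (if y \<le> ty \<and> ty \<le> ny then remaining safe p tx ty else remaining safe p x y))
       \<le> H acc (remaining safe p x y)"
  proof (cases safe)
    case True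
    have "(\<Sum>c=x..<n. col_cost cX cY p c) = (\<Sum>c=x..<tx. col_cost cX cY p c) + (\<Sum>c=tx..<n. col_cost cX cY p c)"
      using x by (simp add: sum.atLeastLessThan_concat)
    then have "d + remaining safe p tx ty \<le> remaining safe p x y"
      using S[OF True] True by (simp add: remaining_def)
    then show ?thesis using S[OF True] con True by (simp add: consistent_def)
  next
    case False
    have "remaining safe p x y \<le> d + (if y \<le> ty \<and> ty \<le> ny then remaining safe p tx ty else remaining safe p x y)"
    proof (cases "y \<le> ty \<and> ty \<le> ny")
      case True
      have e: "n - x = (tx - x) + (n - tx)" "ny - y = (ty - y) + (ny - ty)" using x True by auto
      have e2: "x + (tx - x + a) = tx + a" "y + (ty - y + a) = ty + a" for a using x True by auto
      have "pdist x y (n - x) (ny - y) \<le> d + pdist tx ty (n - tx) (ny - ty)"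
        unfolding e d pdist_def using lev_append[of "\<lambda>a. cX (x + a)" "\<lambda>b. cY (y + b)" "tx - x" "n - tx" "ty - y" "ny - ty"]
        by (simp only: e2)
      then show ?thesis using True False by (simp add: remaining_def)
    qed auto
    then show ?thesis using con False by (simp add: consistent_def)
  qed
qed

lemma remaining_end: "remaining safe p n ny = 0"
  by (simp add: remaining_def pdist_def)

lemma credit_arith:
  fixes b b1 s A C D KQ K q' S e :: nat
  assumes "b - 2 \<le> b1 + 12 * lp + 40 + s" "A + D \<le> C" "q' + K \<le> KQ" "S + KQ + 40 * C + e + 2 \<le> b"
    "e + 200 \<le> b1" "K = 12 * lp + 200"
  shows "S + (q' + 40 * A + e + 20) + 40 * (D + 1) + 30 \<le> b1 - 2 + s"
proof -
  have "b \<le> b1 + 12 * lp + 42 + s" using assms(1) by linarith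
  then have "S + (q' + 40 * A + e + 20) + 40 * (D + 1) + 30 + 2 \<le> b1 + s"
    using assms(2-4,6) by (simp only: distrib_left)
  then show ?thesis using assms(5) by simp
qed

text \<open>Time has three sources: \<beta> per unit of computed distance,
  \<open>12 * lp + 200\<close> per cut, \<open>40\<close> per stride. The incomplete stride at the
  end of a phrase is charged to the cut.\<close>

lemma V_run_loop:
  assumes con: "consistent safe p Cut H lost"
    and cost: "\<And>v. 1 \<le> v \<Longrightarrow> distance_cost L v + 12 * L + search_cost + 60 \<le> \<beta> * v"
    and L: "L = min n (Dl + lp)"
    and conf: "conf m0" and init: "m0 16 = 0" "m0 17 = 0" "m0 18 < Dl" "m0 19 = 0" "m0 20 = 0" "m0 23 = 0"
    and cut: "Cut (m0 18)" and p0: "safe \<Longrightarrow> p 0 = 0"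
    and a: "\<beta> * (3 * k + 3) + (12 * lp + 200) * (n div Dl + 2) + 40 * (n div g) + bend + 10 \<le> a"
    and post: "\<And>b m. (\<And>r. r < 16 \<Longrightarrow> m r = m0 r) \<Longrightarrow> bend \<le> b \<Longrightarrow> m 19 \<le> 6 * B \<Longrightarrow> f b m \<le> H (m 19) 0"
  shows "V (WhileL 23 14 run_body) f a m0 (H 0 (remaining safe p 0 0))"
proof -
  define K where "K = 12 * lp + 200"
  \<comment> \<open>\<open>q\<close> bounds the number of windows that still fit; credits are
    reserved for one more phrase, the one that runs to the end of the strings.\<close>
  define live where "live b m \<longleftrightarrow> m 16 \<le> m 18 \<and> m 18 \<le> m 16 + Dl \<and> m 16 \<le> n \<and> m 17 \<le> ny \<and>
     m 17 \<le> m 16 + k \<and> m 16 \<le> m 17 + k \<and> m 18 \<le> n + Dl \<and> Cut (m 18) \<and> m 19 \<le> TH \<and> m 20 \<le> k \<and>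
     (safe \<longrightarrow> m 17 = p (m 16) \<and> m 20 \<le> (\<Sum>c<m 16. col_cost cX cY p c)) \<and>
     (\<exists>q. n < m 18 + lp + q * Dl \<and>
        \<beta> * (3 * k + 3 - m 20) + K * (q + 1) + 40 * ((n - m 16) div g) + bend + 2 \<le> b)" for b and m :: "nat \<Rightarrow> nat"
  define Inv where "Inv b m \<longleftrightarrow> (\<forall>r<16. m r = m0 r) \<and> m 19 \<le> 6 * B \<and>
     (m 23 = 0 \<and> live b m \<or> m 23 = 1 \<and> bend + 2 \<le> b)" for b and m :: "nat \<Rightarrow> nat"
  define J where "J m = H (m 19) (if m 23 = 0 then remaining safe p (m 16) (m 17) else 0)" for m :: "nat \<Rightarrow> nat"
  have pot: "potential H lost" using con by (simp add: consistent_def)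
  have lostH: "H acc r = lost" if "TH < acc" for acc r using pot that by (simp add: potential_def)
  have m0r: "m0 0 = n" "m0 1 = ny" "m0 2 = k" "m0 4 = lp" "m0 6 = Dl" "m0 8 = g" "m0 9 = TH" "m0 10 = TH + 1"
    "m0 13 = 0" "m0 14 = 1" "m0 15 = 2 * k + 1"
    using conf by (auto simp: conf_def)
  have \<beta>: "search_cost + 60 \<le> \<beta>" using cost[of 1] by simp
  have "V (WhileL 23 14 run_body) f a m0 (J m0)"
  proof (rule V_WhileL[where Inv = Inv], goal_cases)
    case 1
    have q: "n < m0 18 + lp + (n div Dl + 1) * Dl"
      using dividend_less_div_times[OF Dl(1), of n] by simp
    have c: "\<beta> * (3 * k + 3 - m0 20) + K * (n div Dl + 1 + 1) + 40 * ((n - m0 16) div g) + bend + 2 \<le> a"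
      using a init by (simp add: K_def)
    have "live a m0"
      unfolding live_def
      by (intro conjI exI[of _ "n div Dl + 1"] q c) (use init cut p0 in auto)
    then show ?case using init by (simp add: Inv_def)
  next
    case (2 b m)
    then show ?case by (auto simp: Inv_def live_def)
  next
    case (3 b m)
    then have fr: "\<And>r. r < 16 \<Longrightarrow> m r = m0 r" and d0: "m 23 = 0" and lv: "live b m"
      using m0r by (auto simp: Inv_def)
    obtain q where q: "n < m 18 + lp + q * Dl"
      "\<beta> * (3 * k + 3 - m 20) + K * (q + 1) + 40 * ((n - m 16) div g) + bend + 2 \<le> b"
      using lv by (auto simp: live_def)
    have s: "m 16 \<le> m 18" "m 18 \<le> m 16 + Dl" "m 16 \<le> n" "m 17 \<le> ny" "m 17 \<le> m 16 + k" "m 16 \<le> m 17 + k"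
      "m 18 \<le> n + Dl" "Cut (m 18)" "m 19 \<le> TH" "m 20 \<le> k"
      and sf: "safe \<Longrightarrow> m 17 = p (m 16)" "safe \<Longrightarrow> m 20 \<le> (\<Sum>c<m 16. col_cost cX cY p c)"
      using lv by (auto simp: live_def)
    have cm: "conf m" using conf by (simp add: conf_def fr)
    have "\<beta> * 1 \<le> \<beta> * (3 * k + 3 - m 20)" using s(10) by (intro mult_le_mono2) auto
    moreover have "K \<le> K * (q + 1)" by simp
    ultimately have b0: "12 * lp + 40 + search_cost \<le> b - 2" using q(2) \<beta> unfolding K_def by linarith
    show ?case
      unfolding run_body_def
    proof (rule V_seq_T[OF T_find_target[OF cm s(1,5,6,7) b0]])
      fix b1 m1
      assume tp: "target_post m (b - 2) b1 m1"
      have f1: "\<And>r. r \<notin> {18,19,21,22,24} \<union> {40..45} \<Longrightarrow> m1 r = m r" using tp by (simp add: target_post_def)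
      have c1: "conf m1" using cm by (simp add: conf_def f1)
      have r1: "m1 9 = TH" "m1 14 = 1" "m1 23 = 0" using c1 f1 d0 by (auto simp: conf_def)
      have b1: "bend + 200 \<le> b1"
      proof -
        have "b - 2 \<le> b1 + 12 * lp + 40 + search_cost"
          using tp by (auto simp: target_post_def split: if_splits)
        moreover have "\<beta> * 1 \<le> \<beta> * (3 * k + 3 - m 20)" using s(10) by (intro mult_le_mono2) auto
        moreover have "K \<le> K * (q + 1)" by simp
        ultimately show ?thesis using q(2) \<beta> unfolding K_def by linarith
      qed
      show "V (IfL 9 19 (Blk [Copy 23 14])
          (phrase ;; Blk [Copy 16 21, Copy 17 22] ;; IfL 9 19 (Blk [Copy 23 14]) (Blk [Copy 23 24])))
         (\<lambda>b' m'. if Inv b' m' then J m' else 1) b1 m1 (J m)"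
      proof (cases "m1 19 = TH + 1")
        case True
        \<comment> \<open>A failed search contradicts safety: the alignment copies the window to a
          position among those searched.\<close>
        have nos: "\<not> safe"
        proof
          assume safe
          then have c': "consistent True p Cut H lost" using con by simp
          have "\<not> n < m 18 + lp" using tp True s(9) by (auto simp: target_post_def)
          then have c: "m 18 + lp \<le> n" by simp
          show False
            using tp True c s(9) safe_cut[OF c' s(8) c] by (auto simp: target_post_def)
        qed
        define m2 where "m2 = m1(23 := 1)"
        have "Inv (b1 - 3) m2"
          unfolding Inv_def m2_def using f1 fr True bounds B_pos b1 by auto
        moreover have "J m2 \<le> J m"
          using True lostH[of "TH + 1"] d0 nos con by (simp add: J_def m2_def consistent_def)
        ultimately have "(if Inv (b1 - 3) m2 then J m2 else 1) \<le> J m" by simp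
        moreover have "effs [Copy 23 14] m1 = m2" using r1 by (simp add: m2_def)
        ultimately show ?thesis
          by (intro V_IfL V_Blk) (use True r1 b1 in \<open>auto simp: numeral_3_eq_3\<close>)
      next
        case False
        define x y tx ty ex where "x = m 16" and "y = m 17" and "tx = m1 21" and "ty = m1 22" and "ex = m 20"
        define d where "d = pdist x y (tx - x) (ty - y)"
        have acc1: "m1 19 = m 19" using tp False by (auto simp: target_post_def split: if_splits)
        have tg: "target (m 18) tx ty"
          using tp False by (auto simp: target_post_def target_def tx_def ty_def split: if_splits)
        have tx: "x \<le> tx" "tx \<le> n" "tx - x \<le> L"
          using tg s L by (auto simp: target_def x_def)
        note step = target_step[OF con tg s(8) tx(1,2) d_def, of ex, folded x_def y_def, OF sf[folded x_def y_def ex_def]]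
        define R where "R = (if y \<le> ty \<and> ty \<le> ny then remaining safe p tx ty else remaining safe p x y)"
        define q' where "q' = (if n < m 18 + lp then 0 else K * q)"
        define b2 where "b2 = q' + 40 * ((n - tx) div g) + bend + 20"
        have credit: "\<beta> * (3 * k + 3 - ex) + b2 + 40 * ((tx - x) div g + 1) + 30
           \<le> (b1 - 2) + (if tx + y = x + ty then 0 else search_cost)"
        proof -
          have "b - 2 \<le> b1 + 12 * lp + 40 + (if tx + y = x + ty then 0 else search_cost)"
            using tp False by (auto simp: target_post_def tx_def ty_def x_def y_def ac_simps split: if_splits)
          moreover have "(n - tx) div g + (tx - x) div g \<le> (n - x) div g"
            using div_add_le[of "n - tx" "tx - x"] tx by simp
          moreover have "q' + K \<le> K * (q + 1)" by (simp add: q'_def)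
          ultimately show ?thesis
            using q(2) b1 K_def unfolding b2_def ex_def x_def by (rule credit_arith)
        qed
        define g' where "g' b m' = (if phrase_frame m1 m' \<and> b2 \<le> b \<and> m' 19 \<le> 6 * B \<and>
           (m' 19 \<le> TH \<longrightarrow> \<beta> * (3 * k + 3 - m' 20) + b2 \<le> b \<and> m' 20 \<le> k \<and>
              (m' 20 = ex \<or> m' 20 = ex + d) \<and> y \<le> ty \<and> ty \<le> ny) then H (m' 19) R else 1)" for b m'
        have "V phrase g' (b1 - 2) m1 (H (m1 19) (d + R))"
        proof (rule V_phrase[OF c1 _ _ _ _ tx(1,2) _ d_def tx(3) _ _ _ cost pot step(1) credit])
          show "m1 16 = x" "m1 17 = y" "m1 20 = ex" using f1 by (simp_all add: x_def y_def ex_def)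
          show "m1 21 = tx" "m1 22 = ty" by (simp_all add: tx_def ty_def)
          show "y \<le> 2 * B" using s bounds by (simp add: y_def)
          show "ex \<le> k" "m1 19 \<le> TH" using s acc1 by (simp_all add: ex_def)
        qed (auto simp: g'_def)
        moreover have "H (m1 19) (d + R) \<le> J m"
          using step(3)[of "m 19"] d0 acc1 by (simp add: J_def R_def x_def y_def)
        ultimately have Vp: "V phrase g' (b1 - 2) m1 (J m)" by (rule V_mono[OF _ order_refl])
        have "V (phrase ;; Blk [Copy 16 21, Copy 17 22] ;; IfL 9 19 (Blk [Copy 23 14]) (Blk [Copy 23 24]))
          (\<lambda>b' m'. if Inv b' m' then J m' else 1) (b1 - 2) m1 (J m)"
        proof (rule V_seq[OF Vp])
          fix b3 m3 assume "g' b3 m3 < 1"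
          then have P: "phrase_frame m1 m3" "b2 \<le> b3" "m3 19 \<le> 6 * B"
            "m3 19 \<le> TH \<Longrightarrow> \<beta> * (3 * k + 3 - m3 20) + b2 \<le> b3 \<and> m3 20 \<le> k \<and>
              (m3 20 = ex \<or> m3 20 = ex + d) \<and> y \<le> ty \<and> ty \<le> ny"
            and g3: "g' b3 m3 = H (m3 19) R"
            unfolding g'_def by (auto split: if_splits)
          have f3: "\<And>r. r < 64 \<Longrightarrow> r \<notin> {25,26} \<union> sample_regs \<Longrightarrow> m3 r = m1 r"
            using P(1) by (auto simp: phrase_frame_def)
          have r3: "m3 9 = TH" "m3 14 = 1" "m3 21 = tx" "m3 22 = ty" "m3 24 = m1 24" "m3 18 = m1 18"
            using f3 r1 by (auto simp: tx_def ty_def)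
          have fr3: "\<And>r. r < 16 \<Longrightarrow> m3 r = m0 r" using f3 f1 fr by simp
          define m4 where "m4 = m3(16 := tx, 17 := ty)"
          have m4: "effs [Copy 16 21, Copy 17 22] m3 = m4" using r3 by (simp add: m4_def)
          have r4: "m4 9 = TH" "m4 14 = 1" "m4 24 = m1 24" "m4 19 = m3 19" using r3 by (simp_all add: m4_def)
          define v where "v = (if TH < m3 19 then 1 else m1 24)"
          have b3: "bend + 20 \<le> b3" using P(2) by (simp add: b2_def)
          have I: "Inv (b3 - 5) (m4(23 := v))"
          proof (cases "v = 0")
            case True
            then have th: "m3 19 \<le> TH" and m124: "m1 24 = 0" by (auto simp: v_def split: if_splits)
            then have cut: "m 18 + lp \<le> n" "tx = m 18" "m1 18 = m 18 + Dl"
              using tp by (auto simp: target_post_def tx_def split: if_splits)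
            have q0: "0 < q" using q(1) cut(1) by (cases q) auto
            then obtain q0 where q0: "q = Suc q0" by (cases q) auto
            have "live (b3 - 5) (m4(23 := v))"
              unfolding live_def
            proof (intro conjI exI[of _ q0])
              show "safe \<longrightarrow> (m4(23 := v)) 17 = p ((m4(23 := v)) 16) \<and>
                 (m4(23 := v)) 20 \<le> (\<Sum>c<(m4(23 := v)) 16. col_cost cX cY p c)"
                using step(2) P(4)[OF th] by (auto simp: m4_def)
              show "Cut ((m4(23 := v)) 18)" using cut(3) s(8) con r3 by (simp add: m4_def consistent_def)
              show "\<beta> * (3 * k + 3 - (m4(23 := v)) 20) + K * (q0 + 1) + 40 * ((n - (m4(23 := v)) 16) div g) + bend + 2 \<le> b3 - 5"
              proof -
                have "\<beta> * (3 * k + 3 - m3 20) + b2 \<le> b3" using P(4)[OF th] by blast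
                then show ?thesis using cut(1) q0 by (simp add: m4_def b2_def q'_def)
              qed
            qed (use P(4)[OF th] th tg cut q(1) q0 r3 tx in \<open>auto simp: m4_def target_def\<close>)
            then show ?thesis using fr3 P(3) True by (simp add: Inv_def m4_def)
          next
            case False
            moreover have "m1 24 \<in> {0, 1}" using tp by (auto simp: target_post_def split: if_splits)
            ultimately have "v = 1" by (auto simp: v_def split: if_splits)
            then show ?thesis using fr3 P(3) b3 by (simp add: Inv_def m4_def)
          qed
          have "J (m4(23 := v)) \<le> H (m3 19) R"
          proof (cases "m3 19 \<le> TH")
            case True
            then have R: "R = remaining safe p tx ty" using P(4) by (simp add: R_def)
            show ?thesis
            proof (cases "n < m 18 + lp")
              case True
              then have "R = 0" using tg R remaining_end by (auto simp: target_def)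
              moreover have "v = 1" using tp True by (simp add: v_def target_post_def)
              ultimately show ?thesis by (simp add: J_def m4_def)
            next
              case False
              then have "v = 0" using tp \<open>m3 19 \<le> TH\<close> by (simp add: v_def target_post_def)
              then show ?thesis using R by (simp add: J_def m4_def)
            qed
          next
            case False
            then show ?thesis using lostH by (simp add: J_def m4_def)
          qed
          then have fin: "(if Inv (b3 - 5) (m4(23 := v)) then J (m4(23 := v)) else 1) \<le> g' b3 m3"
            using I g3 by simp
          have e: "b3 - 2 - 2 - 1 = b3 - 5" "effs [Copy 23 14] m4 = m4(23 := 1)"
            "effs [Copy 23 24] m4 = m4(23 := m1 24)" using r4 by auto
          show "V (Blk [Copy 16 21, Copy 17 22] ;; IfL 9 19 (Blk [Copy 23 14]) (Blk [Copy 23 24]))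
            (\<lambda>b' m'. if Inv b' m' then J m' else 1) b3 m3 (g' b3 m3)"
          proof (rule V_seq_T[where Q = "\<lambda>b m. b = b3 - 2 \<and> m = m4"])
            show "T (Blk [Copy 16 21, Copy 17 22]) b3 m3 (\<lambda>b m. b = b3 - 2 \<and> m = m4)"
              by (intro T_Blk) (use m4 b3 in auto)
          next
            fix b m assume "b = b3 - 2 \<and> m = m4"
            then show "V (IfL 9 19 (Blk [Copy 23 14]) (Blk [Copy 23 24]))
              (\<lambda>b' m'. if Inv b' m' then J m' else 1) b m (g' b3 m3)"
              by (intro V_IfL V_Blk) (use fin e r4 b3 in \<open>auto simp: v_def\<close>)
          qed
        qed
        then show ?thesis
          by (intro V_IfL) (use r1 acc1 s(9) b1 in auto)
      qed
    qed
  next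
    case (4 b m)
    then have "m 23 = 1" "bend \<le> b - 2" "\<And>r. r < 16 \<Longrightarrow> m r = m0 r" "m 19 \<le> 6 * B"
      using m0r by (auto simp: Inv_def)
    then show ?case using post[of m "b - 2"] by (simp add: J_def)
  qed
  then show ?thesis using init by (simp add: J_def)
qed

section \<open>Potentials for the estimate\<close>

lemma potentialI:
  assumes "\<And>acc r c. acc \<le> TH \<Longrightarrow> c \<le> g \<Longrightarrow>
      real c / g * H (acc + g) r + (1 - real c / g) * H acc r \<le> H acc (r + c)"
    "\<And>acc r d. acc \<le> TH \<Longrightarrow> H (acc + d) r \<le> H acc (r + d)"
    "\<And>acc r. TH < acc \<Longrightarrow> H acc r = lost"
  shows "potential H lost"
  using assms by (simp add: potential_def)

lemma potentialD:
  assumes "potential H lost"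
  shows "acc \<le> TH \<Longrightarrow> c \<le> g \<Longrightarrow>
      real c / g * H (acc + g) r + (1 - real c / g) * H acc r \<le> H acc (r + c)"
    "acc \<le> TH \<Longrightarrow> H (acc + d) r \<le> H acc (r + d)"
    "TH < acc \<Longrightarrow> H acc r = lost"
  using assms unfolding potential_def by blast+

text \<open>Chains one run with the later ones, whose failure bound is \<open>v\<close>:
  \<open>v + G\<close> if an error in any run is fatal, \<open>v * G\<close> if all of them have to
  fail.\<close>

lemma potential_affine:
  assumes "potential G lost" "0 \<le> \<beta>"
  shows "potential (\<lambda>acc r. \<alpha> + \<beta> * G acc r) (\<alpha> + \<beta> * lost)"
proof -
  have 1: "real c / g * (\<alpha> + \<beta> * G (acc + g) r) + (1 - real c / g) * (\<alpha> + \<beta> * G acc r)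
      \<le> \<alpha> + \<beta> * G acc (r + c)" if "acc \<le> TH" "c \<le> g" for acc r c
  proof -
    have "real c / g * (\<alpha> + \<beta> * G (acc + g) r) + (1 - real c / g) * (\<alpha> + \<beta> * G acc r)
      = \<alpha> + \<beta> * (real c / g * G (acc + g) r + (1 - real c / g) * G acc r)"
      by (simp add: algebra_simps)
    also have "\<dots> \<le> \<alpha> + \<beta> * G acc (r + c)"
      using potentialD(1)[OF assms(1) that] assms(2) by (intro add_left_mono mult_left_mono)
    finally show ?thesis .
  qed
  have 2: "\<alpha> + \<beta> * G (acc + d) r \<le> \<alpha> + \<beta> * G acc (r + d)" if "acc \<le> TH" for acc r d
    using potentialD(2)[OF assms(1) that] assms(2) by (intro add_left_mono mult_left_mono)
  show ?thesis
    using potentialD(3)[OF assms(1)] by (intro potentialI 1 2) auto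
qed

lemma potential_const: "potential (\<lambda>acc r. \<alpha>) \<alpha>"
  by (simp add: potential_def algebra_simps)

text \<open>The estimate moves in units of \<open>g\<close>, hence the division. Positive
  \<open>lam\<close> with \<open>lost = 1\<close> bounds the probability that the estimate exceeds
  \<open>TH\<close>, negative \<open>lam\<close> with \<open>lost = 0\<close> the probability that
  it does not.\<close>

definition exp_potential :: "real \<Rightarrow> real \<Rightarrow> nat \<Rightarrow> nat \<Rightarrow> real" where
  "exp_potential lam lost acc r =
     (if TH < acc then lost else exp ((lam * (real acc - real TH) + (exp lam - 1) * real r) / g))"

text \<open>The exponential moment of a stride with \<open>c\<close> hits is bounded as in Chernoff's inequality.\<close>

lemma potential_exp:
  assumes "lost = 0 \<or> lost = 1 \<and> 0 \<le> lam"
  shows "potential (exp_potential lam lost) lost"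
proof -
  define h where "h acc r = exp ((lam * (real acc - real TH) + (exp lam - 1) * real r) / g)" for acc r :: nat
  have gp: "0 < real g" using g by simp
  have le: "exp_potential lam lost acc r \<le> h acc r" for acc r
  proof (cases "TH < acc")
    case True
    show ?thesis
    proof (cases "lost = 0")
      case False
      then have "0 \<le> lam" using assms by simp
      then have "0 \<le> (lam * (real acc - real TH) + (exp lam - 1) * real r) / g"
        using True gp by (intro divide_nonneg_pos add_nonneg_nonneg mult_nonneg_nonneg) auto
      then show ?thesis using assms False True by (simp add: exp_potential_def h_def)
    qed (use True in \<open>simp add: exp_potential_def h_def\<close>)
  qed (simp add: exp_potential_def h_def)
  have hg: "h (acc + g) r = h acc r * exp lam" for acc r
  proof -
    have "(lam * (real (acc + g) - real TH) + (exp lam - 1) * real r) / g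
      = (lam * (real acc - real TH) + (exp lam - 1) * real r) / g + lam"
      using gp by (simp add: field_simps)
    then show ?thesis by (simp add: h_def exp_add)
  qed
  have hc: "h acc (r + c) = h acc r * exp ((exp lam - 1) * (real c / g))" for acc r c
  proof -
    have "(lam * (real acc - real TH) + (exp lam - 1) * real (r + c)) / g
      = (lam * (real acc - real TH) + (exp lam - 1) * real r) / g + (exp lam - 1) * (real c / g)"
      using gp by (simp add: field_simps)
    then show ?thesis by (simp add: h_def exp_add)
  qed
  have 1: "real c / g * exp_potential lam lost (acc + g) r + (1 - real c / g) * exp_potential lam lost acc r
      \<le> exp_potential lam lost acc (r + c)" if "acc \<le> TH" "c \<le> g" for acc r c
  proof -
    have c: "0 \<le> real c / g" "real c / g \<le> 1" using that gp by auto
    have "real c / g * exp_potential lam lost (acc + g) r + (1 - real c / g) * exp_potential lam lost acc r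
      \<le> real c / g * (h acc r * exp lam) + (1 - real c / g) * h acc r"
      using c le[of "acc + g" r] le[of acc r] unfolding hg by (intro add_mono mult_left_mono) auto
    also have "\<dots> = h acc r * (1 + (exp lam - 1) * (real c / g))" by (simp add: algebra_simps diff_divide_distrib)
    also have "\<dots> \<le> h acc r * exp ((exp lam - 1) * (real c / g))"
      by (intro mult_left_mono exp_ge_add_one_self) (simp add: h_def)
    finally show ?thesis using that hc by (simp add: exp_potential_def h_def)
  qed
  have 2: "exp_potential lam lost (acc + d) r \<le> exp_potential lam lost acc (r + d)" if "acc \<le> TH" for acc r d
  proof -
    \<comment> \<open>An exactly computed cost changes the exponent by \<open>lam * d\<close> before
      division by \<open>g\<close>; \<open>1 + lam \<le> exp lam\<close> makes this no worse than
      the share set aside for a sampled cost.\<close>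
    have "lam * real d \<le> (exp lam - 1) * real d"
      using exp_ge_add_one_self[of lam] by (intro mult_right_mono) linarith+
    then have "h (acc + d) r \<le> h acc (r + d)"
      unfolding h_def using gp by (auto intro!: divide_right_mono simp: algebra_simps)
    moreover have "exp_potential lam lost acc (r + d) = h acc (r + d)"
      using that by (simp add: exp_potential_def h_def)
    ultimately show ?thesis using le[of "acc + d" r] by linarith
  qed
  show ?thesis
    by (intro potentialI 1 2) (auto simp: exp_potential_def)
qed

lemma exp_potential_mono:
  assumes "0 \<le> lam" "r \<le> r'" shows "exp_potential lam lost acc r \<le> exp_potential lam lost acc r'"
  using assms by (auto simp: exp_potential_def intro!: divide_right_mono mult_left_mono)

lemma exp_potential_antimono:
  assumes "lam \<le> 0" "r \<le> r'" shows "exp_potential lam lost acc r' \<le> exp_potential lam lost acc r"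
  using assms by (auto simp: exp_potential_def intro!: divide_right_mono mult_left_mono_neg)

text \<open>With stride \<open>1\<close> every position is tested and a stride has zero or one hit,
  so the final estimate is determined. The potentials are the indicators of its two
  outcomes.\<close>

lemma potential_exact:
  assumes "g = 1"
  shows "potential (\<lambda>acc r. of_bool (TH < acc + r)) 1"
    and "potential (\<lambda>acc r. of_bool (acc + r \<le> TH)) 0"
  by (intro potentialI; use assms in \<open>auto simp: le_Suc_eq\<close>)+

section \<open>A single run with a random offset\<close>

definition run_once :: com where
  "run_once = Rnd 18 ;;
     Blk [Op Mod 18 18 6, Copy 16 13, Copy 17 13, Copy 19 13, Copy 20 13, Copy 23 13] ;;
     WhileL 23 14 run_body"

definition run_cost :: "nat \<Rightarrow> nat" where
  "run_cost \<beta> = \<beta> * (3 * k + 3) + (12 * lp + 200) * (n div Dl + 2) + 40 * (n div g) + 20"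

lemma V_run_once:
  assumes con: "\<And>r. r < Dl \<Longrightarrow> consistent (safe r) p (\<lambda>c. c mod Dl = r) (H r) (lost r)"
    and p0: "p 0 = 0"
    and cost: "\<And>v. 1 \<le> v \<Longrightarrow> distance_cost L v + 12 * L + search_cost + 60 \<le> \<beta> * v"
    and L: "L = min n (Dl + lp)"
    and conf: "conf m0"
    and a: "run_cost \<beta> + bend \<le> a"
    and post: "\<And>r b m. r < Dl \<Longrightarrow> (\<And>r. r < 16 \<Longrightarrow> m r = m0 r) \<Longrightarrow> bend \<le> b \<Longrightarrow> m 19 \<le> 6 * B \<Longrightarrow>
       f b m \<le> H r (m 19) 0"
    and u: "(\<Sum>r<Dl. H r 0 (remaining (safe r) p 0 0)) / Dl \<le> u"
  shows "V run_once f a m0 u"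
  unfolding run_once_def
proof (rule V_Rnd_seq[where g = "\<lambda>v. H (v mod Dl) 0 (remaining (safe (v mod Dl)) p 0 0)"])
  show "1 \<le> a" using a by (simp add: run_cost_def)
next
  fix v :: nat assume v: "v < 2 ^ w"
  define r where "r = v mod Dl"
  have rD: "r < Dl" using Dl by (simp add: r_def)
  have m0r: "m0 6 = Dl" "m0 13 = 0" using conf by (auto simp: conf_def)
  define m1 where "m1 = m0(18 := r, 16 := 0, 17 := 0, 19 := 0, 20 := 0, 23 := 0)"
  have m1: "effs [Op Mod 18 18 6, Copy 16 13, Copy 17 13, Copy 19 13, Copy 20 13, Copy 23 13] (m0(18 := v)) = m1"
    using m0r by (simp add: m1_def r_def)
  have W: "V (WhileL 23 14 run_body) f (a - 7) m1 (H r 0 (remaining (safe r) p 0 0))"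
  proof (rule V_run_loop[OF con[OF rD] cost L])
    show "conf m1" using conf by (simp add: conf_def m1_def)
    show "m1 18 mod Dl = r" using rD by (simp add: m1_def)
    show "f b m \<le> H r (m 19) 0" if "\<And>r. r < 16 \<Longrightarrow> m r = m1 r" "bend \<le> b" "m 19 \<le> 6 * B" for b m
      by (rule post[OF rD]) (use that in \<open>auto simp: m1_def\<close>)
  qed (use rD p0 a in \<open>auto simp: m1_def run_cost_def\<close>)
  show "V (Blk [Op Mod 18 18 6, Copy 16 13, Copy 17 13, Copy 19 13, Copy 20 13, Copy 23 13] ;;
     WhileL 23 14 run_body) f (a - 1) (m0(18 := v)) (H (v mod Dl) 0 (remaining (safe (v mod Dl)) p 0 0))"
    unfolding r_def[symmetric]
  proof (rule V_seq_T[where Q = "\<lambda>b m. b = a - 7 \<and> m = m1"])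
    show "T (Blk [Op Mod 18 18 6, Copy 16 13, Copy 17 13, Copy 19 13, Copy 20 13, Copy 23 13]) (a - 1)
      (m0(18 := v)) (\<lambda>b m. b = a - 7 \<and> m = m1)"
      by (intro T_Blk) (use m1 a in \<open>auto simp: run_cost_def\<close>)
  qed (use W in auto)
next
  have "(\<Sum>v<2 ^ w. H (v mod Dl) 0 (remaining (safe (v mod Dl)) p 0 0)) / 2 ^ w
     = (\<Sum>r<Dl. H r 0 (remaining (safe r) p 0 0)) / Dl"
    using sum_mod_average[OF Dl(2), of "\<lambda>r. H r 0 (remaining (safe r) p 0 0)"] by simp
  then show "(\<Sum>v<2 ^ w. H (v mod Dl) 0 (remaining (safe (v mod Dl)) p 0 0)) / 2 ^ w \<le> u"
    using u by simp
qed

definition run_post :: "nat \<Rightarrow> (nat \<Rightarrow> nat) \<Rightarrow> nat \<Rightarrow> (nat \<Rightarrow> nat) \<Rightarrow> bool" where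
  "run_post bend m0 b m \<longleftrightarrow> (\<forall>r<16. m r = m0 r) \<and> bend \<le> b"

text \<open>\<open>G\<close> bounds the probability that the run accepts.\<close>

lemma V_run_once_NO:
  assumes G: "potential G 0" "\<And>acc r. 0 \<le> G acc r" "\<And>acc r r'. r \<le> r' \<Longrightarrow> G acc r' \<le> G acc r"
      "\<And>acc. acc \<le> TH \<Longrightarrow> 1 \<le> G acc 0"
    and cost: "\<And>v. 1 \<le> v \<Longrightarrow> distance_cost L v + 12 * L + search_cost + 60 \<le> \<beta> * v"
    and L: "L = min n (Dl + lp)"
    and conf: "conf m0"
    and a: "run_cost \<beta> + bend \<le> a"
    and post: "\<And>b m. run_post bend m0 b m \<Longrightarrow> f b m \<le> (if m 19 \<le> TH then 1 else v)"
    and v: "0 \<le> v"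
  shows "V run_once f a m0 (v + G 0 (pdist 0 0 n ny))"
proof (rule V_run_once[where safe = "\<lambda>_. False" and H = "\<lambda>_ acc r. v + 1 * G acc r" and lost = "\<lambda>_. v + 1 * 0"
      and p = "\<lambda>_. 0", OF _ _ cost L conf a])
  fix r assume "r < Dl"
  show "consistent False (\<lambda>_. 0) (\<lambda>c. c mod Dl = r) (\<lambda>acc r. v + 1 * G acc r) (v + 1 * 0)"
    using potential_affine[OF G(1), of 1 v] G(2,3) by (simp add: consistent_def)
next
  fix r b m assume "\<And>r. r < 16 \<Longrightarrow> m r = m0 r" "bend \<le> b"
  then have *: "f b m \<le> (if m 19 \<le> TH then 1 else v)" by (intro post) (auto simp: run_post_def)
  show "f b m \<le> v + 1 * G (m 19) 0"
  proof (cases "m 19 \<le> TH")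
    case True
    then show ?thesis using * G(4)[of "m 19"] v by simp
  next
    case False
    then show ?thesis using * G(2)[of "m 19" 0] by simp
  qed
next
  show "(\<Sum>r<Dl. v + 1 * G 0 (remaining False (\<lambda>_. 0) 0 0)) / Dl \<le> v + G 0 (pdist 0 0 n ny)"
    using Dl by (simp add: remaining_def)
qed auto

text \<open>At most a quarter of the offsets place an edit of the optimal alignment \<open>p\<close> into some window.\<close>

lemma V_run_once_YES:
  assumes G: "potential G 1" "\<And>acc r. 0 \<le> G acc r" "\<And>acc r r'. r \<le> r' \<Longrightarrow> G acc r \<le> G acc r'"
      "G 0 k \<le> 1 / 4"
    and al: "alignment p n ny" "(\<Sum>c<n. col_cost cX cY p c) \<le> k"
    and uniq: "\<And>c s t. c + lp \<le> n \<Longrightarrow> matches lp c s \<Longrightarrow> matches lp c t \<Longrightarrow> s \<le> c + k \<Longrightarrow> c \<le> s + k \<Longrightarrow>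
         t \<le> c + k \<Longrightarrow> c \<le> t + k \<Longrightarrow> s = t"
    and Dlk: "4 * k * lp \<le> Dl"
    and cost: "\<And>v. 1 \<le> v \<Longrightarrow> distance_cost L v + 12 * L + search_cost + 60 \<le> \<beta> * v"
    and L: "L = min n (Dl + lp)"
    and conf: "conf m0"
    and a: "run_cost \<beta> + bend \<le> a"
    and post: "\<And>b m. run_post bend m0 b m \<Longrightarrow> f b m \<le> (if m 19 \<le> TH then 0 else v)"
    and v: "0 \<le> v"
  shows "V run_once f a m0 (v / 2)"
proof -
  define good_offset where "good_offset r \<longleftrightarrow>
     (\<forall>c i. c mod Dl = r \<longrightarrow> c + lp \<le> n \<longrightarrow> c \<le> i \<longrightarrow> i < c + lp \<longrightarrow> col_cost cX cY p i = 0)" for r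
  define E where "E = {i. i < n \<and> col_cost cX cY p i \<noteq> 0}"
  have finE: "finite E" by (simp add: E_def)
  have "card E \<le> (\<Sum>i\<in>E. col_cost cX cY p i)"
    using sum_mono[of E "\<lambda>_. 1" "col_cost cX cY p"] by (auto simp: E_def)
  also have "\<dots> \<le> (\<Sum>c<n. col_cost cX cY p c)"
    by (intro sum_mono2) (auto simp: E_def)
  finally have cardE: "card E \<le> k" using al by simp
  \<comment> \<open>A column \<open>i\<close> with an edit spoils only the offsets
    \<open>(i - u) mod Dl\<close> with \<open>u < lp\<close>, where \<open>u\<close> is its place in
    the window. At most \<open>k\<close> such columns spoil at most \<open>k * lp\<close>
    offsets.\<close>
  have "{r. r < Dl \<and> \<not> good_offset r} \<subseteq> (\<lambda>(i, u). (i - u) mod Dl) ` (E \<times> {..<lp})"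
  proof
    fix r assume "r \<in> {r. r < Dl \<and> \<not> good_offset r}"
    then obtain c i where c: "c mod Dl = r" "c + lp \<le> n" "c \<le> i" "i < c + lp" "col_cost cX cY p i \<noteq> 0"
      by (auto simp: good_offset_def)
    then have "(i, i - c) \<in> E \<times> {..<lp}" "r = (i - (i - c)) mod Dl" by (auto simp: E_def)
    then show "r \<in> (\<lambda>(i, u). (i - u) mod Dl) ` (E \<times> {..<lp})" by (metis (mono_tags, lifting) case_prod_conv image_eqI)
  qed
  then have "card {r. r < Dl \<and> \<not> good_offset r} \<le> card (E \<times> {..<lp})"
    using finE by (meson card_image_le card_mono finite_SigmaI finite_imageI finite_lessThan order_trans)
  also have "\<dots> \<le> k * lp" using cardE by (simp add: card_cartesian_product)
  finally have cardbad: "4 * card {r. r < Dl \<and> \<not> good_offset r} \<le> Dl" using Dlk by simp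
  \<comment> \<open>An unlucky offset wastes the run and leaves the bound \<open>v\<close> of the
    later runs; a lucky one multiplies \<open>v\<close> by the bound \<open>G\<close> on a wrong
    rejection.\<close>
  define H where "H r = (if good_offset r then (\<lambda>acc rm. 0 + v * G acc rm) else (\<lambda>acc rm. v))" for r
  have G1: "G acc r = 1" if "TH < acc" for acc r using G(1) that by (simp add: potential_def)
  show ?thesis
  proof (rule V_run_once[where safe = good_offset and H = H and lost = "\<lambda>r. v" and p = p, OF _ _ cost L conf a])
    fix r assume "r < Dl"
    show "consistent (good_offset r) p (\<lambda>c. c mod Dl = r) (H r) v"
    proof (cases "good_offset r")
      case True
      have "\<forall>acc r r'. r \<le> r' \<longrightarrow> v * G acc r \<le> v * G acc r'"
        using G(3) v by (intro allI impI mult_left_mono) auto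
      moreover have "potential (\<lambda>acc r. v * G acc r) v"
        using potential_affine[OF G(1) v, of 0] by simp
      moreover have "\<forall>c i. c mod Dl = r \<longrightarrow> c + lp \<le> n \<longrightarrow> c \<le> i \<longrightarrow> i < c + lp \<longrightarrow> col_cost cX cY p i = 0"
        using True by (simp only: good_offset_def)
      moreover have "\<forall>c s t. c + lp \<le> n \<longrightarrow> matches lp c s \<longrightarrow> matches lp c t \<longrightarrow> s \<le> c + k \<longrightarrow>
          c \<le> s + k \<longrightarrow> t \<le> c + k \<longrightarrow> c \<le> t + k \<longrightarrow> s = t"
        using uniq by blast
      moreover have "H r = (\<lambda>acc rm. v * G acc rm)" using True by (simp add: H_def)
      moreover have "\<forall>c. c mod Dl = r \<longrightarrow> (c + Dl) mod Dl = r" by simp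
      ultimately show ?thesis
        using True al by (simp only: consistent_def if_True simp_thms)
    next
      case False
      then show ?thesis using potential_const by (simp add: consistent_def H_def)
    qed
  next
    show "p 0 = 0" using al by (simp add: alignment_def)
  next
    fix r b m assume "\<And>r. r < 16 \<Longrightarrow> m r = m0 r" "bend \<le> b"
    then have *: "f b m \<le> (if m 19 \<le> TH then 0 else v)" by (intro post) (auto simp: run_post_def)
    show "f b m \<le> H r (m 19) 0"
    proof (cases "m 19 \<le> TH")
      case True
      have "0 \<le> v * G (m 19) 0" using v G(2) by simp
      then show ?thesis using * True v by (auto simp: H_def)
    next
      case False
      then show ?thesis using * G1 by (simp add: H_def)
    qed
  next
    let ?bad = "{r. r < Dl \<and> r \<in> {r. \<not> good_offset r}}"
    have "H r 0 (remaining (good_offset r) p 0 0) \<le> (if r \<in> {r. \<not> good_offset r} then v else v / 4)" for r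
    proof (cases "good_offset r")
      case True
      have "G 0 (remaining True p 0 0) \<le> G 0 k"
        using al(2) by (intro G(3)) (simp add: remaining_def lessThan_atLeast0)
      then have "v * G 0 (remaining True p 0 0) \<le> v * (1 / 4)" using G(4) v by (intro mult_left_mono) auto
      then show ?thesis using True by (simp add: H_def)
    qed (simp add: H_def)
    then have "(\<Sum>r<Dl. H r 0 (remaining (good_offset r) p 0 0)) / Dl
      \<le> (\<Sum>r<Dl. if r \<in> {r. \<not> good_offset r} then v else v / 4) / Dl"
      by (intro divide_right_mono sum_mono) auto
    also have "\<dots> = real (card ?bad) / Dl * v + (1 - real (card ?bad) / Dl) * (v / 4)"
      by (rule average_hits[OF Dl(1)])
    \<comment> \<open>The total is at most \<open>1/4 + 1/4 * 3/4 = 7/16\<close> of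
      \<open>v\<close>.\<close>
    also have "\<dots> = v / 4 + (real (card ?bad) / Dl) * (3 / 4 * v)" by (simp add: algebra_simps)
    also have "\<dots> \<le> v / 4 + (1 / 4) * (3 / 4 * v)"
    proof -
      have "4 * real (card ?bad) \<le> real Dl" using cardbad by simp
      then have "real (card ?bad) / Dl \<le> 1 / 4" using Dl(1) by (simp add: field_simps)
      then show ?thesis using v by (intro add_left_mono mult_right_mono) auto
    qed
    also have "\<dots> \<le> v / 2" using v by simp
    finally show "(\<Sum>r<Dl. H r 0 (remaining (good_offset r) p 0 0)) / Dl \<le> v / 2" .
  qed
qed

end

section \<open>Repeated runs\<close>

definition main_loop :: com where
  "main_loop = WhileL 12 11
     (sampler.run_once ;; IfL 9 19 (Blk []) (Stp True) ;; Blk [Op Add 12 12 14]) ;; Stp False"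

context sampler
begin

text \<open>\<open>J j\<close> bounds the failure probability with \<open>j\<close> runs left,
  \<open>next_v\<close> describes the effect of one more run, and \<open>yes\<close> is the failure
  charged for accepting. YES instances halve the bound in each run, NO instances add the error of
  one run.\<close>

lemma V_main_loop:
  assumes conf: "conf m0" and R: "m0 11 = R" "m0 12 = 0" "R < 2 ^ w"
    and run: "\<And>f a m v bend. conf m \<Longrightarrow> run_cost \<beta> + bend \<le> a \<Longrightarrow> 0 \<le> v \<Longrightarrow>
       (\<And>b m'. run_post bend m b m' \<Longrightarrow> f b m' \<le> (if m' 19 \<le> TH then yes else v)) \<Longrightarrow>
       V run_once f a m (next_v v)"
    and yes: "(if correct_answer I True then 0 else 1) \<le> yes"
    and J: "\<And>j. 0 \<le> J j" "\<And>j. next_v (J j) \<le> J (Suc j)" "(if correct_answer I False then 0 else 1) \<le> J 0"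
    and a: "R * (run_cost \<beta> + 20) + 10 \<le> a"
  shows "V main_loop f a m0 (J R)"
proof -
  define Inv where "Inv b m \<longleftrightarrow> (\<forall>r<16. r \<noteq> 12 \<longrightarrow> m r = m0 r) \<and> m 12 \<le> R \<and>
     (R - m 12) * (run_cost \<beta> + 20) + 3 \<le> b" for b m
  define F where "F b m = (if b = 0 then 1 else if correct_answer I False then 0 else (1::real))" for b :: nat and m :: "nat \<Rightarrow> nat"
  have m0r: "m0 9 = TH" "m0 14 = 1" using conf by (auto simp: conf_def)
  have "V (WhileL 12 11 (run_once ;; IfL 9 19 (Blk []) (Stp True) ;; Blk [Op Add 12 12 14]))
     F a m0 (J (R - m0 12))"
  proof (rule V_WhileL[where Inv = Inv and J = "\<lambda>m. J (R - m 12)"], goal_cases)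
    case 1
    then show ?case using R a by (simp add: Inv_def)
  next
    case (2 b m)
    then show ?case by (simp add: Inv_def)
  next
    case (3 b m)
    then have fr: "\<And>r. r < 16 \<Longrightarrow> r \<noteq> 12 \<Longrightarrow> m r = m0 r" and lt: "m 12 < R"
      and b: "(R - m 12) * (run_cost \<beta> + 20) + 3 \<le> b" using R by (auto simp: Inv_def)
    define j where "j = R - m 12 - 1"
    have j: "R - m 12 = Suc j" using lt by (simp add: j_def)
    have b': "run_cost \<beta> + (j * (run_cost \<beta> + 20) + 20) \<le> b - 2" using b unfolding j by simp
    have cm: "conf m" using conf by (simp add: conf_def fr)
    define bend where "bend = j * (run_cost \<beta> + 20) + 20"
    define G where "G b' m' = (if run_post bend m b' m' then (if m' 19 \<le> TH then yes else J j) else 1)" for b' m'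
    have "V run_once G (b - 2) m (next_v (J j))"
      by (rule run[OF cm _ J(1), of bend]) (use b' in \<open>auto simp: G_def bend_def\<close>)
    then have "V run_once G (b - 2) m (J (Suc j))"
      by (rule V_mono[OF _ order_refl]) (rule J)
    then show ?case unfolding j
    proof (rule V_seq)
      fix b1 m1 assume "G b1 m1 < 1"
      then have P: "run_post bend m b1 m1" and Ge: "G b1 m1 = (if m1 19 \<le> TH then yes else J j)"
        by (auto simp: G_def split: if_splits)
      have f1: "\<And>r. r < 16 \<Longrightarrow> m1 r = m r" "bend \<le> b1" using P by (auto simp: run_post_def)
      have r1: "m1 9 = TH" "m1 14 = 1" "m1 12 = m 12" using f1(1) fr m0r by simp_all
      define m2 where "m2 = m1(12 := Suc (m 12))"
      have w1: "Suc (m 12) < 2 ^ w" using lt R(3) by simp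
      have m2: "effs [Op Add 12 12 14] m1 = m2" using r1 w1 by (simp add: m2_def)
      have I2: "Inv (b1 - 4) m2"
        unfolding Inv_def using f1 fr lt by (auto simp: m2_def j_def bend_def)
      have R2: "R - m2 12 = j" by (simp add: m2_def j_def)
      show "V (IfL 9 19 (Blk []) (Stp True) ;; Blk [Op Add 12 12 14])
         (\<lambda>b' m'. if Inv b' m' then J (R - m' 12) else 1) b1 m1 (G b1 m1)"
      proof (cases "m1 19 \<le> TH")
        case True
        have "V (IfL 9 19 (Blk []) (Stp True)) (\<lambda>_ _. 1) b1 m1 (G b1 m1)"
          by (intro V_IfL V_Stp) (use True r1 f1 yes Ge in \<open>auto simp: bend_def\<close>)
        then show ?thesis by (rule V_seq) auto
      next
        case False
        show ?thesis
        proof (rule V_seq_T[where Q = "\<lambda>b m. b = b1 - 2 \<and> m = m1"])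
          show "T (IfL 9 19 (Blk []) (Stp True)) b1 m1 (\<lambda>b m. b = b1 - 2 \<and> m = m1)"
            by (intro T_IfL T_Blk) (use False r1 f1 in \<open>auto simp: bend_def\<close>)
        next
          fix b m' assume "b = b1 - 2 \<and> m' = m1"
          moreover have "Inv (b1 - 2 - 1) m2"
            using I2 unfolding Inv_def by auto
          ultimately show "V (Blk [Op Add 12 12 14]) (\<lambda>b' m'. if Inv b' m' then J (R - m' 12) else 1) b m' (G b1 m1)"
            by (intro V_Blk) (use m2 R2 Ge False f1 in \<open>auto simp: bend_def\<close>)
        qed
      qed
    qed
  next
    case (4 b m)
    then have "m 12 = R" "3 \<le> b" using R by (auto simp: Inv_def)
    then show ?case using J(3) by (simp add: F_def)
  qed
  then have "V (WhileL 12 11 (run_once ;; IfL 9 19 (Blk []) (Stp True) ;; Blk [Op Add 12 12 14])) F a m0 (J R)"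
    using R by simp
  then show ?thesis
    unfolding main_loop_def
  proof (rule V_seq)
    fix b m assume "F b m < 1"
    then show "V (Stp False) f b m (F b m)"
      by (intro V_Stp) (auto simp: F_def split: if_splits)
  qed
qed

end

section \<open>Computing the parameters\<close>

definition init_window :: com where
  "init_window = Blk [Op Add 4 0 14] ;; MinL 4 3 ;; IfL 13 4 (Blk []) (Blk [Const 4 1])"

definition init_bits :: com where
  "init_bits = Blk [Op Add 45 0 1, Const 46 4, Op Add 45 45 46, Const 5 0, Const 46 1] ;;
     WhileL 46 45 (Blk [Op Add 46 46 46, Op Add 5 5 14])"

definition init_spacing :: com where
  "init_spacing = Blk [Op Add 45 2 14, Op Mul 45 45 4, Op Add 45 45 45, Op Add 45 45 45, Const 6 1] ;;
     WhileL 6 45 (Blk [Op Add 6 6 6])"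

definition init_stride :: "nat \<Rightarrow> com" where
  "init_stride \<kappa> = Blk [Mul_Eps 7 2, Mul_Eps 45 7, Const 46 \<kappa>, Op Mul 46 46 5, Op Div 45 45 46,
       Op Add 45 45 14, Const 8 1, Const 47 2] ;;
     WhileL 47 45 (Blk [Copy 8 47, Op Add 47 47 47])"

definition init_constants :: "nat \<Rightarrow> com" where
  "init_constants c = Blk [Const 46 2, Op Div 46 7 46, Op Add 9 2 46, Op Add 10 9 14, Op Add 15 2 2,
     Op Add 15 15 14, Const 46 c, Op Mul 11 46 5, Const 12 0]"

definition initialise :: "nat \<Rightarrow> nat \<Rightarrow> com" where
  "initialise \<kappa> c = init_window ;; init_bits ;; init_spacing ;; init_stride \<kappa> ;; init_constants c"

text \<open>The early answers settle \<open>k \<ge> |X| + |Y|\<close>, where the distance cannot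
  exceed \<open>k\<close>, and length differences above \<open>k\<close>. They also bound
  \<open>k\<close> by the input size, without which products such as \<open>4 * (k + 1) * lp\<close>
  might overflow a word.\<close>

definition gap_algorithm :: "nat \<Rightarrow> nat \<Rightarrow> com" where
  "gap_algorithm \<kappa> c =
     Blk [Const 14 1, Op Add 45 0 1] ;; IfL 2 45 (Blk []) (Stp True) ;;
     Blk [Op Add 45 0 2] ;; IfL 45 1 (Stp False) (Blk []) ;;
     Blk [Op Add 45 1 2] ;; IfL 45 0 (Stp False) (Blk []) ;;
     initialise \<kappa> c ;; main_loop"

context bounded_ram
begin

text \<open>Window lengths above \<open>|X| + 1\<close> are clipped, as no such window fits anyway;
  this bounds the cell by the input size. Length \<open>0\<close> is raised to \<open>1\<close> so
  that the estimates may assume a positive length.\<close>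

lemma T_init_window:
  assumes "m 13 = 0" "m 14 = 1" "m 0 + 1 < 2 ^ w" "10 \<le> a"
  shows "T init_window a m (\<lambda>b m'. a \<le> b + 10 \<and> m' = m(4 := max 1 (min (m 3) (m 0 + 1))))"
  unfolding init_window_def
  by (intro T_seq T_Blk T_MinL T_IfL) (use assms in \<open>auto simp: minimum_def max_def min_def\<close>)

text \<open>Cell \<open>5\<close> receives the bit length of \<open>N\<close>, which stands in for
  the logarithm in the stride and in the number of runs. The strict test compares with
  \<open>N + 1\<close>, hence the constant \<open>4\<close> added to
  \<open>|X| + |Y|\<close>.\<close>

lemma T_init_bits:
  assumes "m 14 = 1" "m 0 + m 1 + 3 = N" "2 * N < 2 ^ w" "N < 2 ^ bt" "2 ^ bt \<le> 2 * N" "4 * bt + 10 \<le> a"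
  shows "T init_bits a m (\<lambda>b m'. a \<le> b + 4 * bt + 10 \<and> m' 5 = bt \<and> (\<forall>r. r \<notin> {5,45,46} \<longrightarrow> m' r = m r))" (is "T _ _ _ ?Q")
  unfolding init_bits_def
proof (intro T_seq T_Blk)
  define Inv where "Inv b m' \<longleftrightarrow> (\<forall>r. r \<notin> {5,45,46} \<longrightarrow> m' r = m r) \<and> m' 45 = N + 1 \<and>
     m' 46 = 2 ^ (m' 5) \<and> m' 5 \<le> bt \<and> a \<le> b + 4 * m' 5 + 5" for b m'
  have w: "N + 1 < 2 ^ w" using assms(2,3) by simp
  show "T (WhileL 46 45 (Blk [Op Add 46 46 46, Op Add 5 5 14]))
     (a - length [Op Add 45 0 1, Const 46 4, Op Add 45 45 46, Const 5 0, Const 46 1])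
     (effs [Op Add 45 0 1, Const 46 4, Op Add 45 45 46, Const 5 0, Const 46 1] m)
     ?Q"
  proof (rule T_WhileL[where Inv = Inv], goal_cases)
    case 1
    show ?case using assms w by (auto simp: Inv_def)
  next
    case (2 b m')
    then show ?case using assms(6) by (auto simp: Inv_def)
  next
    case (3 b m')
    then have lt: "(2::nat) ^ m' 5 \<le> N" by (auto simp: Inv_def)
    then have "(2::nat) ^ m' 5 < 2 ^ bt" using assms(4) by linarith
    then have i: "m' 5 < bt" by simp
    have "m' 5 < 2 ^ m' 5" by simp
    then have "m' 5 < N" using lt by linarith
    then have w2: "2 ^ m' 5 + 2 ^ m' 5 < (2::nat) ^ w" "Suc (m' 5) < 2 ^ w"
      using lt assms(3) by auto
    show ?case
      by (intro T_Blk) (use 3 assms(1) assms(6) i w2 in \<open>auto simp: Inv_def\<close>)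
  next
    case (4 b m')
    then have "N < 2 ^ m' 5" "m' 5 \<le> bt" by (auto simp: Inv_def)
    moreover have "m' 5 = bt"
    proof (rule ccontr)
      assume "m' 5 \<noteq> bt"
      then have "Suc (m' 5) \<le> bt" using \<open>m' 5 \<le> bt\<close> by simp
      then have "(2::nat) ^ Suc (m' 5) \<le> 2 ^ bt" by (intro power_increasing) auto
      then show False using \<open>N < 2 ^ m' 5\<close> assms(5) by simp
    qed
    ultimately show ?case using 4 by (auto simp: Inv_def)
  qed
qed (use assms in auto)

lemma T_init_spacing:
  assumes "m 14 = 1" "4 * (m 2 + 1) * m 4 = M" "0 < M" "4 * M < 2 ^ w" "M \<le> 2 ^ i" "2 ^ i < 2 * M"
    "4 * i + 10 \<le> a"
  shows "T init_spacing a m (\<lambda>b m'. a \<le> b + 4 * i + 10 \<and> m' 6 = 2 ^ i \<and> (\<forall>r. r \<notin> {6,45} \<longrightarrow> m' r = m r))" (is "T _ _ _ ?Q")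
  unfolding init_spacing_def
proof (intro T_seq T_Blk)
  define Inv where "Inv b m' \<longleftrightarrow> (\<forall>r. r \<notin> {6,45} \<longrightarrow> m' r = m r) \<and> m' 45 = M \<and>
     (\<exists>j\<le>i. m' 6 = 2 ^ j \<and> a \<le> b + 4 * j + 5)" for b m'
  have m4: "0 < m 4" using assms(2,3) by (cases "m 4") auto
  have mm: "m 2 + 1 \<le> M" "(m 2 + 1) * m 4 \<le> M"
  proof -
    have M: "M = 4 * ((m 2 + 1) * m 4)" using assms(2)[symmetric] by (simp only: mult.assoc)
    have le: "(m 2 + 1) * m 4 \<le> M" unfolding M by simp
    show "(m 2 + 1) * m 4 \<le> M" by (rule le)
    have "m 2 + 1 \<le> (m 2 + 1) * m 4" using m4 by (cases "m 4") simp_all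
    then show "m 2 + 1 \<le> M" using le by (rule order_trans)
  qed
  have w: "m 2 + 1 < 2 ^ w" "(m 2 + 1) * m 4 < 2 ^ w" "(m 2 + 1) * m 4 + (m 2 + 1) * m 4 < 2 ^ w" "M < 2 ^ w"
    using mm assms(2-4) by auto
  have M: "(m 2 + 1) * m 4 + (m 2 + 1) * m 4 + ((m 2 + 1) * m 4 + (m 2 + 1) * m 4) = M"
    using assms(2) by (simp add: algebra_simps)
  show "T (WhileL 6 45 (Blk [Op Add 6 6 6]))
     (a - length [Op Add 45 2 14, Op Mul 45 45 4, Op Add 45 45 45, Op Add 45 45 45, Const 6 1])
     (effs [Op Add 45 2 14, Op Mul 45 45 4, Op Add 45 45 45, Op Add 45 45 45, Const 6 1] m)
     ?Q"
  proof (rule T_WhileL[where Inv = Inv], goal_cases)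
    case 1
    have e: "effs [Op Add 45 2 14, Op Mul 45 45 4, Op Add 45 45 45, Op Add 45 45 45, Const 6 1] m
       = m(45 := M, 6 := 1)"
      using assms(1) w M by (simp add: binop_Add binop_Mul del: mult_Suc)
    show ?case unfolding e Inv_def using assms(7) by (auto intro!: exI[of _ 0])
  next
    case (2 b m')
    then show ?case using assms(7) by (auto simp: Inv_def)
  next
    case (3 b m')
    then obtain j where j: "j \<le> i" "m' 6 = 2 ^ j" "a \<le> b + 4 * j + 5" "(2::nat) ^ j < M"
      and f: "\<forall>r. r \<notin> {6,45} \<longrightarrow> m' r = m r" "m' 45 = M" by (auto simp: Inv_def)
    then have "(2::nat) ^ j < 2 ^ i" using assms(5) by linarith
    then have ji: "j < i" by simp
    have w2: "2 ^ j + 2 ^ j < (2::nat) ^ w" using j(4) assms(4) by linarith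
    show ?case
      by (intro T_Blk) (use j f ji w2 assms(7) in \<open>auto simp: Inv_def intro!: exI[of _ "Suc j"]\<close>)
  next
    case (4 b m')
    then obtain j where j: "j \<le> i" "m' 6 = 2 ^ j" "a \<le> b + 4 * j + 5" "M \<le> (2::nat) ^ j"
      and f: "\<forall>r. r \<notin> {6,45} \<longrightarrow> m' r = m r" "m' 45 = M" by (auto simp: Inv_def)
    have "j = i"
    proof (rule ccontr)
      assume "j \<noteq> i"
      then have "(2::nat) ^ Suc j \<le> 2 ^ i" using j(1) by (intro power_increasing) auto
      then show False using j(4) assms(6) by simp
    qed
    then show ?case using j f by auto
  qed
qed (use assms in auto)

text \<open>Only words \<open>\<lfloor>eps * a\<rfloor>\<close> are available, so
  \<open>\<epsilon>\<^sup>2 * k\<close> is approximated by two nested floors. The stride is the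
  largest power of two not above \<open>q\<close>, or \<open>1\<close> if
  \<open>q = 0\<close>.\<close>

lemma T_init_stride:
  fixes m :: "nat \<Rightarrow> nat" and \<kappa> :: nat
  defines "e1 \<equiv> nat \<lfloor>eps I * real (m 2)\<rfloor>"
  defines "q \<equiv> nat \<lfloor>eps I * real e1\<rfloor> div (\<kappa> * m 5)"
  assumes "m 14 = 1" "\<kappa> * m 5 < 2 ^ w" "\<kappa> < 2 ^ w" "4 * q + 4 < 2 ^ w" "j = 0 \<or> 2 ^ j \<le> q" "q < 2 ^ (j + 1)"
    "5 * j + 20 \<le> a"
  shows "T (init_stride \<kappa>) a m (\<lambda>b m'. a \<le> b + 5 * j + 20 \<and> m' 8 = 2 ^ j \<and> m' 7 = e1 \<and>
    (\<forall>r. r \<notin> {7,8,45,46,47} \<longrightarrow> m' r = m r))" (is "T _ _ _ ?Q")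
  unfolding init_stride_def
proof (intro T_seq T_Blk)
  define Inv where "Inv b m' \<longleftrightarrow> (\<forall>r. r \<notin> {7,8,45,46,47} \<longrightarrow> m' r = m r) \<and> m' 7 = e1 \<and> m' 45 = q + 1 \<and>
     (\<exists>i\<le>j. m' 8 = 2 ^ i \<and> m' 47 = 2 ^ (i + 1) \<and> a \<le> b + 5 * i + 8)" for b m'
  show "T (WhileL 47 45 (Blk [Copy 8 47, Op Add 47 47 47]))
     (a - length [Mul_Eps 7 2, Mul_Eps 45 7, Const 46 \<kappa>, Op Mul 46 46 5, Op Div 45 45 46,
       Op Add 45 45 14, Const 8 1, Const 47 2])
     (effs [Mul_Eps 7 2, Mul_Eps 45 7, Const 46 \<kappa>, Op Mul 46 46 5, Op Div 45 45 46,
       Op Add 45 45 14, Const 8 1, Const 47 2] m)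
     ?Q"
  proof (rule T_WhileL[where Inv = Inv], goal_cases)
    case 1
    have e: "effs [Mul_Eps 7 2, Mul_Eps 45 7, Const 46 \<kappa>, Op Mul 46 46 5, Op Div 45 45 46,
       Op Add 45 45 14, Const 8 1, Const 47 2] m
       = m(7 := e1, 46 := \<kappa> * m 5, 45 := q + 1, 8 := 1, 47 := 2)"
      using assms(3-6) by (auto simp: q_def e1_def fun_eq_iff)
    show ?case unfolding e Inv_def using assms(9) by (auto intro!: exI[of _ 0])
  next
    case (2 b m')
    then show ?case using assms(9) by (auto simp: Inv_def)
  next
    case (3 b m')
    then obtain i where i: "i \<le> j" "m' 8 = 2 ^ i" "m' 47 = 2 ^ (i + 1)" "a \<le> b + 5 * i + 8" "(2::nat) ^ (i + 1) \<le> q"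
      and f: "\<forall>r. r \<notin> {7,8,45,46,47} \<longrightarrow> m' r = m r" "m' 45 = q + 1" "m' 7 = e1" by (auto simp: Inv_def)
    then have "(2::nat) ^ (i + 1) < 2 ^ (j + 1)" using assms(8) by linarith
    then have ij: "i < j" by simp
    have w2: "2 ^ (i + 1) + 2 ^ (i + 1) < (2::nat) ^ w" using i(5) assms(6) by linarith
    show ?case
      by (intro T_Blk) (use i f ij w2 assms(9) in \<open>auto simp: Inv_def intro!: exI[of _ "Suc i"]\<close>)
  next
    case (4 b m')
    then obtain i where i: "i \<le> j" "m' 8 = 2 ^ i" "m' 47 = 2 ^ (i + 1)" "a \<le> b + 5 * i + 8" "q < (2::nat) ^ (i + 1)"
      and f: "\<forall>r. r \<notin> {7,8,45,46,47} \<longrightarrow> m' r = m r" "m' 45 = q + 1" "m' 7 = e1" by (auto simp: Inv_def)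
    have "i = j"
    proof (rule ccontr)
      assume "i \<noteq> j"
      then have "(2::nat) ^ (i + 1) \<le> 2 ^ j" "j \<noteq> 0" using i(1) by (auto intro!: power_increasing simp del: power_Suc)
      then show False using i(5) assms(7) by linarith
    qed
    then show ?case using i f by auto
  qed
qed (use assms in auto)

text \<open>The threshold lies halfway between \<open>k\<close> and
  \<open>(1 + \<epsilon>) * k\<close> up to rounding, which leaves a margin of about
  \<open>\<epsilon> * k / 2\<close> on either side.\<close>

lemma T_init_constants:
  assumes "m 14 = 1" "m 2 + m 7 + 1 < 2 ^ w" "2 * m 2 + 1 < 2 ^ w" "c < 2 ^ w" "c * m 5 < 2 ^ w" "9 \<le> a"
  shows "T (init_constants c) a m (\<lambda>b m'. a \<le> b + 9 \<and> m' 9 = m 2 + m 7 div 2 \<and> m' 10 = m 2 + m 7 div 2 + 1 \<and>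
     m' 15 = 2 * m 2 + 1 \<and> m' 11 = c * m 5 \<and> m' 12 = 0 \<and> (\<forall>r. r \<notin> {9,10,11,12,15,46} \<longrightarrow> m' r = m r))"
proof -
  have "m 2 + m 7 div 2 + 1 < 2 ^ w" "m 2 + m 2 + 1 < 2 ^ w" "m 2 + m 2 < 2 ^ w" "m 2 + m 7 div 2 < 2 ^ w"
    using assms(2,3) by linarith+
  then show ?thesis
    unfolding init_constants_def by (intro T_Blk) (use assms in auto)
qed

end

section \<open>Chernoff bounds\<close>

lemma stride_bounds:
  fixes \<epsilon> :: real and k \<kappa> bt g e1 e2 :: nat
  assumes eps: "0 < \<epsilon>" "\<epsilon> < 1"
    and e1: "e1 = nat \<lfloor>\<epsilon> * real k\<rfloor>" and e2: "e2 = nat \<lfloor>\<epsilon> * real e1\<rfloor>"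
    and g: "0 < g" "g \<le> e2 div (\<kappa> * bt)"
  shows "real \<kappa> * real bt * real g \<le> \<epsilon>\<^sup>2 * real k"
    and "real (k + e1 div 2) \<le> k + \<epsilon> * real k / 2"
    and "k + \<epsilon> * real k / 2 - 1 \<le> real (k + e1 div 2)"
proof -
  have r1: "real e1 \<le> \<epsilon> * real k" "\<epsilon> * real k - 1 \<le> real e1" unfolding e1 using eps by auto
  have r2: "real e2 \<le> \<epsilon> * real e1" unfolding e2 using eps by auto
  have "g * (\<kappa> * bt) \<le> e2" using g(2) by (metis div_times_less_eq_dividend le_trans mult_le_mono1)
  then have "real (g * (\<kappa> * bt)) \<le> real e2" by (rule of_nat_mono)
  then have "real \<kappa> * real bt * real g \<le> real e2" by (simp add: ac_simps)
  also have "\<dots> \<le> \<epsilon> * (\<epsilon> * real k)" using r2 r1(1) eps by (meson mult_left_mono order_trans less_imp_le)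
  finally show "real \<kappa> * real bt * real g \<le> \<epsilon>\<^sup>2 * real k" by (simp add: power2_eq_square)
  have h: "real (e1 div 2) \<le> real e1 / 2" "real e1 / 2 - 1 / 2 \<le> real (e1 div 2)" by linarith+
  show "real (k + e1 div 2) \<le> k + \<epsilon> * real k / 2" using h(1) r1(1) by simp
  show "k + \<epsilon> * real k / 2 - 1 \<le> real (k + e1 div 2)" using h(2) r1(2) by simp
qed

text \<open>With \<open>lam = \<epsilon> / 5\<close> and
  \<open>exp x \<le> 1 + x + x\<^sup>2\<close> the exponent times \<open>g\<close> is at most
  \<open>\<epsilon> / 5 - (1/10 - 1/25) * \<epsilon>\<^sup>2 * k\<close>, where
  \<open>\<epsilon> / 5\<close> is the price of rounding the threshold. As
  \<open>\<epsilon>\<^sup>2 * k \<ge> 100 * g\<close>, this is at most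
  \<open>- 2 * g\<close>.\<close>

lemma chernoff_upper:
  fixes \<epsilon> :: real and k \<kappa> bt g :: nat and TH :: real
  assumes eps: "0 < \<epsilon>" "\<epsilon> < 1" and g: "0 < g" "1 \<le> bt" "100 \<le> \<kappa>"
    and b: "real \<kappa> * real bt * real g \<le> \<epsilon>\<^sup>2 * real k" and TH: "k + \<epsilon> * real k / 2 - 1 \<le> TH"
  shows "exp ((\<epsilon> / 5 * (0 - TH) + (exp (\<epsilon> / 5) - 1) * real k) / g) \<le> 1 / 4"
proof -
  have "exp (\<epsilon> / 5) \<le> 1 + \<epsilon> / 5 + (\<epsilon> / 5)\<^sup>2" using eps by (intro exp_bound) auto
  then have "(exp (\<epsilon> / 5) - 1) * real k \<le> (\<epsilon> / 5 + (\<epsilon> / 5)\<^sup>2) * real k"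
    by (intro mult_right_mono) auto
  moreover have "\<epsilon> / 5 * (k + \<epsilon> * real k / 2 - 1) \<le> \<epsilon> / 5 * TH"
    using TH eps by (intro mult_left_mono) auto
  moreover have "\<epsilon> / 5 * (k + \<epsilon> * real k / 2 - 1) = \<epsilon> / 5 * k + \<epsilon>\<^sup>2 * real k / 10 - \<epsilon> / 5"
    by (simp add: power2_eq_square field_simps)
  moreover have "(\<epsilon> / 5 + (\<epsilon> / 5)\<^sup>2) * real k = \<epsilon> / 5 * k + \<epsilon>\<^sup>2 * real k / 25"
    by (simp add: power2_eq_square field_simps)
  ultimately have 1: "\<epsilon> / 5 * (0 - TH) + (exp (\<epsilon> / 5) - 1) * real k \<le> \<epsilon> / 5 - 3 / 50 * (\<epsilon>\<^sup>2 * real k)"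
    using minus_mult_right[of "\<epsilon> / 5" TH] by (simp only: diff_0)
  have "100 * 1 * real g \<le> real \<kappa> * real bt * real g"
    using g by (intro mult_right_mono mult_mono) auto
  then have "100 * real g \<le> \<epsilon>\<^sup>2 * real k" using b by simp
  then have "\<epsilon> / 5 - 3 / 50 * (\<epsilon>\<^sup>2 * real k) \<le> - 2 * real g"
    using eps g(1) by (simp add: field_simps)
  then have "(\<epsilon> / 5 * (0 - TH) + (exp (\<epsilon> / 5) - 1) * real k) / g \<le> - 2"
    using 1 g(1) by (simp add: divide_le_eq)
  then have "exp ((\<epsilon> / 5 * (0 - TH) + (exp (\<epsilon> / 5) - 1) * real k) / g) \<le> exp (- 2)" by simp
  also have "exp (- 2 :: real) \<le> 1 / 4"
  proof -
    have "(2::real) \<le> exp 1" using exp_ge_add_one_self[of 1] by simp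
    then have "2 * 2 \<le> exp 1 * exp (1::real)" by (intro mult_mono) auto
    then have "4 \<le> exp (2::real)" by (simp add: exp_add[symmetric])
    then show ?thesis by (simp add: exp_minus field_simps)
  qed
  finally show ?thesis .
qed

text \<open>With \<open>s = \<epsilon> / 8\<close> and
  \<open>exp (- s) \<le> 1 - s + s\<^sup>2\<close> the exponent times \<open>g\<close> is at most
  \<open>(2 * s\<^sup>2 - s * \<epsilon> / 2) * k = - \<epsilon>\<^sup>2 * k / 32\<close>. The
  factor \<open>100 * (c + 1) * bt\<close> between \<open>g\<close> and
  \<open>\<epsilon>\<^sup>2 * k\<close> makes the error of a single run polynomially small.\<close>

lemma chernoff_lower:
  fixes \<epsilon> :: real and k \<kappa> bt g c r :: nat and TH :: real
  assumes eps: "0 < \<epsilon>" "\<epsilon> < 1" and g: "0 < g" and \<kappa>: "100 * (c + 1) \<le> \<kappa>"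
    and b: "real \<kappa> * real bt * real g \<le> \<epsilon>\<^sup>2 * real k" and TH: "TH \<le> k + \<epsilon> * real k / 2"
    and r: "(1 + \<epsilon>) * k \<le> r"
  shows "exp ((- \<epsilon> / 8 * (0 - TH) + (exp (- \<epsilon> / 8) - 1) * real r) / g) \<le> (1 / 2) ^ (2 * (c + 1) * bt)"
proof -
  define s where "s = \<epsilon> / 8"
  have s: "0 < s" "s < 1" using eps by (auto simp: s_def)
  have "exp (- s) * (1 + s) \<le> exp (- s) * exp s"
    using exp_ge_add_one_self[of s] by (intro mult_left_mono) auto
  then have "exp (- s) * (1 + s) \<le> 1" by (simp add: exp_minus)
  moreover have "1 \<le> (1 - s + s\<^sup>2) * (1 + s)" using s by (simp add: power2_eq_square algebra_simps)
  ultimately have "exp (- s) * (1 + s) \<le> (1 - s + s\<^sup>2) * (1 + s)" by linarith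
  then have e: "exp (- s) \<le> 1 - s + s\<^sup>2" using s by simp
  have s2: "0 \<le> s - s\<^sup>2" using s by (simp add: power2_eq_square)
  have "(s - s\<^sup>2) * ((1 + \<epsilon>) * k) \<le> (s - s\<^sup>2) * r" using s2 r by (intro mult_left_mono) auto
  moreover have "(exp (- s) - 1) * real r \<le> (- (s - s\<^sup>2)) * real r" using e by (intro mult_right_mono) auto
  moreover have "s * TH \<le> s * (k + \<epsilon> * real k / 2)" using TH s by (intro mult_left_mono) auto
  moreover have "s * (k + \<epsilon> * real k / 2) - (s - s\<^sup>2) * ((1 + \<epsilon>) * k) = (s\<^sup>2 * (1 + \<epsilon>) - s * \<epsilon> / 2) * k"
    by (simp add: algebra_simps)
  moreover have "(s\<^sup>2 * (1 + \<epsilon>) - s * \<epsilon> / 2) * k \<le> (- \<epsilon>\<^sup>2 / 32) * k"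
  proof (rule mult_right_mono)
    have "s\<^sup>2 * (1 + \<epsilon>) \<le> s\<^sup>2 * 2" using eps by (intro mult_left_mono) auto
    then show "s\<^sup>2 * (1 + \<epsilon>) - s * \<epsilon> / 2 \<le> - \<epsilon>\<^sup>2 / 32" by (simp add: s_def power2_eq_square)
  qed simp
  ultimately have 1: "- s * (0 - TH) + (exp (- s) - 1) * real r \<le> - (\<epsilon>\<^sup>2 * k) / 32"
    by (simp add: algebra_simps)
  have "real (100 * (c + 1)) * real bt * real g \<le> real \<kappa> * real bt * real g"
    using \<kappa> by (intro mult_right_mono of_nat_mono) auto
  then have "100 * real (c + 1) * real bt * real g \<le> \<epsilon>\<^sup>2 * k" using b by simp
  then have "- (\<epsilon>\<^sup>2 * k) / 32 \<le> - (2 * real (c + 1) * real bt) * real g"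
  proof -
    have "0 \<le> real (c + 1) * real bt * real g" by simp
    then have "64 * (real (c + 1) * real bt * real g) \<le> 100 * (real (c + 1) * real bt * real g)" by (intro mult_right_mono) auto
    also have "\<dots> \<le> \<epsilon>\<^sup>2 * k" using \<open>100 * real (c + 1) * real bt * real g \<le> \<epsilon>\<^sup>2 * k\<close> by (simp only: mult.assoc)
    finally have "64 * (real (c + 1) * real bt * real g) \<le> \<epsilon>\<^sup>2 * k" .
    moreover have "(2 * real (c + 1) * real bt) * real g = 64 * (real (c + 1) * real bt * real g) / 32" by simp
    ultimately have "(2 * real (c + 1) * real bt) * real g \<le> (\<epsilon>\<^sup>2 * k) / 32" by linarith
    then show ?thesis by simp
  qed
  with 1 have "(- s * (0 - TH) + (exp (- s) - 1) * real r) / g \<le> - (2 * real (c + 1) * real bt)"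
    using g by (simp add: divide_le_eq)
  then have "exp ((- s * (0 - TH) + (exp (- s) - 1) * real r) / g) \<le> exp (- (2 * real (c + 1) * real bt))"
    by (simp only: exp_le_cancel_iff)
  also have "- (2 * real (c + 1) * real bt) = real (2 * (c + 1) * bt) * (- 1)" by (simp add: algebra_simps)
  also have "exp (real (2 * (c + 1) * bt) * (- 1)) = exp (- 1) ^ (2 * (c + 1) * bt)"
    by (rule exp_of_nat_mult)
  also have "\<dots> \<le> (1 / 2) ^ (2 * (c + 1) * bt)"
  proof (rule power_mono)
    have "(2::real) \<le> exp 1" using exp_ge_add_one_self[of 1] by simp
    then show "exp (- 1) \<le> (1 / 2 :: real)" by (simp add: exp_minus field_simps)
  qed simp
  finally show ?thesis by (simp add: s_def)
qed

text \<open>The two ways of failing: some of the \<open>c * bt\<close> runs accepts a NO instance,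
  or all of them reject a YES instance. The exponent \<open>2 * (c + 1) * bt\<close> leaves room for
  the factor \<open>c * bt\<close>, which is at most \<open>2 ^ (c + bt)\<close>.\<close>

lemma error_union_bound:
  fixes c bt N :: nat
  assumes "1 \<le> bt" "N \<le> 2 ^ bt" "0 < N"
  shows "real (c * bt) * (1 / 2) ^ (2 * (c + 1) * bt) \<le> 1 / real N ^ c" "(1 / 2) ^ (c * bt) \<le> 1 / real N ^ c"
proof -
  have "real N ^ c \<le> (2 ^ bt) ^ c" using assms by (intro power_mono) (simp_all flip: of_nat_le_iff)
  also have "(2 ^ bt) ^ c = (2::real) ^ (c * bt)" by (simp flip: power_mult add: mult.commute)
  finally have N: "real N ^ c \<le> 2 ^ (c * bt)" .
  then show 2: "(1 / 2) ^ (c * bt) \<le> 1 / real N ^ c"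
    using assms by (simp add: power_one_over field_simps)
  have le: "c * bt \<le> 2 * (c + 1) * bt" by (simp add: algebra_simps)
  have "c * bt \<le> 2 ^ c * 2 ^ bt" by (intro mult_le_mono less_imp_le less_exp)
  also have "\<dots> = 2 ^ (c + bt)" by (simp add: power_add)
  also have "\<dots> \<le> 2 ^ (2 * (c + 1) * bt - c * bt)"
  proof (intro power_increasing)
    have "c * 1 \<le> c * bt" using assms by (intro mult_le_mono2) auto
    moreover have "2 * (c + 1) * bt - c * bt = c * bt + 2 * bt" by (simp add: algebra_simps)
    ultimately show "c + bt \<le> 2 * (c + 1) * bt - c * bt" by linarith
  qed simp
  finally have "real (c * bt) \<le> 2 ^ (2 * (c + 1) * bt - c * bt)"
    by (metis of_nat_le_iff of_nat_numeral of_nat_power)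
  then have "real (c * bt) * (1 / 2) ^ (2 * (c + 1) * bt)
     \<le> 2 ^ (2 * (c + 1) * bt - c * bt) * (1 / 2) ^ (2 * (c + 1) * bt)"
    by (intro mult_right_mono) auto
  also have "2 ^ (2 * (c + 1) * bt - c * bt) * (1 / 2 :: real) ^ (2 * (c + 1) * bt) = (1 / 2) ^ (c * bt)"
  proof -
    have "(1 / 2 :: real) ^ (2 * (c + 1) * bt) = (1 / 2) ^ (2 * (c + 1) * bt - c * bt) * (1 / 2) ^ (c * bt)"
      by (simp only: power_add[symmetric] le_add_diff_inverse2[OF le])
    then show ?thesis by (simp add: power_one_over)
  qed
  finally show "real (c * bt) * (1 / 2) ^ (2 * (c + 1) * bt) \<le> 1 / real N ^ c" using 2 by linarith
qed

section \<open>Running time\<close>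

text \<open>From \<open>bt \<le> 1 + ln N / ln 2\<close> with \<open>1 / ln 2 \<le> 3 / 2\<close>
  and \<open>1 \<le> ln N\<close>.\<close>

lemma log_exponent:
  fixes bt N :: nat
  assumes "2 ^ bt \<le> 2 * N" "3 \<le> N"
  shows "real bt \<le> 5 / 2 * ln (real N)" "1 \<le> ln (real N)"
proof -
  have "exp 1 \<le> real N" using assms exp_le by linarith
  then show l1: "1 \<le> ln (real N)" using assms by (simp add: ln_ge_iff)
  have "(2::real) ^ bt \<le> 2 * real N" using assms(1) by (metis of_nat_le_iff of_nat_mult of_nat_numeral of_nat_power)
  then have "ln ((2::real) ^ bt) \<le> ln (2 * real N)" using assms by (subst ln_le_cancel_iff) auto
  then have "real bt * ln 2 \<le> ln 2 + ln (real N)" using assms by (simp add: ln_realpow ln_mult)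
  moreover have "(real bt - 1) * (2 / 3) \<le> (real bt - 1) * ln 2 \<or> bt = 0"
    using mult_left_mono[OF ln2_ge_two_thirds, of "real bt - 1"] by (cases "bt = 0") auto
  moreover have "(real bt - 1) * ln 2 = real bt * ln 2 - ln 2" by (simp add: left_diff_distrib)
  ultimately show "real bt \<le> 5 / 2 * ln (real N)" using l1
  proof (elim disjE, goal_cases)
    case 1
    then have "(real bt - 1) * (2 / 3) \<le> ln (real N)" by linarith
    then have "real bt \<le> 1 + 3 / 2 * ln (real N)" by simp
    then show ?case using l1 by linarith
  next
    case 2
    then have "real bt = 0" by simp
    then show ?case using l1 by linarith
  qed
qed

text \<open>The two floors lose at most \<open>2\<close>, the division and the rounding to a power
  of two at most a factor of two, so
  \<open>\<epsilon>\<^sup>2 * (k + 1) \<le> 2 * g * \<kappa> * bt + 3\<close>. As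
  \<open>g * \<kappa> * bt \<ge> 1\<close>, the factor \<open>5\<close> covers this, also for stride
  \<open>1\<close>.\<close>

lemma uniform_stride_cost:
  fixes \<epsilon> t :: real and k \<kappa> bt g n :: nat
  assumes eps: "0 < \<epsilon>" "\<epsilon> < 1"
    and g: "0 < g" "nat \<lfloor>\<epsilon> * real (nat \<lfloor>\<epsilon> * real k\<rfloor>)\<rfloor> div (\<kappa> * bt) < 2 * g" and kb: "1 \<le> \<kappa>" "1 \<le> bt"
    and t: "1 / (\<epsilon>\<^sup>2 * (real k + 1)) * real n \<le> t"
  shows "real (n div g) \<le> 5 * real \<kappa> * real bt * t"
proof -
  define e1 where "e1 = nat \<lfloor>\<epsilon> * real k\<rfloor>"
  define e2 where "e2 = nat \<lfloor>\<epsilon> * real e1\<rfloor>"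
  have "\<epsilon> * real k - 1 \<le> real e1" unfolding e1_def by linarith
  then have "\<epsilon> * (\<epsilon> * real k - 1) \<le> \<epsilon> * real e1" using eps by (intro mult_left_mono) auto
  moreover have "\<epsilon> * real e1 - 1 \<le> real e2" unfolding e2_def by linarith
  ultimately have 1: "\<epsilon>\<^sup>2 * real k - 2 \<le> real e2" using eps by (simp add: power2_eq_square algebra_simps)
  have "0 < \<kappa> * bt" using kb by simp
  then have "e2 < 2 * g * (\<kappa> * bt)"
    using g(2) unfolding e1_def[symmetric] e2_def[symmetric] by (simp add: div_less_iff_less_mult)
  then have "real e2 \<le> real (2 * g * (\<kappa> * bt))" by (intro of_nat_mono) simp
  moreover have "1 \<le> g * (\<kappa> * bt)" using g(1) kb by simp
  then have "1 \<le> real (g * (\<kappa> * bt))" by linarith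
  moreover have "\<epsilon>\<^sup>2 \<le> 1" using eps by (simp add: power_le_one)
  ultimately have 2: "\<epsilon>\<^sup>2 * (real k + 1) \<le> 5 * (real g * (real \<kappa> * real bt))"
    using 1 by (simp add: algebra_simps)
  have pos: "0 < \<epsilon>\<^sup>2 * (real k + 1)" using eps by (intro mult_pos_pos) auto
  have "real n / real g \<le> 5 * (real \<kappa> * real bt) * (1 / (\<epsilon>\<^sup>2 * (real k + 1)) * real n)"
  proof -
    have "(\<epsilon>\<^sup>2 * (real k + 1)) * real n \<le> 5 * (real g * (real \<kappa> * real bt)) * real n"
      using 2 by (intro mult_right_mono) auto
    then show ?thesis using pos g(1) by (simp add: field_simps)
  qed
  also have "\<dots> \<le> 5 * (real \<kappa> * real bt) * t" using t by (intro mult_left_mono) auto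
  finally have "real n / real g \<le> 5 * real \<kappa> * real bt * t" by simp
  then show ?thesis using of_nat_div_le_of_nat[of n g, where 'a = real] by linarith
qed

section \<open>The algorithm\<close>

lemma power_two_above:
  fixes N :: nat
  assumes "0 < N" shows "\<exists>i>0. N < 2 ^ i \<and> 2 ^ i \<le> 2 * N"
proof -
  define i where "i = (LEAST i. N < 2 ^ i)"
  have "N < 2 ^ N" by (rule less_exp)
  then have i: "N < 2 ^ i" unfolding i_def by (rule LeastI)
  then have "i \<noteq> 0" using assms by (cases i) auto
  then obtain j where j: "i = Suc j" by (cases i) auto
  then have "\<not> N < 2 ^ j" unfolding i_def by (metis not_less_Least lessI)
  then show ?thesis using i j by (intro exI[of _ i]) auto
qed

lemma power_two_ceiling:
  fixes M :: nat
  assumes "0 < M" shows "\<exists>i. M \<le> 2 ^ i \<and> 2 ^ i < 2 * M"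
proof (cases "M = 1")
  case True
  then show ?thesis by (intro exI[of _ 0]) auto
next
  case False
  then obtain i where "M - 1 < 2 ^ i" "(2::nat) ^ i \<le> 2 * (M - 1)"
    using power_two_above[of "M - 1"] assms by auto
  then show ?thesis using assms False by (intro exI[of _ i]) auto
qed

lemma power_two_floor:
  fixes q :: nat
  shows "\<exists>j. (j = 0 \<or> 2 ^ j \<le> q) \<and> q < 2 ^ (j + 1)"
proof (cases "q = 0")
  case True
  then show ?thesis by (intro exI[of _ 0]) auto
next
  case False
  then obtain i where "0 < i" "q < 2 ^ i" "2 ^ i \<le> 2 * q" using power_two_above[of q] by auto
  then show ?thesis by (cases i) auto
qed

lemma lev_le_add: "lev x y i j \<le> i + j"
  using lev_add_left[of x y 0 i j] by simp

section \<open>Uniqueness of window occurrences\<close>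

context bounded_ram
begin

lemma matches_unique_less:
  assumes per: "\<And>i. i + l \<le> length (str_X I) \<Longrightarrow> per (substring (str_X I) i (i + l)) > 2 * k"
    and c: "c + l \<le> length (str_X I)"
    and m: "matches l c s" "matches l c t" and st: "s < t" "t \<le> s + 2 * k"
  shows False
proof -
  let ?S = "substring (str_X I) c (c + l)"
  have len: "length ?S = l" using c by (simp add: substring_def)
  have nth: "?S ! i = cX (c + i)" if "i < l" for i
    using c that by (simp add: substring_def char_at_def)
  have "is_period (t - s) ?S"
    unfolding is_period_def len
  proof (intro conjI allI impI)
    fix i assume i: "i + (t - s) < l"
    have "cX (c + i) = cY (t + i)" using m(2) i by (simp add: matches_def)
    also have "\<dots> = cY (s + (i + (t - s)))" using st by (simp add: add.commute)
    also have "\<dots> = cX (c + (i + (t - s)))" using m(1) i by (simp add: matches_def)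
    finally show "?S ! i = ?S ! (i + (t - s))" using i nth by simp
  qed (use st in simp)
  then have "per ?S \<le> t - s" unfolding per_def by (rule Least_le)
  then show False using per[OF c] st by simp
qed

text \<open>The window length of the program differs from \<open>l\<close> only for
  \<open>l = 0\<close> and \<open>l > |X| + 1\<close>. In the latter case no window fits; in the
  former the empty string, of period \<open>1\<close>, forces \<open>k = 0\<close>, and then
  \<open>s = c = t\<close>.\<close>

lemma matches_unique:
  assumes per: "\<And>i. i + l \<le> length (str_X I) \<Longrightarrow> per (substring (str_X I) i (i + l)) > 2 * k"
    and c: "c + max 1 (min l (length (str_X I) + 1)) \<le> length (str_X I)"
    and m: "matches (max 1 (min l (length (str_X I) + 1))) c s" "matches (max 1 (min l (length (str_X I) + 1))) c t"
    and r: "s \<le> c + k" "c \<le> s + k" "t \<le> c + k" "c \<le> t + k"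
  shows "s = t"
proof (cases "l = 0")
  case True
  have "is_period 1 ([] :: nat list)" by (simp add: is_period_def)
  then have "per ([] :: nat list) \<le> 1" unfolding per_def by (rule Least_le)
  then have "k = 0" using per[of 0] True by (simp add: substring_def)
  then show ?thesis using r by simp
next
  case False
  then have l: "max 1 (min l (length (str_X I) + 1)) = l" using c by (simp add: min_def max_def split: if_splits)
  show ?thesis
  proof (rule ccontr)
    assume "s \<noteq> t"
    then consider "s < t" | "t < s" by linarith
    then show False
    proof cases
      case 1
      show False
        by (rule matches_unique_less[of l k c s t]) (use per c m r 1 l in auto)
    next
      case 2
      show False
        by (rule matches_unique_less[of l k c t s]) (use per c m r 2 l in auto)
    qed
  qed
qed

end

section \<open>Error probability and running time of the repeated runs\<close>

context sampler
begin

text \<open>The \<beta> of the amortised analysis: \<open>2 * v + 1 \<le> 3 * v\<close> for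
  \<open>v \<ge> 1\<close> turns the \<open>4\<close> of \<open>distance_cost\<close> into
  \<open>12\<close>.\<close>

definition overhead :: "nat \<Rightarrow> nat" where
  "overhead L = 12 * (120 * (L + 1) + 10) + 12 * L + search_cost + 68"

lemma distance_cost_overhead:
  assumes "1 \<le> v"
  shows "distance_cost L v + 12 * L + search_cost + 60 \<le> overhead L * v"
proof -
  obtain u where v: "v = Suc u" using assms by (cases v) auto
  define E where "E = 120 * (L + 1) + 10"
  have "overhead L * v = overhead L + overhead L * u" by (simp add: v)
  moreover have "12 * E * u \<le> overhead L * u" by (simp add: overhead_def E_def)
  moreover have "distance_cost L v = 12 * E + 8 * E * u + 8" by (simp add: distance_cost_def E_def v algebra_simps)
  moreover have "8 * E * u \<le> 12 * E * u" by simp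
  moreover have "overhead L = 12 * E + 12 * L + search_cost + 68" by (simp add: overhead_def E_def)
  ultimately show ?thesis by linarith
qed

lemma V_run_once_any:
  assumes cost: "\<And>v. 1 \<le> v \<Longrightarrow> distance_cost L v + 12 * L + search_cost + 60 \<le> \<beta> * v"
    and L: "L = min n (Dl + lp)" and conf: "conf m0" and a: "run_cost \<beta> + bend \<le> a"
    and post: "\<And>b m. run_post bend m0 b m \<Longrightarrow> f b m \<le> v"
  shows "V run_once f a m0 v"
proof (rule V_run_once[where safe = "\<lambda>_. False" and H = "\<lambda>_ _ _. v" and lost = "\<lambda>_. v" and p = "\<lambda>_. 0",
      OF _ _ cost L conf a])
  show "consistent False (\<lambda>_. 0) (\<lambda>c. c mod Dl = r) (\<lambda>_ _. v) v" for r
    using potential_const by (simp add: consistent_def)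
  show "f b m \<le> v" if "\<And>r. r < 16 \<Longrightarrow> m r = m0 r" "bend \<le> b" for b m
    by (rule post) (use that in \<open>auto simp: run_post_def\<close>)
qed (use Dl in auto)

text \<open>Between \<open>k\<close> and \<open>(1 + \<epsilon>) * k\<close> both answers are
  correct and the failure bound is \<open>0\<close>. On YES and NO instances stride \<open>1\<close>
  uses the exact potentials and any larger stride the exponential ones.\<close>

lemma V_main:
  fixes \<kappa> c bt N :: nat and \<epsilon> :: real
  defines "e1 \<equiv> nat \<lfloor>\<epsilon> * real k\<rfloor>"
  defines "e2 \<equiv> nat \<lfloor>\<epsilon> * real e1\<rfloor>"
  defines "\<beta> \<equiv> overhead (min n (Dl + lp))"
  assumes I: "length (str_X I) = n" "length (str_Y I) = ny" "thr I = k" "eps I = \<epsilon>"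
    and eps: "0 < \<epsilon>" "\<epsilon> < 1" and kn: "k < n + ny"
    and uniq: "\<And>c s t. c + lp \<le> n \<Longrightarrow> matches lp c s \<Longrightarrow> matches lp c t \<Longrightarrow> s \<le> c + k \<Longrightarrow> c \<le> s + k \<Longrightarrow>
         t \<le> c + k \<Longrightarrow> c \<le> t + k \<Longrightarrow> s = t"
    and Dlk: "4 * k * lp \<le> Dl" and TH: "TH = k + e1 div 2"
    and g1: "g = 1 \<or> g \<le> e2 div (\<kappa> * bt)" and \<kappa>: "\<kappa> = 100 * (c + 1)"
    and bt: "1 \<le> bt" "N \<le> 2 ^ bt" "0 < N"
    and conf: "conf m0" and R: "m0 11 = c * bt" "m0 12 = 0" "c * bt < 2 ^ w"
    and a: "c * bt * (run_cost \<beta> + 20) + 10 \<le> a"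
  shows "V main_loop f a m0 (1 / real N ^ c)"
proof -
  have cost: "\<And>v. 1 \<le> v \<Longrightarrow> distance_cost (min n (Dl + lp)) v + 12 * min n (Dl + lp) + search_cost + 60 \<le> \<beta> * v"
    unfolding \<beta>_def by (rule distance_cost_overhead)
  have ED: "ED (str_X I) (str_Y I) = pdist 0 0 n ny"
    by (simp add: ED_eq_lev I pdist_def)
  note loop = V_main_loop[OF conf R(1,2,3), of \<beta>, OF _ _ _ _ _ a]
  note sb = stride_bounds[OF eps e1_def[THEN meta_eq_to_obj_eq] e2_def[THEN meta_eq_to_obj_eq] g(1)]
  note eb = error_union_bound[OF bt]
  consider (yes) "pdist 0 0 n ny \<le> k"
    | (no) "k < pdist 0 0 n ny" "(1 + \<epsilon>) * k \<le> pdist 0 0 n ny"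
    | (gap) "k < pdist 0 0 n ny" "pdist 0 0 n ny < (1 + \<epsilon>) * k" by linarith
  then show ?thesis
  proof cases
    case yes
    \<comment> \<open>For empty \<open>X\<close> the distance would be \<open>|Y|\<close>, which
      exceeds \<open>k\<close> by the assumption \<open>kn\<close>; so an alignment with at least
      one column exists.\<close>
    have n0: "0 < n"
    proof (rule ccontr)
      assume "\<not> 0 < n"
      then show False using yes kn by (simp add: pdist_def)
    qed
    obtain p where p: "alignment p n ny" "(\<Sum>c<n. col_cost cX cY p c) \<le> lev cX cY n ny"
      using optimal_alignment[OF n0] by blast
    have p2: "(\<Sum>c<n. col_cost cX cY p c) \<le> k" using p(2) yes by (simp add: pdist_def)
    obtain G where G: "potential G 1" "\<And>acc r. 0 \<le> G acc r" "\<And>acc r r'. r \<le> r' \<Longrightarrow> G acc r \<le> G acc r'"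
      "G 0 k \<le> 1 / 4"
    proof (cases "g = 1")
      case True
      show ?thesis
        by (rule that[OF potential_exact(1)[OF True]]) (auto simp: TH)
    next
      case False
      then have g2: "g \<le> e2 div (\<kappa> * bt)" using g1 by simp
      show ?thesis
      proof (rule that[of "exp_potential (\<epsilon> / 5) 1"])
        show "potential (exp_potential (\<epsilon> / 5) 1) 1" using eps by (intro potential_exp) auto
        show "exp_potential (\<epsilon> / 5) 1 0 k \<le> 1 / 4"
          using chernoff_upper[OF eps g(1) bt(1) _ sb(1)[OF g2] sb(3)[OF g2, folded TH]] \<kappa>
          by (simp add: exp_potential_def)
        show "exp_potential (\<epsilon> / 5) 1 acc r \<le> exp_potential (\<epsilon> / 5) 1 acc r'" if "r \<le> r'" for acc r r'
          using eps that by (intro exp_potential_mono) auto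
      qed (simp add: exp_potential_def)
    qed
    have "V main_loop f a m0 ((\<lambda>j. (1 / 2) ^ j) (c * bt))"
    proof (rule loop[where yes = 0 and next_v = "\<lambda>v. v / 2"])
      show "V run_once f a m (v / 2)" if "conf m" "run_cost \<beta> + bend \<le> a" "0 \<le> v"
        "\<And>b m'. run_post bend m b m' \<Longrightarrow> f b m' \<le> (if m' 19 \<le> TH then 0 else v)" for f a m v bend
        by (rule V_run_once_YES[where G = G and p = p and L = "min n (Dl + lp)" and \<beta> = \<beta> and bend = bend and v = v and f = f and a = a and ?m0.0 = m, OF G p(1) p2 uniq Dlk cost refl that(1,2) that(4) that(3)])
      show "(if correct_answer I True then 0 else 1) \<le> (0 :: real)"
        using yes by (simp add: correct_answer_def ED I)
    qed (auto split: if_splits)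
    then show ?thesis by (rule V_mono) (use eb(2) in auto)
  next
    case no
    obtain G where G: "potential G 0" "\<And>acc r. 0 \<le> G acc r" "\<And>acc r r'. r \<le> r' \<Longrightarrow> G acc r' \<le> G acc r"
      "\<And>acc. acc \<le> TH \<Longrightarrow> 1 \<le> G acc 0" "G 0 (pdist 0 0 n ny) \<le> (1 / 2) ^ (2 * (c + 1) * bt)"
    proof (cases "g = 1")
      case True
      \<comment> \<open>For \<open>k = 0\<close> the threshold is \<open>0\<close> and the distance
        is positive; otherwise \<open>\<epsilon> * k / 2 < \<epsilon> * k\<close> separates the
        two.\<close>
      have "TH < pdist 0 0 n ny"
      proof (cases "k = 0")
        case True
        then show ?thesis using no by (simp add: TH e1_def)
      next
        case False
        have "real (e1 div 2) \<le> real e1 / 2" by linarith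
        moreover have "real e1 \<le> \<epsilon> * real k" unfolding e1_def using eps by simp
        ultimately have "real TH \<le> k + \<epsilon> * real k / 2" unfolding TH by simp
        moreover have "0 < \<epsilon> * real k" using eps False by simp
        ultimately have "real TH < (1 + \<epsilon>) * k" by (simp add: algebra_simps)
        then show ?thesis using no(2) by linarith
      qed
      then show ?thesis
        by (intro that[OF potential_exact(2)[OF True]]) auto
    next
      case False
      then have g2: "g \<le> e2 div (\<kappa> * bt)" using g1 by simp
      show ?thesis
      proof (rule that[of "exp_potential (- \<epsilon> / 8) 0"])
        show "potential (exp_potential (- \<epsilon> / 8) 0) 0" by (intro potential_exp) auto
        show "exp_potential (- \<epsilon> / 8) 0 0 (pdist 0 0 n ny) \<le> (1 / 2) ^ (2 * (c + 1) * bt)"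
          using chernoff_lower[OF eps g(1) _ sb(1)[OF g2] sb(2)[OF g2, folded TH] no(2), of c] \<kappa>
          by (simp add: exp_potential_def)
        show "1 \<le> exp_potential (- \<epsilon> / 8) 0 acc 0" if "acc \<le> TH" for acc
        proof -
          have "0 \<le> - \<epsilon> / 8 * (real acc - real TH) / real g"
            using that eps by (intro divide_nonneg_nonneg mult_nonpos_nonpos) auto
          then show ?thesis using that by (simp add: exp_potential_def)
        qed
        show "exp_potential (- \<epsilon> / 8) 0 acc r' \<le> exp_potential (- \<epsilon> / 8) 0 acc r" if "r \<le> r'" for acc r r'
          using eps that by (intro exp_potential_antimono) auto
      qed (simp add: exp_potential_def)
    qed
    define q where "q = G 0 (pdist 0 0 n ny)"
    have q: "0 \<le> q" "q \<le> (1 / 2) ^ (2 * (c + 1) * bt)" using G by (simp_all add: q_def)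
    have "V main_loop f a m0 ((\<lambda>j. real j * q) (c * bt))"
    proof (rule loop[where yes = 1 and next_v = "\<lambda>v. v + q"])
      show "V run_once f a m (v + q)" if "conf m" "run_cost \<beta> + bend \<le> a" "0 \<le> v"
        "\<And>b m'. run_post bend m b m' \<Longrightarrow> f b m' \<le> (if m' 19 \<le> TH then 1 else v)" for f a m v bend
        unfolding q_def by (rule V_run_once_NO[where G = G and L = "min n (Dl + lp)" and \<beta> = \<beta> and bend = bend and v = v and f = f and a = a and ?m0.0 = m, OF G(1-4) cost refl that(1,2) that(4) that(3)])
      show "(if correct_answer I False then 0 else 1) \<le> real 0 * q"
        using no by (simp add: correct_answer_def ED I)
    qed (use q in \<open>auto simp: algebra_simps\<close>)
    moreover have "real (c * bt) * q \<le> 1 / real N ^ c"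
    proof -
      have "real (c * bt) * q \<le> real (c * bt) * (1 / 2) ^ (2 * (c + 1) * bt)"
        using q by (intro mult_left_mono) auto
      then show ?thesis using eb(1)[of c] by linarith
    qed
    ultimately show ?thesis by (rule V_mono[OF _ order_refl])
  next
    case gap
    have "V main_loop f a m0 ((\<lambda>j. 0) (c * bt))"
    proof (rule loop[where yes = 0 and next_v = "\<lambda>v. v"])
      show "V run_once f a m v" if "conf m" "run_cost \<beta> + bend \<le> a" "0 \<le> v"
        "\<And>b m'. run_post bend m b m' \<Longrightarrow> f b m' \<le> (if m' 19 \<le> TH then 0 else v)" for f a m v bend
        by (rule V_run_once_any[where L = "min n (Dl + lp)" and \<beta> = \<beta> and bend = bend and v = v and f = f and a = a and ?m0.0 = m, OF cost refl that(1,2)]) (assumption, rule order_trans[OF that(4)], assumption, use that(3) in auto)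
      show "(if correct_answer I True then 0 else 1) \<le> (0 :: real)" "(if correct_answer I False then 0 else 1) \<le> (0 :: real)"
        using gap by (simp_all add: correct_answer_def ED I)
    qed auto
    then show ?thesis by (rule V_mono) auto
  qed
qed

text \<open>With \<open>K = k + 1\<close> and \<open>P = lp\<close>, phrases have length
  \<open>O(K * P)\<close>. Distances cost \<open>O(K)\<close> times this, thus
  \<open>O(P * K\<^sup>2) = O(t)\<close>. About \<open>n / (K * P)\<close> cuts cost
  \<open>O(P)\<close> each, thus \<open>O(n / K + P) = O(t)\<close>. The strides are covered by
  hypothesis \<open>s\<close>.\<close>

lemma run_cost_bound:
  fixes t :: real and \<kappa> bt :: nat
  assumes t: "1 \<le> t" "real n \<le> (real k + 1) * t" "real lp * (real k + 1)\<^sup>2 \<le> 4 * t"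
    and D: "4 * (k + 1) * lp \<le> Dl" "Dl < 8 * (k + 1) * lp" and lp: "1 \<le> lp" and bt: "1 \<le> bt"
    and s: "real (n div g) \<le> 5 * real \<kappa> * real bt * t"
  shows "real (run_cost (overhead (min n (Dl + lp))) + 20) \<le> (207000 + 200 * real \<kappa>) * real bt * t"
proof -
  define K P where "K = real k + 1" and "P = real lp"
  have KP: "1 \<le> K" "1 \<le> P" "1 \<le> K * P" using lp by (auto simp: K_def P_def mult_ge1_I)
  have PK: "P * K\<^sup>2 \<le> 4 * t" using t(3) by (simp add: K_def P_def)
  have "P * 1 \<le> P * K\<^sup>2" using KP by (intro mult_left_mono) auto
  then have P: "P \<le> 4 * t" using PK by simp
  define L where "L = min n (Dl + lp)"
  have "real Dl \<le> real (8 * (k + 1) * lp)" using D(2) by (intro of_nat_mono) simp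
  then have Dl8: "real Dl \<le> 8 * (K * P)" by (simp add: K_def P_def algebra_simps)
  have "real L \<le> real Dl + P" by (simp add: L_def P_def)
  moreover have "P \<le> K * P" using mult_right_mono[OF KP(1), of P] KP by simp
  ultimately have "real L + 1 \<le> 10 * (K * P)" using Dl8 KP by linarith
  then have "(real L + 1) * K \<le> 10 * (K * P) * K" using KP by (intro mult_right_mono) auto
  also have "10 * (K * P) * K = 10 * (P * K\<^sup>2)" by (simp add: power2_eq_square)
  finally have LK: "(real L + 1) * K \<le> 40 * t" using PK by simp
  have "real (4 * (k + 1) * lp) \<le> real Dl" using D(1) by (rule of_nat_mono)
  then have Dl4: "4 * (K * P) \<le> real Dl" by (simp add: K_def P_def algebra_simps)
  have "real (n div Dl) * real Dl \<le> real n" by (metis div_times_less_eq_dividend of_nat_le_iff of_nat_mult)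
  moreover have "real (n div Dl) * (4 * (K * P)) \<le> real (n div Dl) * real Dl"
    using Dl4 by (intro mult_left_mono) auto
  ultimately have "K * (4 * (real (n div Dl) * P)) \<le> K * t" using t(2) by (simp add: K_def algebra_simps)
  then have nD: "4 * (real (n div Dl) * P) \<le> t" using KP by simp
  have r: "real (run_cost (overhead L) + 20) = real (overhead L) * (3 * K) + (12 * P + 200) * (real (n div Dl) + 2)
     + 40 * real (n div g) + 40"
    by (simp add: run_cost_def K_def P_def algebra_simps)
  have "(12 * P + 200) * (real (n div Dl) + 2) \<le> (212 * P) * (real (n div Dl) + 2)"
    using KP by (intro mult_right_mono) auto
  also have "\<dots> = 53 * (4 * (real (n div Dl) * P)) + 424 * P" by (simp add: algebra_simps)
  finally have 1: "(12 * P + 200) * (real (n div Dl) + 2) \<le> 1749 * t" using nD P by linarith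
  have "real search_cost = (2 * K - 1) * (12 * P + 20) + 4"
    by (simp add: search_cost_def K_def P_def algebra_simps)
  also have "(2 * K - 1) * (12 * P + 20) \<le> (2 * K) * (32 * P)"
    using KP by (intro mult_mono) auto
  finally have sc: "real search_cost \<le> 64 * (K * P) + 4" by simp
  have "real (overhead L) = 1452 * real L + 1628 + real search_cost"
    by (simp add: overhead_def algebra_simps)
  then have "real (overhead L) \<le> 1700 * (real L + 1) + 64 * (K * P)" using sc by simp
  then have "real (overhead L) * (3 * K) \<le> (1700 * (real L + 1) + 64 * (K * P)) * (3 * K)"
    using KP by (intro mult_right_mono) auto
  also have "\<dots> = 5100 * ((real L + 1) * K) + 192 * (P * K\<^sup>2)" by (simp add: algebra_simps power2_eq_square)
  finally have 2: "real (overhead L) * (3 * K) \<le> 204768 * t" using LK PK by linarith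
  have "real (run_cost (overhead L) + 20) \<le> 207000 * t + 200 * real \<kappa> * real bt * t"
  proof -
    have "40 * real (n div g) \<le> 200 * real \<kappa> * real bt * t"
      using mult_left_mono[OF s, of 40] by simp
    moreover have "40 \<le> 40 * t" using t(1) by simp
    ultimately show ?thesis unfolding r using 1 2 by linarith
  qed
  also have "207000 * t \<le> 207000 * real bt * t"
    using bt t(1) by simp
  finally show ?thesis unfolding L_def by (simp add: algebra_simps)
qed

end

section \<open>The whole program\<close>

context bounded_ram
begin

lemma T_initialise:
  fixes m :: "nat \<Rightarrow> nat" and \<kappa> c bt i j n ny k l N lp e1 q :: nat
  defines "e1 \<equiv> nat \<lfloor>eps I * real k\<rfloor>"
  defines "q \<equiv> nat \<lfloor>eps I * real e1\<rfloor> div (\<kappa> * bt)"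
  defines "lp \<equiv> max 1 (min l (n + 1))"
  assumes m: "m 0 = n" "m 1 = ny" "m 2 = k" "m 3 = l" "m 13 = 0" "m 14 = 1" and N: "N = n + ny + 3"
    and bt: "N < 2 ^ bt" "2 ^ bt \<le> 2 * N"
    and i: "4 * (k + 1) * lp \<le> 2 ^ i" "2 ^ i < 2 * (4 * (k + 1) * lp)"
    and j: "j = 0 \<or> 2 ^ j \<le> q" "q < 2 ^ (j + 1)"
    and w: "N < B" "\<kappa> * bt < B" "\<kappa> < B" "q < B" "e1 < B" "k < B" "c < B" "c * bt < B" "4 * (k + 1) * lp < B"
    and a: "4 * bt + 4 * i + 5 * j + 60 \<le> a"
  shows "T (initialise \<kappa> c) a m (\<lambda>b m'. a \<le> b + 4 * bt + 4 * i + 5 * j + 60 \<and>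
     m' 11 = c * bt \<and> m' 12 = 0 \<and> m' 0 = n \<and> m' 1 = ny \<and> m' 2 = k \<and> m' 4 = lp \<and> m' 6 = 2 ^ i \<and> m' 8 = 2 ^ j \<and>
     m' 9 = k + e1 div 2 \<and> m' 10 = k + e1 div 2 + 1 \<and> m' 13 = 0 \<and> m' 14 = 1 \<and> m' 15 = 2 * k + 1)"
  unfolding initialise_def
proof (intro T_seq, rule T_mono[OF T_init_window], goal_cases)
  case (5 b1 m1)
  then have m1: "m1 = m(4 := lp)" and b1: "a \<le> b1 + 10" using m by (auto simp: lp_def)
  show ?case
  proof (rule T_seq, rule T_mono[OF T_init_bits[where N = N and bt = bt]], goal_cases)
    case (7 b2 m2)
    then have m2: "m2 5 = bt" "\<And>r. r \<notin> {5,45,46} \<Longrightarrow> m2 r = m1 r" and b2: "a \<le> b2 + 4 * bt + 20"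
      using b1 by auto
    show ?case
    proof (rule T_seq, rule T_mono[OF T_init_spacing[where M = "4 * (k + 1) * lp" and i = i]], goal_cases)
      case (8 b3 m3)
      then have m3: "m3 6 = 2 ^ i" "\<And>r. r \<notin> {6,45} \<Longrightarrow> m3 r = m2 r" and b3: "a \<le> b3 + 4 * bt + 4 * i + 30"
        using b2 by auto
      have m35: "m3 5 = bt" "m3 2 = k" using m2 m3 m1 m by auto
      show ?case
      proof (rule T_seq, rule T_mono[OF T_init_stride[where j = j]], goal_cases)
        case (8 b4 m4)
        then have m4: "m4 8 = 2 ^ j" "m4 7 = e1" "\<And>r. r \<notin> {7,8,45,46,47} \<Longrightarrow> m4 r = m3 r"
          and b4: "a \<le> b4 + 4 * bt + 4 * i + 5 * j + 50"
          using b3 m35 by (auto simp: e1_def)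
        have m4r: "m4 5 = bt" "m4 2 = k" "m4 14 = 1" using m4 m3 m2 m1 m by auto
        show ?case
        proof (rule T_mono[OF T_init_constants], goal_cases)
          case (7 b5 m5)
          then show ?case using m4 m3 m2 m1 m b4 by auto
        qed (use m4 m4r w B_word a b4 in auto)
      qed (use m1 m2 m3 m35 m w B_word a b3 j in \<open>auto simp: q_def e1_def\<close>)
    qed (use m1 m2 m w B_word a b2 i in \<open>auto simp: lp_def\<close>)
  qed (use m1 m w B_word a b1 N bt in auto)
qed (use m w B_word a N in auto)

lemma V_skip_unless:
  assumes "V rest f b m u" "m r < m s \<Longrightarrow> False" "b + 2 \<le> a"
  shows "V (IfL r s (Stp False) (Blk []) ;; rest) f a m u"
proof (rule V_seq_T[where Q = "\<lambda>b' m'. b' = a - 2 \<and> m' = m"])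
  show "T (IfL r s (Stp False) (Blk [])) a m (\<lambda>b' m'. b' = a - 2 \<and> m' = m)"
    by (intro T_IfL T_Blk) (use assms in auto)
qed (use assms in \<open>auto intro: V_mono\<close>)

text \<open>The largest quantities are the cut distance, quadratic in \<open>N\<close>, and
  \<open>\<kappa> * bt\<close> and \<open>c * bt\<close>, linear in \<open>N\<close>; the cubic
  \<open>B\<close> covers them all.\<close>

lemma V_gap_algorithm:
  fixes X Y :: "nat list" and k l c N n ny :: nat and \<epsilon> :: real
  defines "\<kappa> \<equiv> 100 * (c + 1)"
  assumes I: "I = Input X Y k l \<epsilon>" and n: "n = length X" "ny = length Y" and N: "N = n + ny + 3"
    and eps: "0 < \<epsilon>" "\<epsilon> < 1"
    and per: "\<And>i. i + l \<le> length X \<Longrightarrow> per (substring X i (i + l)) > 2 * k"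
    and B: "B = (\<kappa> + c + 20) * N ^ 3"
  shows "\<exists>a bt. V (gap_algorithm \<kappa> c) (\<lambda>_ _. 1) a (init_mem I) (1 / real N ^ c) \<and> 2 ^ bt \<le> 2 * N \<and>
     real a \<le> (200 + c * (207000 + 200 * \<kappa>)) * (real bt)\<^sup>2 * time_bound I"
proof -
  have N3: "3 \<le> N" using N by simp
  have N1: "N \<le> N ^ 3" "N * N \<le> N ^ 3"
    using N3 by (simp_all add: power3_eq_cube)
  have NB: "20 * N ^ 3 \<le> B" "\<kappa> * N ^ 3 \<le> B" "c * N ^ 3 \<le> B"
    unfolding B by (simp_all add: algebra_simps)
  have NB': "20 * N \<le> B" "20 * (N * N) \<le> B" using NB N1 by linarith+
  obtain bt where bt: "0 < bt" "N < 2 ^ bt" "2 ^ bt \<le> 2 * N" using power_two_above[of N] N3 by auto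
  have btN: "bt \<le> N"
  proof -
    obtain b' where b': "bt = Suc b'" using bt(1) by (cases bt) auto
    have "b' < 2 ^ b'" by (rule less_exp)
    moreover have "2 ^ b' \<le> N" using bt(3) b' by simp
    ultimately show ?thesis unfolding b' by linarith
  qed
  have tb: "1 \<le> time_bound I" by (simp add: time_bound_def)
  have m0: "init_mem I 0 = n" "init_mem I 1 = ny" "init_mem I 2 = k" "init_mem I 3 = l" "init_mem I 13 = 0"
    using I n by (simp_all add: init_mem_def)
  define m1 where "m1 = (init_mem I)(14 := 1, 45 := n + ny)"
  have w: "n + ny < 2 ^ w" using N NB' B_word by linarith
  have e1: "effs [Const 14 1, Op Add 45 0 1] (init_mem I) = m1"
    using m0 w by (simp add: m1_def)
  have EDl: "ED X Y = lev (char_at X) (char_at Y) n ny" by (simp add: ED_eq_lev n)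
  have EDu: "ED X Y \<le> n + ny" unfolding EDl by (rule lev_le_add)
  have EDd: "n \<le> ny + ED X Y" "ny \<le> n + ED X Y" using lev_ge_diff[of n ny] unfolding EDl by auto
  have cheap: "real 20 \<le> (200 + c * (207000 + 200 * \<kappa>)) * (real bt)\<^sup>2 * time_bound I"
  proof -
    have "20 * 1 * 1 \<le> (200 + real c * (207000 + 200 * \<kappa>)) * (real bt)\<^sup>2 * time_bound I"
      using bt(1) tb by (intro mult_mono) (auto simp: one_le_power)
    then show ?thesis by simp
  qed
  have start: "V (gap_algorithm \<kappa> c) f a (init_mem I) u"
    if "V (IfL 2 45 (Blk []) (Stp True) ;;
     Blk [Op Add 45 0 2] ;; IfL 45 1 (Stp False) (Blk []) ;;
     Blk [Op Add 45 1 2] ;; IfL 45 0 (Stp False) (Blk []) ;;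
     initialise \<kappa> c ;; main_loop) f (a - 2) m1 u" "2 \<le> a" for f a u
    unfolding gap_algorithm_def
  proof (rule V_seq_T[where Q = "\<lambda>b m. b = a - 2 \<and> m = m1"])
    show "T (Blk [Const 14 1, Op Add 45 0 1]) a (init_mem I) (\<lambda>b m. b = a - 2 \<and> m = m1)"
      by (intro T_Blk) (use e1 that in auto)
  qed (use that in auto)
  have r1: "m1 2 = k" "m1 45 = n + ny" "m1 0 = n" "m1 1 = ny" "m1 13 = 0" "m1 14 = 1" "m1 3 = l"
    using m0 by (simp_all add: m1_def)
  have u0: "0 \<le> 1 / real N ^ c" by simp
  show ?thesis
  proof (cases "k < n + ny")
    case False
    have "V (IfL 2 45 (Blk []) (Stp True)) (\<lambda>_ _. 1) 18 m1 (1 / real N ^ c)"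
      by (intro V_IfL V_Stp) (use False r1 EDu I in \<open>auto simp: correct_answer_def\<close>)
    then have "V (gap_algorithm \<kappa> c) (\<lambda>_ _. 1) 20 (init_mem I) (1 / real N ^ c)"
      by (intro start V_seq[where g = "\<lambda>_ _. 1"]) auto
    then show ?thesis using cheap bt(3) by blast
  next
    case True
    note kn = True
    have kN: "k < N" using kn N by simp
    define m2 where "m2 = m1(45 := n + k)"
    define m3 where "m3 = m2(45 := ny + k)"
    have w2: "n + k < 2 ^ w" "ny + k < 2 ^ w" using N kn NB' B_word by linarith+
    have e2: "effs [Op Add 45 0 2] m1 = m2" using r1 w2 by (simp add: m2_def)
    have e3: "effs [Op Add 45 1 2] m2 = m3" using r1 w2 by (simp add: m2_def m3_def)
    have start2: "V (gap_algorithm \<kappa> c) f (a + 5) (init_mem I) u"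
      if V: "V (IfL 45 1 (Stp False) (Blk []) ;;
       Blk [Op Add 45 1 2] ;; IfL 45 0 (Stp False) (Blk []) ;;
       initialise \<kappa> c ;; main_loop) f a m2 u" for f a u
    proof (rule start)
      show "V (IfL 2 45 (Blk []) (Stp True) ;;
       Blk [Op Add 45 0 2] ;; IfL 45 1 (Stp False) (Blk []) ;;
       Blk [Op Add 45 1 2] ;; IfL 45 0 (Stp False) (Blk []) ;;
       initialise \<kappa> c ;; main_loop) f (a + 5 - 2) m1 u"
      proof (rule V_seq_T[where Q = "\<lambda>b m. b = a + 1 \<and> m = m1"])
        show "T (IfL 2 45 (Blk []) (Stp True)) (a + 5 - 2) m1 (\<lambda>b m. b = a + 1 \<and> m = m1)"
          by (intro T_IfL T_Blk) (use r1 kn in auto)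
      next
        fix b m assume "b = a + 1 \<and> m = m1"
        moreover have "T (Blk [Op Add 45 0 2]) (a + 1) m1 (\<lambda>b m. b = a \<and> m = m2)"
          by (intro T_Blk) (use e2 in auto)
        ultimately show "V (Blk [Op Add 45 0 2] ;; IfL 45 1 (Stp False) (Blk []) ;;
            Blk [Op Add 45 1 2] ;; IfL 45 0 (Stp False) (Blk []) ;;
            initialise \<kappa> c ;; main_loop) f b m u"
          using V by (auto intro: V_seq_T)
      qed
    qed simp
    have r2: "m2 45 = n + k" "m2 1 = ny" "m2 0 = n" using r1 by (simp_all add: m2_def)
    have r3: "m3 45 = ny + k" "m3 0 = n" "m3 1 = ny" "m3 2 = k" "m3 3 = l" "m3 13 = 0" "m3 14 = 1"
      using r1 by (simp_all add: m2_def m3_def)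
    show ?thesis
    proof (cases "n + k < ny")
      case True
      have "V (IfL 45 1 (Stp False) (Blk [])) (\<lambda>_ _. 1) 15 m2 (1 / real N ^ c)"
        by (intro V_IfL V_Stp) (use True r2 EDd I in \<open>auto simp: correct_answer_def\<close>)
      then have "V (gap_algorithm \<kappa> c) (\<lambda>_ _. 1) (15 + 5) (init_mem I) (1 / real N ^ c)"
        by (intro start2 V_seq[where g = "\<lambda>_ _. 1"]) auto
      then show ?thesis using cheap bt(3) by (intro exI[of _ 20] exI[of _ bt]) simp
    next
      case False
      note c1 = False
      have start3: "V (gap_algorithm \<kappa> c) f (a + 8) (init_mem I) u"
        if V: "V (IfL 45 0 (Stp False) (Blk []) ;; initialise \<kappa> c ;; main_loop) f a m3 u" for f a u
      proof -
        have "V (Blk [Op Add 45 1 2] ;; IfL 45 0 (Stp False) (Blk []) ;; initialise \<kappa> c ;; main_loop) f (a + 1) m2 u"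
        proof (rule V_seq_T[where Q = "\<lambda>b m. b = a \<and> m = m3"])
          show "T (Blk [Op Add 45 1 2]) (a + 1) m2 (\<lambda>b m. b = a \<and> m = m3)"
            by (intro T_Blk) (use e3 in auto)
        qed (use V in auto)
        then have "V (IfL 45 1 (Stp False) (Blk []) ;; Blk [Op Add 45 1 2] ;; IfL 45 0 (Stp False) (Blk []) ;;
          initialise \<kappa> c ;; main_loop) f (a + 3) m2 u"
          by (rule V_skip_unless) (use r2 c1 in auto)
        from start2[OF this] show ?thesis by (simp add: add.commute)
      qed
      show ?thesis
      proof (cases "ny + k < n")
        case True
        have "V (IfL 45 0 (Stp False) (Blk [])) (\<lambda>_ _. 1) 12 m3 (1 / real N ^ c)"
          by (intro V_IfL V_Stp) (use True r3 EDd I in \<open>auto simp: correct_answer_def\<close>)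
        then have "V (gap_algorithm \<kappa> c) (\<lambda>_ _. 1) (12 + 8) (init_mem I) (1 / real N ^ c)"
          by (intro start3 V_seq[where g = "\<lambda>_ _. 1"]) auto
        then show ?thesis using cheap bt(3) by (intro exI[of _ 20] exI[of _ bt]) simp
      next
        case False
        note c2 = False
        define lp where "lp = max 1 (min l (n + 1))"
        define e1 where "e1 = nat \<lfloor>eps I * real k\<rfloor>"
        define q where "q = nat \<lfloor>eps I * real e1\<rfloor> div (\<kappa> * bt)"
        have epsI: "eps I = \<epsilon>" using I by simp
        have lp: "1 \<le> lp" "lp \<le> n + 1" by (auto simp: lp_def)
        have M0: "0 < 4 * (k + 1) * lp" using lp by simp
        obtain i where i: "4 * (k + 1) * lp \<le> 2 ^ i" "2 ^ i < 2 * (4 * (k + 1) * lp)"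
          using power_two_ceiling[OF M0] by blast
        obtain j where j: "j = 0 \<or> 2 ^ j \<le> q" "q < 2 ^ (j + 1)" using power_two_floor[of q] by blast
        have fl: "nat \<lfloor>\<epsilon> * real x\<rfloor> \<le> x" for x :: nat
        proof -
          have "\<epsilon> * real x \<le> 1 * real x" using eps by (intro mult_right_mono) auto
          then show ?thesis by linarith
        qed
        have e1k: "e1 \<le> k" using fl[of k] by (simp add: e1_def epsI)
        have "q \<le> nat \<lfloor>eps I * real e1\<rfloor>" unfolding q_def by (rule div_le_dividend)
        then have qk: "q \<le> k" using fl[of e1] e1k epsI by simp
        have lpN: "lp \<le> N" using lp N by simp
        have MN: "(k + 1) * lp \<le> N * N" using kN lpN by (intro mult_le_mono) auto
        have MN8: "8 * ((k + 1) * lp) \<le> 8 * (N * N)" using MN by (rule mult_le_mono2)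
        moreover have "0 < N * N" using N3 by simp
        ultimately have MB: "8 * ((k + 1) * lp) < B" using NB'(2) by linarith
        have M8: "2 * (4 * (k + 1) * lp) = 8 * ((k + 1) * lp)" by (simp add: algebra_simps)
        have iB: "2 ^ i < B" using i(2) MB unfolding M8 by linarith
        have Bsum: "B = \<kappa> * N ^ 3 + c * N ^ 3 + 20 * N ^ 3" unfolding B by (simp add: algebra_simps)
        have cube: "0 < N ^ 3" "bt \<le> N ^ 3" using N3 btN N1 by (simp, linarith)
        have "\<kappa> * bt \<le> \<kappa> * N ^ 3" "c * bt \<le> c * N ^ 3" "\<kappa> * 1 \<le> \<kappa> * N ^ 3" "c * 1 \<le> c * N ^ 3"
          using cube by (intro mult_le_mono2; linarith)+
        then have \<kappa>B: "\<kappa> * bt < B" "c * bt < B" "\<kappa> < B" "c < B"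
          unfolding Bsum using cube(1) by linarith+
        have jg: "2 ^ j \<le> max 1 q" using j(1) by auto
        interpret S: sampler w I B n ny k lp "2 ^ i" "2 ^ j" "k + e1 div 2"
        proof
          show "n \<le> B" "ny \<le> B" "k \<le> B" "lp \<le> B" using N kN lpN NB'(1) by auto
          show "2 ^ i \<le> B" using iB by simp
          show "2 ^ j \<le> B" using jg qk kN NB'(1) N3 by simp
          show "k + e1 div 2 \<le> 2 * B" using e1k kN NB'(1) by linarith
          have *: "(2::nat) ^ x dvd 2 ^ w" if "2 ^ x \<le> B" for x
          proof -
            have "(2::nat) ^ x \<le> 2 ^ w" using that B_word by linarith
            then show ?thesis by (simp add: le_imp_power_dvd)
          qed
          show "(2::nat) ^ i dvd 2 ^ w" using iB by (intro *) simp
          show "(2::nat) ^ j dvd 2 ^ w" using jg qk kN NB'(1) N3 by (intro *) simp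
        qed auto
        define \<beta> where "\<beta> = S.overhead (min n (2 ^ i + lp))"
        define a1 where "a1 = c * bt * (S.run_cost \<beta> + 20) + 10"
        define a0 where "a0 = a1 + 4 * bt + 4 * i + 5 * j + 60"
        have NlB: "N < B" using NB'(1) N3 by linarith
        have "4 * (k + 1) * lp < B" using iB i(1) by linarith
        then have W: "N < B" "\<kappa> * bt < B" "\<kappa> < B" "q < B" "e1 < B" "k < B" "c < B" "c * bt < B"
            "4 * (k + 1) * lp < B"
          using NlB \<kappa>B qk e1k kN by auto
        have "V (initialise \<kappa> c ;; main_loop) (\<lambda>_ _. 1) a0 m3 (1 / real N ^ c)"
        proof (rule V_seq_T[OF T_initialise[OF r3(2-7) N bt(2,3) i[unfolded lp_def]
              j[unfolded q_def e1_def] W[unfolded lp_def q_def e1_def]]])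
          show "4 * bt + 4 * i + 5 * j + 60 \<le> a0" by (simp add: a0_def)
        next
          fix b and m :: "nat \<Rightarrow> nat"
          assume post: "a0 \<le> b + 4 * bt + 4 * i + 5 * j + 60 \<and>
             m 11 = c * bt \<and> m 12 = 0 \<and> m 0 = n \<and> m 1 = ny \<and> m 2 = k \<and> m 4 = max 1 (min l (n + 1)) \<and> m 6 = 2 ^ i \<and> m 8 = 2 ^ j \<and>
             m 9 = k + nat \<lfloor>eps I * real k\<rfloor> div 2 \<and> m 10 = k + nat \<lfloor>eps I * real k\<rfloor> div 2 + 1 \<and> m 13 = 0 \<and> m 14 = 1 \<and> m 15 = 2 * k + 1"
          show "V main_loop (\<lambda>_ _. 1) b m (1 / real N ^ c)"
          proof (rule S.V_main[where \<epsilon> = \<epsilon> and \<kappa> = \<kappa> and bt = bt and c = c and N = N])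
            have "4 * k * lp \<le> 4 * (k + 1) * lp" by (intro mult_le_mono) auto
            then show "4 * k * lp \<le> 2 ^ i" using i(1) by (rule order_trans)
            show "S.conf m" unfolding S.conf_def using post by (simp add: lp_def e1_def)
            show "s = t" if "c + lp \<le> n" "matches lp c s" "matches lp c t" "s \<le> c + k" "c \<le> s + k" "t \<le> c + k" "c \<le> t + k" for c s t
              using matches_unique[of l k c s t] per that by (simp add: lp_def n I)
            show "2 ^ j = 1 \<or> 2 ^ j \<le> nat \<lfloor>\<epsilon> * real (nat \<lfloor>\<epsilon> * real k\<rfloor>)\<rfloor> div (\<kappa> * bt)"
              using j(1) by (auto simp: q_def e1_def epsI)
            show "c * bt * (S.run_cost (S.overhead (min n (2 ^ i + lp))) + 20) + 10 \<le> b"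
              using post unfolding a0_def a1_def \<beta>_def by simp
          qed (use I n eps kn bt i(1) post \<kappa>B B_word in \<open>auto simp: \<kappa>_def e1_def\<close>)
        qed
        then have "V (IfL 45 0 (Stp False) (Blk []) ;; initialise \<kappa> c ;; main_loop) (\<lambda>_ _. 1) (a0 + 2) m3 (1 / real N ^ c)"
          by (rule V_skip_unless) (use r3 c2 in auto)
        from start3[OF this] have V: "V (gap_algorithm \<kappa> c) (\<lambda>_ _. 1) (a0 + 10) (init_mem I) (1 / real N ^ c)"
          by (simp add: add.commute)
        have t: "time_bound I = max 1 (1 / (\<epsilon>\<^sup>2 * (real k + 1)) * real n + (real k)\<^sup>2 * real l)"
          using I n by (simp add: time_bound_def)
        have e2: "0 < \<epsilon>\<^sup>2" "\<epsilon>\<^sup>2 \<le> 1" using eps by (auto simp: power_le_one)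
        have t1: "1 / (\<epsilon>\<^sup>2 * (real k + 1)) * real n \<le> time_bound I"
          and t2: "(real k)\<^sup>2 * real l \<le> time_bound I"
        proof -
          have "0 \<le> 1 / (\<epsilon>\<^sup>2 * (real k + 1)) * real n" "0 \<le> (real k)\<^sup>2 * real l" by auto
          then show "1 / (\<epsilon>\<^sup>2 * (real k + 1)) * real n \<le> time_bound I" "(real k)\<^sup>2 * real l \<le> time_bound I"
            unfolding t by linarith+
        qed
        have nt: "real n \<le> (real k + 1) * time_bound I"
        proof -
          have "real n * \<epsilon>\<^sup>2 \<le> real n * 1" using e2 by (intro mult_left_mono) auto
          then have "real n \<le> real n / \<epsilon>\<^sup>2" using e2 by (simp add: pos_le_divide_eq)
          moreover have "real n / \<epsilon>\<^sup>2 = (real k + 1) * (1 / (\<epsilon>\<^sup>2 * (real k + 1)) * real n)"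
          proof -
            have "real n / \<epsilon>\<^sup>2 = K * (1 / (\<epsilon>\<^sup>2 * K) * real n)" if "K \<noteq> 0" for K using that by simp
            from this[of "real k + 1"] show ?thesis by simp
          qed
          moreover have "(real k + 1) * (1 / (\<epsilon>\<^sup>2 * (real k + 1)) * real n) \<le> (real k + 1) * time_bound I"
            using t1 by (intro mult_left_mono) auto
          ultimately show ?thesis by linarith
        qed
        \<comment> \<open>For \<open>k > 0\<close> the hypothesis on the periods gives
          \<open>l > 0\<close>, so the window length is at most \<open>l\<close>, and
          \<open>(k + 1)\<^sup>2 \<le> 4 * k\<^sup>2\<close>. For \<open>k = 0\<close> the second
          term of the time bound vanishes, and the first, at least \<open>|X|\<close>, takes
          over.\<close>
        have lpt: "real lp * (real k + 1)\<^sup>2 \<le> 4 * time_bound I"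
        proof (cases "k = 0")
          case True
          have "real lp \<le> real n + 1" using lp(2) by linarith
          then show ?thesis using True nt tb by simp
        next
          case False
          have "l \<noteq> 0"
          proof
            assume "l = 0"
            have "is_period 1 ([] :: nat list)" by (simp add: is_period_def)
            then have "Defs.per ([] :: nat list) \<le> 1" unfolding per_def by (rule Least_le)
            then show False using per[of 0] \<open>l = 0\<close> False by (simp add: substring_def)
          qed
          then have "real lp \<le> real l" by (simp add: lp_def)
          moreover have "(real k + 1)\<^sup>2 \<le> (2 * real k)\<^sup>2" using False by (intro power_mono) auto
          ultimately have "real lp * (real k + 1)\<^sup>2 \<le> real l * (2 * real k)\<^sup>2" by (intro mult_mono) auto
          also have "\<dots> = 4 * ((real k)\<^sup>2 * real l)" by (simp add: power2_eq_square)
          finally show ?thesis using t2 by linarith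
        qed
        have strides: "real (n div 2 ^ j) \<le> 5 * real \<kappa> * real bt * time_bound I"
          by (rule uniform_stride_cost[OF eps _ _ _ _ t1])
            (use j(2) bt(1) in \<open>auto simp: q_def e1_def epsI \<kappa>_def\<close>)
        have rc: "real (S.run_cost \<beta> + 20) \<le> (207000 + 200 * real \<kappa>) * real bt * time_bound I"
          unfolding \<beta>_def
          by (rule S.run_cost_bound[OF tb nt lpt i(1) _ lp(1) _ strides])
            (use i(2) bt(1) in \<open>simp_all add: algebra_simps\<close>)
        have "(2::nat) ^ i < 2 ^ (2 * bt + 3)"
        proof -
          have "2 ^ i < 8 * (N * N)" using i(2) MN8 unfolding M8 by (rule less_le_trans)
          also have "\<dots> \<le> 8 * (2 ^ bt * 2 ^ bt)" by (intro mult_le_mono order_refl less_imp_le bt(2))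
          also have "\<dots> = 2 ^ (2 * bt + 3)" by (simp only: mult_2[of bt] power_add) simp
          finally show ?thesis .
        qed
        then have ib: "i < 2 * bt + 3" by simp
        have jb: "j \<le> bt"
        proof (cases "j = 0")
          case False
          then have "(2::nat) ^ j < 2 ^ bt" using j(1) qk kN bt(2) by linarith
          then show ?thesis by simp
        qed simp
        have "real (4 * bt + 4 * i + 5 * j + 80) \<le> 200 * real bt" using ib jb bt(1) by simp
        also have "\<dots> \<le> 200 * ((real bt)\<^sup>2 * time_bound I)"
        proof -
          have "real bt * 1 * 1 \<le> real bt * real bt * time_bound I" using bt(1) tb by (intro mult_mono) auto
          then show ?thesis by (simp add: power2_eq_square)
        qed
        finally have A: "real (4 * bt + 4 * i + 5 * j + 80) \<le> 200 * ((real bt)\<^sup>2 * time_bound I)" .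
        have "real (c * bt) * real (S.run_cost \<beta> + 20) \<le> real (c * bt) * ((207000 + 200 * real \<kappa>) * real bt * time_bound I)"
          using rc by (intro mult_left_mono) auto
        also have "\<dots> = c * (207000 + 200 * real \<kappa>) * ((real bt)\<^sup>2 * time_bound I)"
          by (simp add: power2_eq_square)
        finally have "real (c * bt * (S.run_cost \<beta> + 20)) \<le> c * (207000 + 200 * real \<kappa>) * ((real bt)\<^sup>2 * time_bound I)"
          by simp
        moreover have "real (a0 + 10) = real (c * bt * (S.run_cost \<beta> + 20)) + real (4 * bt + 4 * i + 5 * j + 80)"
          by (simp add: a0_def a1_def)
        ultimately have "real (a0 + 10) \<le> (200 + c * (207000 + 200 * \<kappa>)) * (real bt)\<^sup>2 * time_bound I"
          using A by (simp add: algebra_simps)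
        then show ?thesis using V bt(3) by blast
      qed
    qed
  qed
qed

end

theorem theorem5p4:
  fixes c :: nat
  shows "\<exists>(P :: program) (a :: nat) (C :: real) (d :: nat).
    \<forall>(w :: nat) (X :: nat list) (Y :: nat list) (k :: nat) (l :: nat) (\<epsilon> :: real) I N.
      I = Input X Y k l \<epsilon> \<longrightarrow>
      N = input_size I \<longrightarrow>
      0 < \<epsilon> \<longrightarrow> \<epsilon> < 1 \<longrightarrow>
      (\<forall>i. i + l \<le> length X \<longrightarrow> per (substring X i (i + l)) > 2 * k) \<longrightarrow>
      fits_in_words w I \<longrightarrow> N ^ a \<le> 2 ^ w \<longrightarrow>
      measure_pmf.prob
        (run w P I (nat \<lfloor>C * (ln (real N)) ^ d * time_bound I\<rfloor>))
        {s. \<exists>b. s = Halted b \<and> correct_answer I b}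
      \<ge> 1 - 1 / real N ^ c"
proof -
  define \<kappa> where "\<kappa> = 100 * (c + 1)"
  \<comment> \<open>Words have to hold \<open>1000 * B = h * N ^ 3\<close>. Since
    \<open>h < 2 ^ h \<le> N ^ h\<close>, the exponent \<open>h + 3\<close>, which depends only on
    \<open>c\<close>, suffices.\<close>
  define h where "h = 1000 * (\<kappa> + c + 20)"
  define K where "K = 200 + real c * (207000 + 200 * \<kappa>)"
  \<comment> \<open>One factor \<open>bt\<close> comes from the number of runs, the other from the
    stride; \<open>bt \<le> 5 / 2 * ln N\<close> turns them into the exponent \<open>2\<close> and
    the factor \<open>25 / 4\<close>.\<close>
  have "1 - 1 / real N ^ c \<le> measure_pmf.prob
      (run w (compile 0 (gap_algorithm \<kappa> c)) I (nat \<lfloor>K * (25 / 4) * (ln (real N)) ^ 2 * time_bound I\<rfloor>))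
      {s. \<exists>b. s = Halted b \<and> correct_answer I b}"
    if I: "I = Input X Y k l \<epsilon>" and N: "N = input_size I" and eps: "0 < \<epsilon>" "\<epsilon> < 1"
      and per: "\<forall>i. i + l \<le> length X \<longrightarrow> per (substring X i (i + l)) > 2 * k"
      and fits: "fits_in_words w I" and w: "N ^ (h + 3) \<le> 2 ^ w"
    for w X Y k l \<epsilon> I N
  proof -
    have N3: "N = length X + length Y + 3" using I N by (simp add: input_size_def)
    define B where "B = (\<kappa> + c + 20) * N ^ 3"
    have "h < 2 ^ h" by (rule less_exp)
    also have "(2::nat) ^ h \<le> N ^ h" using N3 by (intro power_mono) auto
    finally have "h * N ^ 3 \<le> N ^ h * N ^ 3" by (intro mult_right_mono) auto
    also have "\<dots> \<le> 2 ^ w" using w by (simp add: power_add)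
    finally have "1000 * B \<le> 2 ^ w" by (simp add: B_def h_def algebra_simps)
    then interpret bounded_ram w I B
      by unfold_locales (use N3 in \<open>auto simp: B_def\<close>)
    obtain a bt where a: "V (gap_algorithm \<kappa> c) (\<lambda>_ _. 1) a (init_mem I) (1 / real N ^ c)" "2 ^ bt \<le> 2 * N"
      "real a \<le> K * (real bt)\<^sup>2 * time_bound I"
      using V_gap_algorithm[OF I refl refl N3 eps per[rule_format], of c] B_def
      unfolding K_def \<kappa>_def by auto
    define P where "P = compile 0 (gap_algorithm \<kappa> c)"
    define t where "t = nat \<lfloor>K * (25 / 4) * (ln (real N)) ^ 2 * time_bound I\<rfloor>"
    have "real a \<le> K * (25 / 4) * (ln (real N)) ^ 2 * time_bound I"
    proof -
      have "real bt \<le> 5 / 2 * ln (real N)" by (rule log_exponent[OF a(2)]) (use N3 in simp)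
      then have "(real bt)\<^sup>2 \<le> (5 / 2 * ln (real N))\<^sup>2" by (intro power_mono) auto
      also have "\<dots> = 25 / 4 * (ln (real N))\<^sup>2" by (simp add: power2_eq_square)
      finally have "K * (real bt)\<^sup>2 * time_bound I \<le> K * (25 / 4 * (ln (real N))\<^sup>2) * time_bound I"
        by (intro mult_right_mono mult_left_mono) (auto simp: K_def time_bound_def)
      then show ?thesis using a(3) by simp
    qed
    then have "a \<le> t" unfolding t_def by (rule le_nat_floor)
    then have "bad P t (Running 0 (init_mem I)) \<le> bad P a (Running 0 (init_mem I))"
      by (rule bad_antimono)
    moreover have "bad P (a + 0) (Running 0 (init_mem I)) \<le> 1 / real N ^ c"
    proof (rule VD[OF a(1)])
      have "P = [] @ compile 0 (gap_algorithm \<kappa> c) @ []" by (simp add: P_def)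
      then show "code_at P 0 (compile 0 (gap_algorithm \<kappa> c))" unfolding code_at_def by blast
    qed (rule bad_le_1)
    ultimately have "bad P t (Running 0 (init_mem I)) \<le> 1 / real N ^ c" by simp
    then have "measure_pmf.prob (run w P I t) (- good) \<le> 1 / real N ^ c"
      by (simp add: bad_def run_eq_run_from)
    moreover have "measure_pmf.prob (run w P I t) (- good) = 1 - measure_pmf.prob (run w P I t) good"
      using measure_pmf.prob_compl[of good "run w P I t"] by (simp add: Compl_eq_Diff_UNIV)
    ultimately show ?thesis by (simp add: good_def P_def t_def)
  qed
  then show ?thesis by blast
qed

end
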